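(* There exist absolute (numerical) constants $A_0>0$ and $c_0>0$ such that the following holds. Let $p\ge 2$, let $X\in\mathbb{R}^{n\times p}$ have unit-normed columns and obey the coherence property $\mu(X)\le A_0(\log p)^{-1}$, and let $\sigma>0$. Let $S\ge 1$ be an integer with $$S\le \frac{c_0\,p}{\|X\|^2\log p}.$$ Let $\beta\in\mathbb{R}^p$ be drawn from the generic $S$-sparse model, let $z\sim\mathcal{N}(0,\sigma^2 I_n)$ be independent of $\beta$, and let $y=X\beta+z$. Then the lasso estimate $$\hat\beta\in\arg\min_{b\in\mathbb{R}^p}\ \tfrac12\|y-Xb\|_{\ell_2}^2+\lambda\sigma\|b\|_{\ell_1}\qquad\text{with }\lambda=2\sqrt{2\log p}$$ obeys $$\|X\beta-X\hat\beta\|_{\ell_2}^2\le C_0\cdot(2\log p)\cdot S\cdot\sigma^2$$ with probability at least $1-6p^{-2\log 2}-p^{-1}(2\pi\log p)^{-1/2}$, where the constant $C_0$ may be taken as $8(1+\sqrt2)^2$.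
   Context: $\|X\|$ is the operator norm (largest singular value) of $X$. Writing $X_i$ for the $i$th column of $X$ (with $\|X_i\|_{\ell_2}=1$), the coherence is $\mu(X)=\sup_{1\le i<j\le p}|\langle X_i,X_j\rangle|$. Generic $S$-sparse model: $\beta\in\mathbb{R}^p$ is a random vector such that (1) its support $I=\{i:\beta_i\ne0\}$ is selected uniformly at random among the subsets of $\{1,\dots,p\}$ of cardinality $S$; (2) conditional on $I$, the signs of the nonzero entries of $\beta$ are independent and equally likely to be $-1$ or $1$. No assumption is made on the amplitudes $|\beta_i|$, $i\in I$. The probability is over both $\beta$ and $z$. *)

theory Defs
  imports "HOL-Probability.Probability"
begin

text \<open>
  The constants of the theorem must not depend on the dimensions, so the dimensions are natural
  numbers rather than types: \<open>\<real>\<^sup>n\<close> is \<open>rvec n\<close>, the underlying set of the product space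
  \<open>\<Pi>\<^sub>M i\<in>{..<n}. borel\<close>, and an \<open>n \<times> p\<close> matrix is a function \<open>X\<close> of which only the entries
  \<open>X i j\<close> with \<open>i < n\<close> and \<open>j < p\<close> are used. Indices start at \<open>0\<close>.
\<close>

abbreviation rvec :: "nat \<Rightarrow> (nat \<Rightarrow> real) set" where
  "rvec n \<equiv> {..<n} \<rightarrow>\<^sub>E UNIV"

abbreviation norm2 :: "nat \<Rightarrow> (nat \<Rightarrow> real) \<Rightarrow> real" where
  "norm2 n v \<equiv> L2_set v {..<n}"

definition norm1 :: "nat \<Rightarrow> (nat \<Rightarrow> real) \<Rightarrow> real" where
  "norm1 p b = (\<Sum>j<p. \<bar>b j\<bar>)"

definition mat_vec :: "nat \<Rightarrow> (nat \<Rightarrow> nat \<Rightarrow> real) \<Rightarrow> (nat \<Rightarrow> real) \<Rightarrow> nat \<Rightarrow> real" where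
  "mat_vec p X b i = (\<Sum>j<p. X i j * b j)"

definition op_norm :: "nat \<Rightarrow> nat \<Rightarrow> (nat \<Rightarrow> nat \<Rightarrow> real) \<Rightarrow> real" where
  "op_norm n p X = (SUP b\<in>{b \<in> rvec p. norm2 p b \<le> 1}. norm2 n (mat_vec p X b))"

definition unit_columns :: "nat \<Rightarrow> nat \<Rightarrow> (nat \<Rightarrow> nat \<Rightarrow> real) \<Rightarrow> bool" where
  "unit_columns n p X \<longleftrightarrow> (\<forall>j<p. norm2 n (\<lambda>i. X i j) = 1)"

text \<open>A real supremum, hence meaningful only over a nonempty set of pairs, i.e. for \<open>p \<ge> 2\<close>.\<close>

definition coherence :: "nat \<Rightarrow> nat \<Rightarrow> (nat \<Rightarrow> nat \<Rightarrow> real) \<Rightarrow> real" where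
  "coherence n p X = (SUP (i, j)\<in>{(i, j). i < j \<and> j < p}. \<bar>\<Sum>k<n. X k i * X k j\<bar>)"

definition supp :: "nat \<Rightarrow> (nat \<Rightarrow> real) \<Rightarrow> nat set" where
  "supp p b = {i. i < p \<and> b i \<noteq> 0}"

text \<open>
  \<open>generic_sparse p S D\<close>: the probability measure \<open>D\<close> on \<open>\<real>\<^sup>p\<close> is the law of a vector from the
  generic \<open>S\<close>-sparse model. Conditioning on the event that the support is \<open>I\<close>, which has positive
  probability, is \<^const>\<open>uniform_measure\<close>. Nothing is said about the amplitudes, which may depend on
  the support and on the signs.
\<close>

definition generic_sparse :: "nat \<Rightarrow> nat \<Rightarrow> (nat \<Rightarrow> real) measure \<Rightarrow> bool" where
  "generic_sparse p S D \<longleftrightarrow>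
     prob_space D \<and> sets D = sets (\<Pi>\<^sub>M i\<in>{..<p}. (borel :: real measure)) \<and> S \<le> p \<and>
     distr D (count_space UNIV) (supp p) =
       measure_pmf (pmf_of_set {I. I \<subseteq> {..<p} \<and> card I = S}) \<and>
     (\<forall>I. I \<subseteq> {..<p} \<and> card I = S \<longrightarrow>
        (let D\<^sub>I = uniform_measure D {b \<in> space D. supp p b = I} in
           prob_space.indep_vars D\<^sub>I (\<lambda>_. borel) (\<lambda>i b. sgn (b i)) I \<and>
           (\<forall>i\<in>I. \<P>(b in D\<^sub>I. sgn (b i) = 1) = 1 / 2 \<and> \<P>(b in D\<^sub>I. sgn (b i) = - 1) = 1 / 2)))"

definition gaussian_noise :: "nat \<Rightarrow> real \<Rightarrow> (nat \<Rightarrow> real) measure" where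
  "gaussian_noise n \<sigma> = (\<Pi>\<^sub>M i\<in>{..<n}. density lborel (normal_density 0 \<sigma>))"

definition lasso_objective ::
  "nat \<Rightarrow> nat \<Rightarrow> (nat \<Rightarrow> nat \<Rightarrow> real) \<Rightarrow> (nat \<Rightarrow> real) \<Rightarrow> real \<Rightarrow> (nat \<Rightarrow> real) \<Rightarrow> real" where
  "lasso_objective n p X y \<tau> b =
     1 / 2 * (norm2 n (\<lambda>i. y i - mat_vec p X b i))\<^sup>2 + \<tau> * norm1 p b"

definition is_lasso ::
  "nat \<Rightarrow> nat \<Rightarrow> (nat \<Rightarrow> nat \<Rightarrow> real) \<Rightarrow> (nat \<Rightarrow> real) \<Rightarrow> real \<Rightarrow> (nat \<Rightarrow> real) \<Rightarrow> bool" where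
  "is_lasso n p X y \<tau> b \<longleftrightarrow> is_arg_min (lasso_objective n p X y \<tau>) (\<lambda>b. b \<in> rvec p) b"

end

theory Submission
  imports Defs
begin

text \<open>
  Let \<open>I\<close> be the support of \<open>\<beta>\<close>. The proof separates a deterministic statement about the lasso from
  probabilistic statements about \<open>I\<close>, the signs and the noise.

  \<^emph>\<open>Deterministic part.\<close> The optimality of \<open>\<beta>'\<close> is a variational inequality. It bounds the error by \<open>\<parallel>g\<parallel>\<^sup>2\<close>
  for any vector \<open>g\<close> that satisfies \<open>X\<^sub>I\<^sup>T g = X\<^sub>I\<^sup>T z - \<tau> sgn \<beta>\<^sub>I\<close> on the support and has small correlation
  with the other columns (\<open>lasso_error_le_dual_certificate\<close>). If the Gram matrix on \<open>I\<close> has least eigenvalue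
  at least \<open>1/2\<close>, such a \<open>g\<close> exists in the span of the columns of \<open>I\<close>, and \<open>\<parallel>g\<parallel>\<^sup>2\<close> is at most twice the
  squared norm of the right-hand side (\<open>lasso_error_bound\<close>). The correlation of \<open>g\<close> with a
  column off the support is a linear form in the signs and in the noise whose coefficients are governed by
  the projection of that column onto the span. They are small if the squared correlations of the column
  with the columns of \<open>I\<close> add up to a small multiple of \<open>1 / ln p\<close>; Hoeffding's inequality and the Gaussian tail
  do the rest.

  \<^emph>\<open>Random supports.\<close> It remains to see that a random \<open>I\<close> has these two properties (\<open>prob_not_good\<close>). Both follow
  from one inequality of matrix Chernoff type for \<open>W = \<Sum>i\<in>J. b\<^sub>i b\<^sub>i\<^sup>T\<close>, where \<open>J\<close> contains each index
  independently with probability \<open>\<delta>\<close> (\<open>frame_Chernoff\<close>). It is proved by elementary means: the expected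
  trace moments of \<open>W\<close> satisfy the recursion of Poisson moments. The key is the expansion of the powers of
  \<open>W + b b\<^sup>T\<close> at the vector \<open>b\<close>, together with the log-convexity of \<open>m \<mapsto> \<langle>b, W\<^sup>m b\<rangle>\<close>
  (\<open>frame_moment_insert_le\<close>, \<open>mean_frame_trace_Suc_le\<close>).

  The sum of squared correlations is a one-dimensional instance. For the Gram matrix, coherence must be
  exploited: the rank one operators of the columns have norm one and cannot concentrate. Therefore the
  off-diagonal part is decoupled by splitting the index set at random into \<open>T\<close> and its complement
  (\<open>decoupling_identity\<close>). Given the part of \<open>J\<close> outside of \<open>T\<close>, the rows of the block are short by the first
  property, and the Chernoff bound applies to them (\<open>prob_block_large\<close>); the mean in this application is controlled by a crude
  bound of order \<open>ln p\<close> for the squared norm of the submatrix, which is a third instance. Finally, a uniform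
  \<open>S\<close>-subset is a Bernoulli subset conditioned on its size, an event of probability at least \<open>1 / (p + 1)\<close>
  (\<open>uniform_subset_prob_le\<close>).

  \<^emph>\<open>Measurability.\<close> The vector \<open>X \<beta>'\<close> does not depend on the minimizer and is a nonexpansive function of
  the data, so the event is measurable (\<open>measurable_lasso_event\<close>).
\<close>

section \<open>Frame operators and their moments\<close>

definition ip :: "nat \<Rightarrow> (nat \<Rightarrow> real) \<Rightarrow> (nat \<Rightarrow> real) \<Rightarrow> real" where
  "ip n x y = (\<Sum>k<n. x k * y k)"

lemma ip_commute: "ip n x y = ip n y x"
  unfolding ip_def by (simp add: mult.commute)

lemma ip_add_right: "ip n x (\<lambda>k. y k + z k) = ip n x y + ip n x z"
  unfolding ip_def by (simp add: algebra_simps sum.distrib)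

lemma ip_add_left: "ip n (\<lambda>k. y k + z k) x = ip n y x + ip n z x"
  unfolding ip_def by (simp add: algebra_simps sum.distrib)

lemma ip_diff_right: "ip n x (\<lambda>k. y k - z k) = ip n x y - ip n x z"
  unfolding ip_def by (simp add: algebra_simps sum_subtractf)

lemma ip_diff_left: "ip n (\<lambda>k. y k - z k) x = ip n y x - ip n z x"
  unfolding ip_def by (simp add: algebra_simps sum_subtractf)

lemma ip_scale_right: "ip n x (\<lambda>k. c * y k) = c * ip n x y"
  unfolding ip_def by (simp add: sum_distrib_left algebra_simps)

lemma ip_scale_left: "ip n (\<lambda>k. c * y k) x = c * ip n y x"
  unfolding ip_def by (simp add: sum_distrib_left algebra_simps)

lemma ip_sum_right: "ip n x (\<lambda>k. \<Sum>i\<in>J. c i * v i k) = (\<Sum>i\<in>J. c i * ip n x (v i))"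
  unfolding ip_def by (simp add: sum_distrib_left, subst sum.swap) (simp add: mult_ac)

lemma ip_sum_left: "ip n (\<lambda>k. \<Sum>i\<in>J. c i * v i k) x = (\<Sum>i\<in>J. c i * ip n (v i) x)"
  by (subst (1 2) ip_commute) (rule ip_sum_right)

lemma ip_self_nonneg: "0 \<le> ip n x x"
  unfolding ip_def by (simp add: sum_nonneg)

lemma ip_Cauchy_Schwarz: "(ip n x y)\<^sup>2 \<le> ip n x x * ip n y y"
proof -
  have "(ip n x y)\<^sup>2 \<le> (\<Sum>k<n. (x k)\<^sup>2) * (\<Sum>k<n. (y k)\<^sup>2)"
    unfolding ip_def by (rule Cauchy_Schwarz_ineq_sum)
  then show ?thesis by (simp add: ip_def power2_eq_square)
qed

lemma ip_eq_L2_set: "ip n x x = (L2_set x {..<n})\<^sup>2"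
  unfolding ip_def L2_set_def by (simp add: sum_nonneg power2_eq_square)

definition unitv :: "nat \<Rightarrow> nat \<Rightarrow> real" where
  "unitv j = (\<lambda>k. of_bool (k = j))"

lemma ip_unitv: "j < n \<Longrightarrow> ip n (unitv j) x = x j"
  unfolding ip_def unitv_def by (simp add: of_bool_def if_distrib[of "\<lambda>t. t * _"] sum.delta cong: if_cong)

text \<open>
  For vectors \<open>b i\<close> this is the positive semidefinite operator \<open>\<Sum>i\<in>J. b i (b i)\<^sup>T\<close>, whose quadratic form
  at \<open>x\<close> is \<open>\<Sum>i\<in>J. \<langle>b i, x\<rangle>\<^sup>2\<close>. It is a map on \<open>nat \<Rightarrow> real\<close>, so that its powers are iterates of one
  function and the dimension \<open>n\<close> may vary.
\<close>

definition frame_op :: "nat \<Rightarrow> ('i \<Rightarrow> nat \<Rightarrow> real) \<Rightarrow> 'i set \<Rightarrow> (nat \<Rightarrow> real) \<Rightarrow> nat \<Rightarrow> real" where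
  "frame_op n b J x = (\<lambda>k. \<Sum>i\<in>J. ip n (b i) x * b i k)"

lemma ip_frame_op: "ip n x (frame_op n b J y) = (\<Sum>i\<in>J. ip n (b i) x * ip n (b i) y)"
  unfolding frame_op_def ip_sum_right by (simp add: mult_ac ip_commute)

lemma frame_op_selfadjoint: "ip n (frame_op n b J x) y = ip n x (frame_op n b J y)"
  by (subst ip_commute) (simp add: ip_frame_op mult_ac)

lemma frame_op_add: "frame_op n b J (\<lambda>k. x k + y k) = (\<lambda>k. frame_op n b J x k + frame_op n b J y k)"
  unfolding frame_op_def by (simp add: ip_add_right algebra_simps sum.distrib)

lemma frame_op_scale: "frame_op n b J (\<lambda>k. c * x k) = (\<lambda>k. c * frame_op n b J x k)"
  unfolding frame_op_def by (simp add: ip_scale_right sum_distrib_left mult_ac)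

lemma frame_op_zero: "frame_op n b J (\<lambda>k. 0) = (\<lambda>k. 0)"
  unfolding frame_op_def by (simp add: ip_def)

lemma frame_op_sum:
  "finite F \<Longrightarrow> frame_op n b J (\<lambda>k. \<Sum>j\<in>F. c j * v j k) = (\<lambda>k. \<Sum>j\<in>F. c j * frame_op n b J (v j) k)"
  by (induction F rule: finite_induct) (simp_all add: frame_op_add frame_op_scale frame_op_zero)

lemma frame_pow_selfadjoint:
  "ip n ((frame_op n b J ^^ m) x) y = ip n x ((frame_op n b J ^^ m) y)"
proof (induction m arbitrary: y)
  case (Suc m)
  have "ip n ((frame_op n b J ^^ Suc m) x) y = ip n ((frame_op n b J ^^ m) x) (frame_op n b J y)"
    by (simp add: frame_op_selfadjoint)
  also have "\<dots> = ip n x ((frame_op n b J ^^ Suc m) y)"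
    by (simp add: Suc funpow_swap1)
  finally show ?case .
qed simp

lemma frame_pow_add: "(frame_op n b J ^^ m) (\<lambda>k. x k + y k) = (\<lambda>k. (frame_op n b J ^^ m) x k + (frame_op n b J ^^ m) y k)"
  by (induction m) (simp_all add: frame_op_add)

lemma frame_pow_scale: "(frame_op n b J ^^ m) (\<lambda>k. c * x k) = (\<lambda>k. c * (frame_op n b J ^^ m) x k)"
  by (induction m) (simp_all add: frame_op_scale)

text \<open>
  In an eigenbasis of \<open>W = frame_op n b J\<close> these are the moments of the spectral measure of \<open>W\<close> at \<open>x\<close>,
  a positive measure on \<open>[0, \<infinity>)\<close>. The spectral theorem is avoided: symmetry of \<open>W\<close> already yields the
  positivity and the log-convexity of the moments.
\<close>

definition frame_moment :: "nat \<Rightarrow> ('i \<Rightarrow> nat \<Rightarrow> real) \<Rightarrow> 'i set \<Rightarrow> (nat \<Rightarrow> real) \<Rightarrow> nat \<Rightarrow> real" where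
  "frame_moment n b J x m = ip n x ((frame_op n b J ^^ m) x)"

lemma frame_moment_0: "frame_moment n b J x 0 = ip n x x"
  by (simp add: frame_moment_def)

lemma frame_moment_1: "frame_moment n b J x (Suc 0) = (\<Sum>i\<in>J. (ip n (b i) x)\<^sup>2)"
  by (simp add: frame_moment_def ip_frame_op power2_eq_square)

lemma frame_moment_even:
  "frame_moment n b J x (2 * q) = ip n ((frame_op n b J ^^ q) x) ((frame_op n b J ^^ q) x)"
  by (simp add: frame_moment_def mult_2 funpow_add frame_pow_selfadjoint)

lemma frame_moment_odd:
  "frame_moment n b J x (2 * q + 1) = (\<Sum>i\<in>J. (ip n x ((frame_op n b J ^^ q) (b i)))\<^sup>2)"
proof -
  let ?W = "frame_op n b J"
  have "(?W ^^ (2 * q + 1)) x = (?W ^^ q) (?W ((?W ^^ q) x))"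
  proof -
    have "2 * q + 1 = q + (1 + q)" by simp
    then show ?thesis by (simp only: funpow_add o_apply) simp
  qed
  then have "frame_moment n b J x (2 * q + 1) = ip n ((?W ^^ q) x) (?W ((?W ^^ q) x))"
    by (simp add: frame_moment_def frame_pow_selfadjoint)
  also have "\<dots> = (\<Sum>i\<in>J. (ip n (b i) ((?W ^^ q) x))\<^sup>2)"
    by (simp add: ip_frame_op power2_eq_square)
  also have "\<dots> = (\<Sum>i\<in>J. (ip n x ((?W ^^ q) (b i)))\<^sup>2)"
    by (simp add: ip_commute[of n x] frame_pow_selfadjoint)
  finally show ?thesis .
qed

lemma frame_moment_nonneg: "0 \<le> frame_moment n b J x m"
proof (cases "even m")
  case True then show ?thesis by (auto elim!: evenE simp: frame_moment_even ip_self_nonneg)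
next
  case False
  then obtain q where "m = 2 * q + 1" by (rule oddE)
  then show ?thesis by (simp only: frame_moment_odd) (simp add: sum_nonneg)
qed

lemma nonneg_quadratic_discriminant:
  fixes a b c :: real
  assumes "0 \<le> c" and quad: "\<And>t. 0 \<le> a + 2 * t * b + t\<^sup>2 * c"
  shows "b\<^sup>2 \<le> a * c"
proof (cases "c = 0")
  case True
  show ?thesis
  proof (cases "b = 0")
    case False
    have "0 \<le> a + 2 * (- (a + 1) / (2 * b)) * b" using quad[of "- (a + 1) / (2 * b)"] True by simp
    also have "\<dots> = -1" using False by (simp add: field_simps)
    finally show ?thesis by simp
  qed (simp add: True)
next
  case False
  with \<open>0 \<le> c\<close> have c: "c > 0" by simp
  have "0 \<le> a + 2 * (- b / c) * b + (- b / c)\<^sup>2 * c" by (rule quad)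
  also have "\<dots> = a - b\<^sup>2 / c" using c by (simp add: field_simps power2_eq_square)
  finally show ?thesis using c by (simp add: field_simps)
qed

text \<open>
  Cauchy-Schwarz for the semidefinite form \<open>(x, y) \<mapsto> \<langle>x, W\<^sup>m y\<rangle>\<close>, applied to \<open>x\<close> and \<open>W x\<close>.
\<close>

lemma frame_moment_log_convex:
  "(frame_moment n b J x (Suc m))\<^sup>2 \<le> frame_moment n b J x m * frame_moment n b J x (Suc (Suc m))"
proof (rule nonneg_quadratic_discriminant[OF frame_moment_nonneg])
  fix t :: real
  let ?W = "frame_op n b J"
  let ?y = "\<lambda>k. x k + t * ?W x k"
  have 1: "ip n (?W x) ((?W ^^ m) x) = frame_moment n b J x (Suc m)"
    by (simp add: frame_moment_def frame_op_selfadjoint)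
  have 2: "ip n x ((?W ^^ m) (?W x)) = frame_moment n b J x (Suc m)"
    by (simp add: frame_moment_def funpow_swap1)
  have 3: "ip n (?W x) ((?W ^^ m) (?W x)) = frame_moment n b J x (Suc (Suc m))"
    by (simp add: frame_moment_def funpow_swap1 frame_op_selfadjoint)
  have "0 \<le> frame_moment n b J ?y m" by (rule frame_moment_nonneg)
  also have "\<dots> = frame_moment n b J x m + 2 * t * frame_moment n b J x (Suc m) + t\<^sup>2 * frame_moment n b J x (Suc (Suc m))"
    unfolding frame_moment_def[of n b J ?y m] frame_pow_add frame_pow_scale ip_add_left ip_add_right ip_scale_left ip_scale_right 1 2 3
    by (simp add: frame_moment_def power2_eq_square algebra_simps)
  finally show "0 \<le> frame_moment n b J x m + 2 * t * frame_moment n b J x (Suc m) + t\<^sup>2 * frame_moment n b J x (Suc (Suc m))" .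
qed

lemma log_convex_shift:
  fixes f :: "nat \<Rightarrow> real"
  assumes nonneg: "\<And>m. 0 \<le> f m" and conv: "\<And>m. (f (Suc m))\<^sup>2 \<le> f m * f (Suc (Suc m))"
  assumes "m \<le> l"
  shows "f (Suc m) * f l \<le> f m * f (Suc l)"
  using \<open>m \<le> l\<close>
proof (induction l rule: dec_induct)
  case (step l)
  show ?case
  proof (cases "f (Suc l) = 0")
    case False
    then have pos: "f (Suc l) > 0" using nonneg[of "Suc l"] by simp
    have "f l \<noteq> 0" using conv[of l] pos by (auto simp: power2_eq_square mult_le_0_iff)
    then have pos': "f l > 0" using nonneg[of l] by simp
    have "(f (Suc m) * f l) * (f (Suc l))\<^sup>2 \<le> (f m * f (Suc l)) * (f l * f (Suc (Suc l)))"
      by (rule mult_mono[OF step.IH conv]) (simp_all add: nonneg)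
    then have "(f l * f (Suc l)) * (f (Suc m) * f (Suc l)) \<le> (f l * f (Suc l)) * (f m * f (Suc (Suc l)))"
      by (simp add: power2_eq_square mult_ac)
    then show ?thesis using pos pos' by simp
  qed (simp add: nonneg)
qed simp

text \<open>
  For moments of a positive measure this is Chebyshev's correlation inequality between two increasing
  functions. Only log-convexity matters: it makes \<open>f (m + 1) / f m\<close> increasing, so moving one unit of
  degree from the smaller index to the larger one increases the product.
\<close>

lemma log_convex_product:
  fixes f :: "nat \<Rightarrow> real"
  assumes nonneg: "\<And>m. 0 \<le> f m" and conv: "\<And>m. (f (Suc m))\<^sup>2 \<le> f m * f (Suc (Suc m))"
  shows "f j * f l \<le> f 0 * f (j + l)"
proof -
  have *: "f j * f l \<le> f 0 * f (j + l)" if "j \<le> l" for j l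
    using that
  proof (induction j arbitrary: l)
    case (Suc j)
    have "f (Suc j) * f l \<le> f j * f (Suc l)" using Suc.prems by (intro log_convex_shift assms) auto
    also have "\<dots> \<le> f 0 * f (j + Suc l)" using Suc.prems by (intro Suc.IH) auto
    finally show ?case by simp
  qed simp
  show ?thesis
  proof (cases "j \<le> l")
    case False
    then show ?thesis using *[of l j] by (simp add: mult.commute add.commute)
  qed (rule *)
qed

lemma frame_moment_product:
  "frame_moment n b J x j * frame_moment n b J x l \<le> frame_moment n b J x 0 * frame_moment n b J x (j + l)"
  by (rule log_convex_product) (rule frame_moment_nonneg frame_moment_log_convex)+

text \<open>
  Adding one vector \<open>b\<close> turns \<open>W\<close> into \<open>V = W + b b\<^sup>T\<close>, and \<open>V\<^sup>m b\<close> expands according to the last time at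
  which the rank one part acts; after that only powers of \<open>W\<close> remain.
\<close>

lemma frame_pow_insert:
  assumes "finite J" "i \<notin> J"
  shows "(frame_op n b (insert i J) ^^ m) (b i) =
    (\<lambda>k. (frame_op n b J ^^ m) (b i) k +
      (\<Sum>j<m. frame_moment n b (insert i J) (b i) j * (frame_op n b J ^^ (m - 1 - j)) (b i) k))"
proof (induction m)
  case (Suc m)
  let ?W = "frame_op n b J" and ?V = "frame_op n b (insert i J)"
  let ?g = "frame_moment n b (insert i J) (b i)"
  have ins: "?V x = (\<lambda>k. ?W x k + ip n (b i) x * b i k)" for x
    using assms by (simp add: frame_op_def add.commute)
  have "(?V ^^ Suc m) (b i) = (\<lambda>k. ?W ((?V ^^ m) (b i)) k + ?g m * b i k)"
    by (simp add: ins frame_moment_def)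
  also have "?W ((?V ^^ m) (b i)) = (\<lambda>k. (?W ^^ Suc m) (b i) k + (\<Sum>j<m. ?g j * (?W ^^ Suc (m - 1 - j)) (b i) k))"
    unfolding Suc frame_op_add by (simp add: frame_op_sum)
  also have "\<dots> = (\<lambda>k. (?W ^^ Suc m) (b i) k + (\<Sum>j<m. ?g j * (?W ^^ (m - j)) (b i) k))"
    by (intro ext arg_cong2[of _ _ _ _ "(+)"] refl sum.cong) (auto simp: Suc_diff_Suc simp del: funpow.simps)
  finally show ?case by (simp add: add.assoc)
qed simp

lemma frame_moment_insert:
  assumes "finite J" "i \<notin> J"
  shows "frame_moment n b (insert i J) (b i) m = frame_moment n b J (b i) m +
      (\<Sum>j<m. frame_moment n b (insert i J) (b i) j * frame_moment n b J (b i) (m - 1 - j))"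
proof -
  have "frame_moment n b (insert i J) (b i) m = ip n (b i) ((frame_op n b (insert i J) ^^ m) (b i))"
    by (simp add: frame_moment_def)
  also have "\<dots> = frame_moment n b J (b i) m +
      (\<Sum>j<m. frame_moment n b (insert i J) (b i) j * frame_moment n b J (b i) (m - 1 - j))"
    unfolding frame_pow_insert[OF assms] ip_add_right ip_sum_right by (simp add: frame_moment_def)
  finally show ?thesis .
qed

lemma frame_moment_insert_ge:
  assumes "finite J"
  shows "frame_moment n b J (b i) m \<le> frame_moment n b (insert i J) (b i) m"
proof (cases "i \<in> J")
  case False
  then show ?thesis using frame_moment_insert[OF assms False, of n b m]
    by (simp add: sum_nonneg frame_moment_nonneg)
qed (simp add: insert_absorb)

text \<open>
  Powers are not operator monotone, so \<open>b b\<^sup>T \<le> L\<close> does not suffice to replace \<open>W + b b\<^sup>T\<close> by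
  \<open>W + L\<close> in a moment. At the vector \<open>b\<close> itself this is possible, because every product of moments in the expansion is controlled by \<open>f j * f l \<le> L * f (j + l)\<close>, and the number of
  the terms of a given degree is counted by the hockey stick identity.
\<close>

lemma frame_moment_insert_le:
  assumes "finite J" "i \<notin> J" and L: "ip n (b i) (b i) \<le> L"
  shows "frame_moment n b (insert i J) (b i) m \<le>
    (\<Sum>s\<le>m. real (m choose s) * L ^ s * frame_moment n b J (b i) (m - s))"
proof (induction m rule: less_induct)
  case (less m)
  let ?f = "frame_moment n b J (b i)" and ?g = "frame_moment n b (insert i J) (b i)"
  have L0: "0 \<le> L" using ip_self_nonneg[of n "b i"] L by linarith
  have prod: "?f j * ?f l \<le> L * ?f (j + l)" for j l
  proof -
    have "?f j * ?f l \<le> ?f 0 * ?f (j + l)" by (rule frame_moment_product)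
    also have "\<dots> \<le> L * ?f (j + l)"
      using L by (intro mult_right_mono frame_moment_nonneg) (simp add: frame_moment_0)
    finally show ?thesis .
  qed
  show ?case
  proof (cases m)
    case (Suc r)
    have "(\<Sum>j<m. ?g j * ?f (m - 1 - j)) \<le>
        (\<Sum>j\<le>r. (\<Sum>s\<le>r. real (j choose s) * L ^ Suc s * ?f (r - s)))"
      unfolding Suc lessThan_Suc_atMost
    proof (rule sum_mono)
      fix j assume j: "j \<in> {..r}"
      have "?g j * ?f (r - j) \<le> (\<Sum>s\<le>j. real (j choose s) * L ^ s * ?f (j - s)) * ?f (r - j)"
        using j Suc by (intro mult_right_mono less frame_moment_nonneg) auto
      also have "\<dots> = (\<Sum>s\<le>j. real (j choose s) * L ^ s * (?f (j - s) * ?f (r - j)))"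
        by (simp add: sum_distrib_right mult.assoc)
      also have "\<dots> \<le> (\<Sum>s\<le>j. real (j choose s) * L ^ s * (L * ?f (r - s)))"
      proof (intro sum_mono mult_left_mono)
        fix s assume "s \<in> {..j}"
        then have "j - s + (r - j) = r - s" using j by auto
        then show "?f (j - s) * ?f (r - j) \<le> L * ?f (r - s)" using prod[of "j - s" "r - j"] by simp
      qed (simp add: L0)
      also have "\<dots> = (\<Sum>s\<le>j. real (j choose s) * L ^ Suc s * ?f (r - s))"
        by (simp add: mult_ac)
      also have "\<dots> = (\<Sum>s\<le>r. real (j choose s) * L ^ Suc s * ?f (r - s))"
        using j by (intro sum.mono_neutral_left) auto
      finally show "?g j * ?f (Suc r - 1 - j) \<le> (\<Sum>s\<le>r. real (j choose s) * L ^ Suc s * ?f (r - s))"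
        by simp
    qed
    also have "\<dots> = (\<Sum>s\<le>r. (\<Sum>j\<le>r. real (j choose s)) * L ^ Suc s * ?f (r - s))"
      by (subst sum.swap) (simp add: sum_distrib_right)
    also have "\<dots> = (\<Sum>s\<le>r. real (m choose Suc s) * L ^ Suc s * ?f (m - Suc s))"
    proof (intro sum.cong refl)
      fix s
      have "(\<Sum>j\<le>r. j choose s) = Suc r choose Suc s" by (rule sum_choose_upper)
      then have "(\<Sum>j\<le>r. real (j choose s)) = real (m choose Suc s)" unfolding Suc by (metis of_nat_sum)
      then show "(\<Sum>j\<le>r. real (j choose s)) * L ^ Suc s * ?f (r - s) = real (m choose Suc s) * L ^ Suc s * ?f (m - Suc s)"
        by (simp add: Suc)
    qed
    finally have "?g m \<le> ?f m + (\<Sum>s\<le>r. real (m choose Suc s) * L ^ Suc s * ?f (m - Suc s))"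
      using frame_moment_insert[OF assms(1,2), of n b m] by simp
    also have "\<dots> = (\<Sum>s\<le>m. real (m choose s) * L ^ s * ?f (m - s))"
      unfolding Suc by (subst sum.atMost_Suc_shift) simp
    finally show ?thesis .
  qed (simp add: frame_moment_0)
qed

text \<open>
  This is \<open>tr (F W\<^bsup>m+1\<^esup>) \<le> M tr (W\<^bsup>m+1\<^esup>)\<close> for the full operator \<open>F = \<Sum>i\<in>A. b i (b i)\<^sup>T \<le> M\<close>: distribute
  half of the powers of \<open>W\<close> to each side of \<open>F\<close>. For odd \<open>m + 1\<close> the leftover factor \<open>W\<close> is a sum
  of rank one operators, and for even \<open>m + 1\<close> the trace is expanded in coordinates.
\<close>

lemma sum_frame_moment_le:
  assumes J: "finite J" and A: "finite A"
    and M: "\<And>x. (\<Sum>i\<in>A. (ip n (b i) x)\<^sup>2) \<le> M * ip n x x"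
  shows "(\<Sum>i\<in>A. frame_moment n b J (b i) (Suc m)) \<le> M * (\<Sum>l\<in>J. frame_moment n b J (b l) m)"
proof (cases "even m")
  let ?W = "frame_op n b J"
  case True
  then obtain q where q: "m = 2 * q" by (auto elim!: evenE)
  have "(\<Sum>i\<in>A. frame_moment n b J (b i) (Suc m)) = (\<Sum>i\<in>A. \<Sum>l\<in>J. (ip n (b i) ((?W ^^ q) (b l)))\<^sup>2)"
    unfolding q using frame_moment_odd[of n b J _ q] by simp
  also have "\<dots> = (\<Sum>l\<in>J. \<Sum>i\<in>A. (ip n (b i) ((?W ^^ q) (b l)))\<^sup>2)" by (rule sum.swap)
  also have "\<dots> \<le> (\<Sum>l\<in>J. M * ip n ((?W ^^ q) (b l)) ((?W ^^ q) (b l)))" by (intro sum_mono M)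
  also have "\<dots> = M * (\<Sum>l\<in>J. frame_moment n b J (b l) m)"
    unfolding q frame_moment_even by (simp add: sum_distrib_left)
  finally show ?thesis .
next
  let ?W = "frame_op n b J"
  case False
  then obtain q where q: "Suc m = 2 * q" by (metis evenE even_Suc)
  then obtain q' where q': "q = Suc q'" by (cases q) auto
  have coord: "(\<Sum>i\<in>A. ((?W ^^ q) (b i) e)\<^sup>2) \<le> M * ip n ((?W ^^ q) (unitv e)) ((?W ^^ q) (unitv e))"
    if "e < n" for e
  proof -
    have "(?W ^^ q) (b i) e = ip n (b i) ((?W ^^ q) (unitv e))" for i
    proof -
      have "(?W ^^ q) (b i) e = ip n (unitv e) ((?W ^^ q) (b i))" using that by (simp add: ip_unitv)
      also have "\<dots> = ip n ((?W ^^ q) (unitv e)) (b i)" by (simp add: frame_pow_selfadjoint)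
      finally show ?thesis by (simp add: ip_commute)
    qed
    then show ?thesis using M[of "(?W ^^ q) (unitv e)"] by simp
  qed
  have "(\<Sum>i\<in>A. frame_moment n b J (b i) (Suc m)) = (\<Sum>i\<in>A. \<Sum>e<n. ((?W ^^ q) (b i) e)\<^sup>2)"
    unfolding q frame_moment_even by (simp add: ip_def power2_eq_square)
  also have "\<dots> = (\<Sum>e<n. \<Sum>i\<in>A. ((?W ^^ q) (b i) e)\<^sup>2)" by (rule sum.swap)
  also have "\<dots> \<le> (\<Sum>e<n. M * ip n ((?W ^^ q) (unitv e)) ((?W ^^ q) (unitv e)))"
    by (intro sum_mono coord) simp
  also have "\<dots> = M * (\<Sum>e<n. \<Sum>l\<in>J. b l e * (?W ^^ m) (b l) e)"
  proof -
    have "ip n ((?W ^^ q) (unitv e)) ((?W ^^ q) (unitv e)) = (\<Sum>l\<in>J. b l e * (?W ^^ m) (b l) e)"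
      if e: "e < n" for e
    proof -
      have "ip n ((?W ^^ q) (unitv e)) ((?W ^^ q) (unitv e)) = ip n (unitv e) ((?W ^^ Suc m) (unitv e))"
        unfolding q by (simp flip: frame_moment_even add: frame_moment_def)
      also have "\<dots> = ip n ((?W ^^ m) (unitv e)) (?W (unitv e))"
        by (simp add: frame_pow_selfadjoint funpow_swap1)
      also have "\<dots> = (\<Sum>l\<in>J. ip n (b l) ((?W ^^ m) (unitv e)) * ip n (b l) (unitv e))"
        by (simp add: ip_frame_op)
      also have "\<dots> = (\<Sum>l\<in>J. ip n (unitv e) ((?W ^^ m) (b l)) * ip n (unitv e) (b l))"
        by (simp add: ip_commute[of n "b _"] frame_pow_selfadjoint)
      finally show ?thesis using e by (simp add: ip_unitv mult.commute)
    qed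
    then show ?thesis by (simp add: sum_distrib_left)
  qed
  also have "\<dots> = M * (\<Sum>l\<in>J. frame_moment n b J (b l) m)"
    by (subst sum.swap) (simp add: frame_moment_def ip_def)
  finally show ?thesis .
qed

lemma frame_bound_ge_self:
  assumes A: "finite A" "i \<in> A" and "0 \<le> M"
    and M: "\<And>x. (\<Sum>i\<in>A. (ip n (b i) x)\<^sup>2) \<le> M * ip n x x"
  shows "ip n (b i) (b i) \<le> M"
proof (cases "ip n (b i) (b i) = 0")
  case False
  then have pos: "ip n (b i) (b i) > 0" using ip_self_nonneg[of n "b i"] by simp
  have "(ip n (b i) (b i))\<^sup>2 \<le> (\<Sum>j\<in>A. (ip n (b j) (b i))\<^sup>2)"
    using A by (intro member_le_sum) auto
  also have "\<dots> \<le> M * ip n (b i) (b i)" by (rule M)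
  finally show ?thesis using pos by (simp add: power2_eq_square)
qed (simp add: \<open>0 \<le> M\<close>)

section \<open>Bernoulli random subsets\<close>

text \<open>
  Expectation over the random subset of \<open>A\<close> that contains every element independently with probability
  \<open>\<delta>\<close>. As a finite sum it satisfies a recursion over \<open>A\<close> from which all its properties follow.
\<close>

definition subset_mean :: "real \<Rightarrow> 'a set \<Rightarrow> ('a set \<Rightarrow> real) \<Rightarrow> real" where
  "subset_mean \<delta> A f = (\<Sum>J\<in>Pow A. \<delta> ^ card J * (1 - \<delta>) ^ card (A - J) * f J)"

lemma subset_mean_empty [simp]: "subset_mean \<delta> {} f = f {}"
  by (simp add: subset_mean_def)

lemma subset_mean_insert:
  assumes "finite A" "i \<notin> A"
  shows "subset_mean \<delta> (insert i A) f = (1 - \<delta>) * subset_mean \<delta> A f + \<delta> * subset_mean \<delta> A (\<lambda>J. f (insert i J))"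
proof -
  let ?w = "\<lambda>J. \<delta> ^ card J * (1 - \<delta>) ^ card (insert i A - J) * f J"
  have "subset_mean \<delta> (insert i A) f = (\<Sum>J\<in>Pow A. ?w J) + (\<Sum>J\<in>insert i ` Pow A. ?w J)"
    unfolding subset_mean_def Pow_insert using assms
    by (intro sum.union_disjoint) auto
  also have "(\<Sum>J\<in>insert i ` Pow A. ?w J) = (\<Sum>J\<in>Pow A. ?w (insert i J))"
    using assms by (intro sum.reindex_cong[of "insert i"]) (auto simp: inj_on_def)
  also have "\<dots> = \<delta> * subset_mean \<delta> A (\<lambda>J. f (insert i J))"
    unfolding subset_mean_def sum_distrib_left
  proof (intro sum.cong refl)
    fix J assume J: "J \<in> Pow A"
    then have "finite J" "i \<notin> J" using assms finite_subset by auto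
    moreover have "insert i A - insert i J = A - J" using assms J by auto
    ultimately show "?w (insert i J) = \<delta> * (\<delta> ^ card J * (1 - \<delta>) ^ card (A - J) * f (insert i J))" by simp
  qed
  also have "(\<Sum>J\<in>Pow A. ?w J) = (1 - \<delta>) * subset_mean \<delta> A f"
    unfolding subset_mean_def sum_distrib_left
  proof (intro sum.cong refl)
    fix J assume J: "J \<in> Pow A"
    have "insert i A - J = insert i (A - J)" using assms J by auto
    then have "card (insert i A - J) = Suc (card (A - J))" using assms by simp
    then show "?w J = (1 - \<delta>) * (\<delta> ^ card J * (1 - \<delta>) ^ card (A - J) * f J)" by simp
  qed
  finally show ?thesis .
qed

lemma subset_mean_mono:
  assumes "0 \<le> \<delta>" "\<delta> \<le> 1" "\<And>J. J \<subseteq> A \<Longrightarrow> f J \<le> g J"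
  shows "subset_mean \<delta> A f \<le> subset_mean \<delta> A g"
  unfolding subset_mean_def using assms by (intro sum_mono mult_left_mono) auto

lemma subset_mean_add: "subset_mean \<delta> A (\<lambda>J. f J + g J) = subset_mean \<delta> A f + subset_mean \<delta> A g"
  unfolding subset_mean_def by (simp add: algebra_simps sum.distrib)

lemma subset_mean_cmult: "subset_mean \<delta> A (\<lambda>J. c * f J) = c * subset_mean \<delta> A f"
  unfolding subset_mean_def by (simp add: sum_distrib_left mult_ac)

lemma subset_mean_sum: "subset_mean \<delta> A (\<lambda>J. \<Sum>i\<in>F. f i J) = (\<Sum>i\<in>F. subset_mean \<delta> A (f i))"
  unfolding subset_mean_def sum_distrib_left by (rule sum.swap)

lemma subset_mean_const: "finite A \<Longrightarrow> subset_mean \<delta> A (\<lambda>J. c) = c"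
proof (induction A rule: finite_induct)
  case (insert i A) then show ?case by (simp add: subset_mean_insert algebra_simps)
qed simp

lemma subset_mean_cong: "(\<And>J. J \<subseteq> A \<Longrightarrow> f J = g J) \<Longrightarrow> subset_mean \<delta> A f = subset_mean \<delta> A g"
  unfolding subset_mean_def by (intro sum.cong) auto

lemma subset_mean_nonneg:
  assumes "0 \<le> \<delta>" "\<delta> \<le> 1" "\<And>J. J \<subseteq> A \<Longrightarrow> 0 \<le> f J"
  shows "0 \<le> subset_mean \<delta> A f"
  unfolding subset_mean_def using assms by (intro sum_nonneg mult_nonneg_nonneg) auto

lemma subset_mean_Un:
  assumes "finite A" "finite B" "A \<inter> B = {}"
  shows "subset_mean \<delta> (A \<union> B) f = subset_mean \<delta> A (\<lambda>J. subset_mean \<delta> B (\<lambda>K. f (J \<union> K)))"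
  using assms
proof (induction A arbitrary: f rule: finite_induct)
  case (insert i A)
  then have "finite (A \<union> B)" "i \<notin> A \<union> B" by auto
  then show ?case using insert by (simp add: subset_mean_insert)
qed simp

lemma subset_mean_swap:
  "subset_mean \<delta> A (\<lambda>J. subset_mean \<gamma> B (\<lambda>K. f J K)) = subset_mean \<gamma> B (\<lambda>K. subset_mean \<delta> A (\<lambda>J. f J K))"
  unfolding subset_mean_def sum_distrib_left by (subst sum.swap) (simp add: mult_ac)

text \<open>
  Conditioned on containing \<open>i\<close>, a Bernoulli subset is \<open>i\<close> together with a Bernoulli subset of the
  other elements. This independence of \<open>i\<close> and the rest drives the recursion for the traces.
\<close>

lemma subset_mean_sum_members:
  assumes "finite A"
  shows "subset_mean \<delta> A (\<lambda>J. \<Sum>i\<in>J. F i J) = (\<Sum>i\<in>A. \<delta> * subset_mean \<delta> (A - {i}) (\<lambda>J. F i (insert i J)))"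
proof -
  have "subset_mean \<delta> A (\<lambda>J. \<Sum>i\<in>J. F i J) = subset_mean \<delta> A (\<lambda>J. \<Sum>i\<in>A. of_bool (i \<in> J) * F i J)"
  proof (rule subset_mean_cong)
    fix J assume "J \<subseteq> A"
    then show "(\<Sum>i\<in>J. F i J) = (\<Sum>i\<in>A. of_bool (i \<in> J) * F i J)"
      using assms by (intro sum.mono_neutral_cong_left) auto
  qed
  also have "\<dots> = (\<Sum>i\<in>A. subset_mean \<delta> A (\<lambda>J. of_bool (i \<in> J) * F i J))" by (rule subset_mean_sum)
  also have "\<dots> = (\<Sum>i\<in>A. \<delta> * subset_mean \<delta> (A - {i}) (\<lambda>J. F i (insert i J)))"
  proof (intro sum.cong refl)
    fix i assume i: "i \<in> A"
    have "subset_mean \<delta> A (\<lambda>J. of_bool (i \<in> J) * F i J)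
        = (1 - \<delta>) * subset_mean \<delta> (A - {i}) (\<lambda>J. of_bool (i \<in> J) * F i J)
          + \<delta> * subset_mean \<delta> (A - {i}) (\<lambda>J. of_bool (i \<in> insert i J) * F i (insert i J))"
      using subset_mean_insert[of "A - {i}" i \<delta>] assms i by (simp add: insert_absorb)
    also have "subset_mean \<delta> (A - {i}) (\<lambda>J. of_bool (i \<in> J) * F i J) = subset_mean \<delta> (A - {i}) (\<lambda>J. 0)"
      by (rule subset_mean_cong) auto
    finally show "subset_mean \<delta> A (\<lambda>J. of_bool (i \<in> J) * F i J) = \<delta> * subset_mean \<delta> (A - {i}) (\<lambda>J. F i (insert i J))"
      using assms by (simp add: subset_mean_const)
  qed
  finally show ?thesis .
qed

definition subset_prob :: "real \<Rightarrow> 'a set \<Rightarrow> ('a set \<Rightarrow> bool) \<Rightarrow> real" where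
  "subset_prob \<delta> A P = subset_mean \<delta> A (\<lambda>J. of_bool (P J))"

lemma subset_prob_mono:
  assumes "0 \<le> \<delta>" "\<delta> \<le> 1" "\<And>J. J \<subseteq> A \<Longrightarrow> P J \<Longrightarrow> Q J"
  shows "subset_prob \<delta> A P \<le> subset_prob \<delta> A Q"
  unfolding subset_prob_def using assms by (intro subset_mean_mono) auto

lemma subset_prob_disj_le:
  assumes "0 \<le> \<delta>" "\<delta> \<le> 1"
  shows "subset_prob \<delta> A (\<lambda>J. P J \<or> Q J) \<le> subset_prob \<delta> A P + subset_prob \<delta> A Q"
  unfolding subset_prob_def subset_mean_add[symmetric] using assms by (intro subset_mean_mono) auto

lemma subset_prob_bex_le:
  assumes "0 \<le> \<delta>" "\<delta> \<le> 1" "finite F"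
  shows "subset_prob \<delta> A (\<lambda>J. \<exists>j\<in>F. P j J) \<le> (\<Sum>j\<in>F. subset_prob \<delta> A (P j))"
  unfolding subset_prob_def subset_mean_sum[symmetric]
proof (intro subset_mean_mono assms)
  fix J
  show "of_bool (\<exists>j\<in>F. P j J) \<le> (\<Sum>j\<in>F. of_bool (P j J) :: real)"
  proof (cases "\<exists>j\<in>F. P j J")
    case True
    then obtain j where "j \<in> F" "P j J" by blast
    then have "1 \<le> (\<Sum>j\<in>F. of_bool (P j J) :: real)"
      using member_le_sum[of j F "\<lambda>j. of_bool (P j J) :: real"] assms by auto
    then show ?thesis by simp
  qed (simp add: sum_nonneg)
qed

lemma subset_prob_Markov:
  assumes "0 \<le> \<delta>" "\<delta> \<le> 1" "0 < c" "\<And>J. J \<subseteq> A \<Longrightarrow> 0 \<le> f J" "\<And>J. J \<subseteq> A \<Longrightarrow> P J \<Longrightarrow> c \<le> f J"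
  shows "subset_prob \<delta> A P \<le> subset_mean \<delta> A f / c"
proof -
  have "subset_prob \<delta> A P \<le> subset_mean \<delta> A (\<lambda>J. inverse c * f J)"
    unfolding subset_prob_def
  proof (intro subset_mean_mono assms)
    fix J assume J: "J \<subseteq> A"
    show "of_bool (P J) \<le> inverse c * f J"
      using assms(3) assms(4)[OF J] assms(5)[OF J] by (cases "P J") (auto simp: field_simps)
  qed
  then show ?thesis by (simp add: subset_mean_cmult divide_inverse mult.commute)
qed

section \<open>A Chernoff bound for random frame operators\<close>

text \<open>
  The trace of \<open>W\<^sup>k\<close>, for \<open>k > 0\<close>, written through the moments at the vectors of \<open>J\<close>. The value at \<open>k = 0\<close>
  is \<open>card A\<close> in place of the dimension \<open>n\<close>: it makes the next inequality true also there, and it keeps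
  the ambient dimension out of the final probability, which matters when \<open>n\<close> is much larger than
  the number of vectors.
\<close>

definition frame_trace :: "nat \<Rightarrow> ('i \<Rightarrow> nat \<Rightarrow> real) \<Rightarrow> 'i set \<Rightarrow> 'i set \<Rightarrow> nat \<Rightarrow> real" where
  "frame_trace n b A J k = (case k of 0 \<Rightarrow> real (card A) | Suc m \<Rightarrow> \<Sum>i\<in>J. frame_moment n b J (b i) m)"

lemma sum_frame_moment_le_trace:
  assumes J: "finite J" and A: "finite A" and "0 \<le> M"
    and M: "\<And>x. (\<Sum>i\<in>A. (ip n (b i) x)\<^sup>2) \<le> M * ip n x x"
  shows "(\<Sum>i\<in>A. frame_moment n b J (b i) m) \<le> M * frame_trace n b A J m"
proof (cases m)
  case 0
  have "(\<Sum>i\<in>A. frame_moment n b J (b i) 0) \<le> (\<Sum>i\<in>A. M)"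
    unfolding frame_moment_0 by (intro sum_mono frame_bound_ge_self[OF A _ \<open>0 \<le> M\<close> M])
  then show ?thesis by (simp add: 0 frame_trace_def mult.commute)
next
  case (Suc m')
  then show ?thesis using sum_frame_moment_le[OF J A M] by (simp add: frame_trace_def)
qed

text \<open>
  One factor of \<open>tr W\<^bsup>m+1\<^esup>\<close> selects a vector \<open>b i\<close> that belongs to the random set. By independence the
  others form an operator to which \<open>b i (b i)\<^sup>T\<close> is added, so the rank one expansion applies; summing
  over all \<open>i\<close> brings back traces. The resulting recursion is the one satisfied by the moments of \<open>L\<close>
  times a Poisson variable of mean \<open>\<delta> M / L\<close>.
\<close>

lemma mean_frame_trace_Suc_le:
  assumes A: "finite A" and \<delta>: "0 \<le> \<delta>" "\<delta> \<le> 1" and "0 \<le> M"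
    and M: "\<And>x. (\<Sum>i\<in>A. (ip n (b i) x)\<^sup>2) \<le> M * ip n x x"
    and "0 \<le> L" and L: "\<And>i. i \<in> A \<Longrightarrow> ip n (b i) (b i) \<le> L"
  shows "subset_mean \<delta> A (\<lambda>J. frame_trace n b A J (Suc m)) \<le>
    \<delta> * M * (\<Sum>s\<le>m. real (m choose s) * L ^ s * subset_mean \<delta> A (\<lambda>J. frame_trace n b A J (m - s)))"
proof -
  have fin: "finite J" if "J \<subseteq> A" for J using A that by (rule finite_subset[rotated])
  have step: "subset_mean \<delta> (A - {i}) (\<lambda>J. frame_moment n b J (b i) r) \<le> subset_mean \<delta> A (\<lambda>J. frame_moment n b J (b i) r)"
    if "i \<in> A" for i r
  proof -
    let ?h = "\<lambda>J. frame_moment n b J (b i) r"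
    have "subset_mean \<delta> (A - {i}) ?h \<le> subset_mean \<delta> (A - {i}) (\<lambda>J. ?h (insert i J))"
      by (intro subset_mean_mono \<delta> frame_moment_insert_ge fin) auto
    then have "\<delta> * subset_mean \<delta> (A - {i}) ?h \<le> \<delta> * subset_mean \<delta> (A - {i}) (\<lambda>J. ?h (insert i J))"
      using \<delta> by (intro mult_left_mono)
    then have "subset_mean \<delta> (A - {i}) ?h \<le> subset_mean \<delta> (insert i (A - {i})) ?h"
      using A by (subst subset_mean_insert) (auto simp: algebra_simps)
    then show ?thesis using that by (simp add: insert_absorb)
  qed
  have "subset_mean \<delta> A (\<lambda>J. frame_trace n b A J (Suc m))
      = (\<Sum>i\<in>A. \<delta> * subset_mean \<delta> (A - {i}) (\<lambda>J. frame_moment n b (insert i J) (b i) m))"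
    using A by (simp add: frame_trace_def subset_mean_sum_members)
  also have "\<dots> \<le> (\<Sum>i\<in>A. \<delta> * (\<Sum>s\<le>m. real (m choose s) * L ^ s * subset_mean \<delta> A (\<lambda>J. frame_moment n b J (b i) (m - s))))"
  proof (intro sum_mono mult_left_mono \<delta>)
    fix i assume i: "i \<in> A"
    have "subset_mean \<delta> (A - {i}) (\<lambda>J. frame_moment n b (insert i J) (b i) m)
        \<le> subset_mean \<delta> (A - {i}) (\<lambda>J. \<Sum>s\<le>m. real (m choose s) * L ^ s * frame_moment n b J (b i) (m - s))"
      using i by (intro subset_mean_mono \<delta> frame_moment_insert_le L fin) auto
    also have "\<dots> = (\<Sum>s\<le>m. real (m choose s) * L ^ s * subset_mean \<delta> (A - {i}) (\<lambda>J. frame_moment n b J (b i) (m - s)))"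
      by (simp add: subset_mean_sum subset_mean_cmult)
    also have "\<dots> \<le> (\<Sum>s\<le>m. real (m choose s) * L ^ s * subset_mean \<delta> A (\<lambda>J. frame_moment n b J (b i) (m - s)))"
      using i \<open>0 \<le> L\<close> by (intro sum_mono mult_left_mono step) auto
    finally show "subset_mean \<delta> (A - {i}) (\<lambda>J. frame_moment n b (insert i J) (b i) m) \<le> \<dots>" .
  qed
  also have "\<dots> = \<delta> * (\<Sum>s\<le>m. real (m choose s) * L ^ s * subset_mean \<delta> A (\<lambda>J. \<Sum>i\<in>A. frame_moment n b J (b i) (m - s)))"
    unfolding sum_distrib_left[symmetric] subset_mean_sum
    by (subst sum.swap) (simp add: sum_distrib_left mult_ac)
  also have "\<dots> \<le> \<delta> * (\<Sum>s\<le>m. real (m choose s) * L ^ s * subset_mean \<delta> A (\<lambda>J. M * frame_trace n b A J (m - s)))"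
    using \<open>0 \<le> L\<close> \<open>0 \<le> M\<close>
    by (intro mult_left_mono sum_mono subset_mean_mono \<delta> sum_frame_moment_le_trace fin A M) auto
  also have "\<dots> = \<delta> * M * (\<Sum>s\<le>m. real (m choose s) * L ^ s * subset_mean \<delta> A (\<lambda>J. frame_trace n b A J (m - s)))"
    unfolding subset_mean_cmult sum_distrib_left by (simp add: mult_ac)
  finally show ?thesis .
qed

text \<open>
  Inserting \<open>card A * c ^ j\<close> into the recursion gives \<open>\<delta> M (c + L)\<^sup>m \<le> \<delta> M e c\<^sup>m\<close>, since \<open>m L \<le> c\<close>.
\<close>

lemma mean_frame_trace_le:
  assumes A: "finite A" and \<delta>: "0 \<le> \<delta>" "\<delta> \<le> 1" and "0 \<le> M"
    and M: "\<And>x. (\<Sum>i\<in>A. (ip n (b i) x)\<^sup>2) \<le> M * ip n x x"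
    and "0 \<le> L" and L: "\<And>i. i \<in> A \<Longrightarrow> ip n (b i) (b i) \<le> L"
    and c: "0 < c" "real k * L \<le> c" "exp 1 * \<delta> * M \<le> c" and "j \<le> k"
  shows "subset_mean \<delta> A (\<lambda>J. frame_trace n b A J j) \<le> real (card A) * c ^ j"
  using \<open>j \<le> k\<close>
proof (induction j rule: less_induct)
  case (less j)
  show ?case
  proof (cases j)
    case 0
    then show ?thesis using A by (simp add: frame_trace_def subset_mean_const)
  next
    case (Suc m)
    have "subset_mean \<delta> A (\<lambda>J. frame_trace n b A J j) \<le>
        \<delta> * M * (\<Sum>s\<le>m. real (m choose s) * L ^ s * subset_mean \<delta> A (\<lambda>J. frame_trace n b A J (m - s)))"
      unfolding Suc by (rule mean_frame_trace_Suc_le[OF A \<delta> \<open>0 \<le> M\<close> M \<open>0 \<le> L\<close> L])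
    also have "\<dots> \<le> \<delta> * M * (\<Sum>s\<le>m. real (m choose s) * L ^ s * (real (card A) * c ^ (m - s)))"
      using Suc less.prems \<delta> \<open>0 \<le> M\<close> \<open>0 \<le> L\<close> by (intro mult_left_mono sum_mono less.IH) auto
    also have "\<dots> = real (card A) * (\<delta> * M * (L + c) ^ m)"
      by (simp add: binomial_ring sum_distrib_left mult_ac)
    also have "\<dots> \<le> real (card A) * c ^ j"
    proof (intro mult_left_mono)
      have "(L + c) ^ m = (1 + L / c) ^ m * c ^ m"
        using c by (simp add: power_mult_distrib[symmetric] field_simps)
      also have "\<dots> \<le> exp (L / c) ^ m * c ^ m"
        using c \<open>0 \<le> L\<close> by (intro mult_right_mono power_mono exp_ge_add_one_self) auto
      also have "exp (L / c) ^ m = exp (real m * L / c)" by (simp flip: exp_of_nat_mult)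
      also have "\<dots> * c ^ m \<le> exp 1 * c ^ m"
      proof -
        have "real m * L \<le> real k * L" using Suc less.prems \<open>0 \<le> L\<close> by (intro mult_right_mono) auto
        then show ?thesis using c by (intro mult_right_mono) (auto simp: field_simps)
      qed
      finally have "\<delta> * M * (L + c) ^ m \<le> \<delta> * M * (exp 1 * c ^ m)"
        using \<delta> \<open>0 \<le> M\<close> by (intro mult_left_mono) auto
      also have "\<dots> = exp 1 * \<delta> * M * c ^ m" by (simp add: mult_ac)
      also have "\<dots> \<le> c * c ^ m" using c by (intro mult_right_mono) auto
      finally show "\<delta> * M * (L + c) ^ m \<le> c ^ j" by (simp add: Suc)
    qed simp
    finally show ?thesis .
  qed
qed

text \<open>
  A direction in which the quadratic form exceeds \<open>t\<close> forces a large trace: log-convexity gives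
  \<open>F 1 ^ k \<le> F 0 ^ (k - 1) * F k\<close> for the moments \<open>F\<close> at \<open>x\<close>, and \<open>F k \<le> \<parallel>x\<parallel>\<^sup>2 tr W\<^sup>k\<close>. For odd \<open>k\<close> the last
  step is Cauchy-Schwarz in each summand of \<open>W\<close>.
\<close>

lemma frame_trace_gt:
  assumes "odd k" and "0 \<le> t" and x: "t * ip n x x < (\<Sum>i\<in>J. (ip n (b i) x)\<^sup>2)"
  shows "t ^ k < frame_trace n b A J k"
proof -
  let ?F = "frame_moment n b J x"
  from \<open>odd k\<close> obtain q where q: "k = 2 * q + 1" by (rule oddE)
  have F1: "t * ?F 0 < ?F 1" using x by (simp add: frame_moment_0 frame_moment_1)
  have "ip n x x \<noteq> 0"
  proof
    assume 0: "ip n x x = 0"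
    then have "ip n (b i) x = 0" for i using ip_Cauchy_Schwarz[of n "b i" x] by simp
    then show False using x 0 by simp
  qed
  then have F0: "?F 0 > 0" using ip_self_nonneg[of n x] by (simp add: frame_moment_0)
  have pow: "?F 1 ^ Suc m \<le> ?F 0 ^ m * ?F (Suc m)" for m
  proof (induction m)
    case (Suc m)
    have "?F 1 ^ Suc (Suc m) = ?F 1 * ?F 1 ^ Suc m" by simp
    also have "\<dots> \<le> ?F 1 * (?F 0 ^ m * ?F (Suc m))"
      using Suc by (intro mult_left_mono frame_moment_nonneg)
    also have "\<dots> = ?F 0 ^ m * (?F 1 * ?F (Suc m))" by (simp add: mult_ac)
    also have "\<dots> \<le> ?F 0 ^ m * (?F 0 * ?F (1 + Suc m))"
      by (intro mult_left_mono frame_moment_product zero_le_power frame_moment_nonneg)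
    finally show ?case by (simp add: mult_ac)
  qed simp
  have "?F k = (\<Sum>i\<in>J. (ip n x ((frame_op n b J ^^ q) (b i)))\<^sup>2)" unfolding q by (rule frame_moment_odd)
  also have "\<dots> \<le> (\<Sum>i\<in>J. ip n x x * frame_moment n b J (b i) (2 * q))"
    unfolding frame_moment_even by (intro sum_mono ip_Cauchy_Schwarz)
  also have "\<dots> = ?F 0 * frame_trace n b A J k"
    by (simp add: q frame_trace_def frame_moment_0 sum_distrib_left)
  finally have Fk: "?F k \<le> ?F 0 * frame_trace n b A J k" .
  have "?F 0 ^ k * t ^ k = (t * ?F 0) ^ k" by (simp add: power_mult_distrib mult.commute)
  also have "\<dots> < ?F 1 ^ k" using F1 F0 \<open>0 \<le> t\<close> q by (intro power_strict_mono) auto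
  also have "\<dots> \<le> ?F 0 ^ (2 * q) * ?F k" using pow[of "2 * q"] by (simp add: q)
  also have "\<dots> \<le> ?F 0 ^ (2 * q) * (?F 0 * frame_trace n b A J k)"
    using Fk F0 by (intro mult_left_mono) auto
  also have "\<dots> = ?F 0 ^ k * frame_trace n b A J k" by (simp add: q mult_ac)
  finally show ?thesis using F0 by simp
qed

text \<open>
  A matrix Chernoff inequality for sums of independent rank one operators, by Markov's inequality for
  the \<open>k\<close>-th trace moment. It is used with \<open>k\<close> of order \<open>ln (card A)\<close>.
\<close>

lemma frame_Chernoff:
  assumes A: "finite A" and \<delta>: "0 \<le> \<delta>" "\<delta> \<le> 1" and "0 \<le> M"
    and M: "\<And>x. (\<Sum>i\<in>A. (ip n (b i) x)\<^sup>2) \<le> M * ip n x x"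
    and "0 \<le> L" and L: "\<And>i. i \<in> A \<Longrightarrow> ip n (b i) (b i) \<le> L"
    and c: "0 < c" "real k * L \<le> c" "exp 1 * \<delta> * M \<le> c" and "odd k"
  shows "subset_prob \<delta> A (\<lambda>J. \<exists>x. exp 2 * c * ip n x x < (\<Sum>i\<in>J. (ip n (b i) x)\<^sup>2))
    \<le> real (card A) * exp (- 2 * real k)"
proof -
  let ?t = "exp 2 * c"
  have k: "k = Suc (k - 1)" using \<open>odd k\<close> by (cases k) auto
  have "subset_prob \<delta> A (\<lambda>J. \<exists>x. exp 2 * c * ip n x x < (\<Sum>i\<in>J. (ip n (b i) x)\<^sup>2))
      \<le> subset_mean \<delta> A (\<lambda>J. frame_trace n b A J k) / ?t ^ k"
  proof (rule subset_prob_Markov[OF \<delta>])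
    show "0 < ?t ^ k" using c by simp
    show "0 \<le> frame_trace n b A J k" for J
      by (subst k) (simp add: frame_trace_def sum_nonneg frame_moment_nonneg)
    show "?t ^ k \<le> frame_trace n b A J k" if "\<exists>x. ?t * ip n x x < (\<Sum>i\<in>J. (ip n (b i) x)\<^sup>2)" for J
      using that frame_trace_gt[OF \<open>odd k\<close>, where t = ?t and n = n and J = J and b = b and A = A] c by (auto simp: less_imp_le)
  qed
  also have "\<dots> \<le> real (card A) * c ^ k / ?t ^ k"
    using c by (intro divide_right_mono mean_frame_trace_le[OF A \<delta> \<open>0 \<le> M\<close> M \<open>0 \<le> L\<close> L c order_refl]) auto
  also have "\<dots> = real (card A) * exp (- 2 * real k)"
    using c by (simp add: power_mult_distrib exp_minus field_simps flip: exp_of_nat_mult)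
  finally show ?thesis .
qed

section \<open>Duality and decoupling\<close>

text \<open>
  A matrix and its transpose have the same norm; this and the next lemma are the two directions.
\<close>

lemma frame_bound_synthesis:
  assumes J: "finite J" and "0 \<le> N"
    and N: "\<And>y. (\<Sum>i\<in>J. (ip n (v i) y)\<^sup>2) \<le> N * ip n y y"
  shows "ip n (\<lambda>k. \<Sum>i\<in>J. x i * v i k) (\<lambda>k. \<Sum>i\<in>J. x i * v i k) \<le> N * (\<Sum>i\<in>J. (x i)\<^sup>2)"
proof -
  define y where "y = (\<lambda>k. \<Sum>i\<in>J. x i * v i k)"
  have "(ip n y y)\<^sup>2 = (\<Sum>i\<in>J. x i * ip n (v i) y)\<^sup>2"
    by (subst y_def) (simp add: ip_sum_left)
  also have "\<dots> \<le> (\<Sum>i\<in>J. (x i)\<^sup>2) * (\<Sum>i\<in>J. (ip n (v i) y)\<^sup>2)" by (rule Cauchy_Schwarz_ineq_sum)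
  also have "\<dots> \<le> (\<Sum>i\<in>J. (x i)\<^sup>2) * (N * ip n y y)" by (intro mult_left_mono N sum_nonneg) simp
  finally have *: "ip n y y * ip n y y \<le> (N * (\<Sum>i\<in>J. (x i)\<^sup>2)) * ip n y y"
    by (simp add: power2_eq_square mult_ac)
  show ?thesis
  proof (cases "ip n y y = 0")
    case False
    then show ?thesis using * ip_self_nonneg[of n y] by (simp add: y_def)
  qed (use \<open>0 \<le> N\<close> in \<open>simp add: y_def sum_nonneg\<close>)
qed

lemma frame_bound_analysis:
  assumes J: "finite J" and "0 \<le> N"
    and N: "\<And>x. ip n (\<lambda>k. \<Sum>i\<in>J. x i * v i k) (\<lambda>k. \<Sum>i\<in>J. x i * v i k) \<le> N * (\<Sum>i\<in>J. (x i)\<^sup>2)"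
  shows "(\<Sum>i\<in>J. (ip n (v i) y)\<^sup>2) \<le> N * ip n y y"
proof -
  define s where "s = (\<Sum>i\<in>J. (ip n (v i) y)\<^sup>2)"
  define w where "w = (\<lambda>k. \<Sum>i\<in>J. ip n (v i) y * v i k)"
  have "s = ip n w y" by (simp add: s_def w_def ip_sum_left power2_eq_square)
  then have "s\<^sup>2 \<le> ip n w w * ip n y y" using ip_Cauchy_Schwarz by simp
  also have "\<dots> \<le> (N * s) * ip n y y"
    unfolding w_def s_def by (intro mult_right_mono N ip_self_nonneg)
  finally have *: "s * s \<le> (N * ip n y y) * s" by (simp add: power2_eq_square mult_ac)
  have "0 \<le> s" by (simp add: s_def sum_nonneg)
  show ?thesis
  proof (cases "s = 0")
    case False
    then show ?thesis using * \<open>0 \<le> s\<close> by (simp add: s_def)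
  qed (use \<open>0 \<le> N\<close> ip_self_nonneg in \<open>simp add: s_def\<close>)
qed

lemma subset_mean_half_separates:
  assumes "finite A" "i \<in> A" "j \<in> A" "i \<noteq> j"
  shows "subset_mean (1/2) A (\<lambda>T. of_bool (i \<in> T \<and> j \<notin> T)) = 1 / 4"
proof -
  have A: "A = insert i (insert j (A - {i, j}))" using assms by auto
  have fin: "finite (A - {i, j})" using assms by simp
  have "subset_mean (1/2) (A - {i, j}) (\<lambda>T. of_bool (i \<in> T \<and> j \<notin> T)) = subset_mean (1/2) (A - {i, j}) (\<lambda>T. 0)"
    "subset_mean (1/2) (A - {i, j}) (\<lambda>T. of_bool (j \<notin> T)) = subset_mean (1/2) (A - {i, j}) (\<lambda>T. 1)"
    by (rule subset_mean_cong; auto)+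
  then show ?thesis
    using assms fin by (subst A) (simp add: subset_mean_insert subset_mean_const)
qed

text \<open>
  A uniformly random \<open>T\<close> separates a given ordered pair of distinct elements with probability \<open>1/4\<close>.
\<close>

lemma decoupling_identity:
  fixes H :: "'a \<Rightarrow> 'a \<Rightarrow> real"
  assumes A: "finite A" and J: "J \<subseteq> A"
  shows "(\<Sum>i\<in>J. \<Sum>j\<in>J - {i}. H i j) =
    4 * subset_mean (1/2) A (\<lambda>T. \<Sum>i\<in>J \<inter> T. \<Sum>j\<in>J - T. H i j)"
proof -
  have fJ: "finite J" using A J by (rule finite_subset[rotated])
  have "subset_mean (1/2) A (\<lambda>T. \<Sum>i\<in>J \<inter> T. \<Sum>j\<in>J - T. H i j)
      = subset_mean (1/2) A (\<lambda>T. \<Sum>i\<in>J. \<Sum>j\<in>J. H i j * of_bool (i \<in> T \<and> j \<notin> T))"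
  proof (rule subset_mean_cong)
    fix T
    have "(\<Sum>i\<in>J \<inter> T. \<Sum>j\<in>J - T. H i j) = (\<Sum>i\<in>J \<inter> T. \<Sum>j\<in>J. H i j * of_bool (i \<in> T \<and> j \<notin> T))"
      using fJ by (intro sum.cong sum.mono_neutral_cong_left refl) auto
    also have "\<dots> = (\<Sum>i\<in>J. \<Sum>j\<in>J. H i j * of_bool (i \<in> T \<and> j \<notin> T))"
      using fJ by (intro sum.mono_neutral_left) auto
    finally show "(\<Sum>i\<in>J \<inter> T. \<Sum>j\<in>J - T. H i j) = (\<Sum>i\<in>J. \<Sum>j\<in>J. H i j * of_bool (i \<in> T \<and> j \<notin> T))" .
  qed
  also have "\<dots> = (\<Sum>i\<in>J. \<Sum>j\<in>J. H i j * subset_mean (1/2) A (\<lambda>T. of_bool (i \<in> T \<and> j \<notin> T)))"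
    by (simp add: subset_mean_sum subset_mean_cmult)
  also have "\<dots> = (\<Sum>i\<in>J. \<Sum>j\<in>J - {i}. H i j * (1 / 4))"
  proof (rule sum.cong[OF refl])
    fix i assume i: "i \<in> J"
    have "(\<Sum>j\<in>J. H i j * subset_mean (1/2) A (\<lambda>T. of_bool (i \<in> T \<and> j \<notin> T)))
       = (\<Sum>j\<in>J - {i}. H i j * subset_mean (1/2) A (\<lambda>T. of_bool (i \<in> T \<and> j \<notin> T)))"
      using fJ A by (intro sum.mono_neutral_right) (auto simp: subset_mean_const)
    also have "\<dots> = (\<Sum>j\<in>J - {i}. H i j * (1 / 4))"
      using i J A by (intro sum.cong arg_cong2[of _ _ _ _ times] refl subset_mean_half_separates) auto
    finally show "(\<Sum>j\<in>J. H i j * subset_mean (1/2) A (\<lambda>T. of_bool (i \<in> T \<and> j \<notin> T))) = (\<Sum>j\<in>J - {i}. H i j * (1 / 4))" .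
  qed
  finally show ?thesis by (simp add: sum_divide_distrib[symmetric])
qed

text \<open>
  The block of \<open>H\<close> with rows \<open>J1\<close> and columns \<open>J2\<close> has operator norm larger than \<open>\<epsilon>\<close>.
\<close>

definition block_large :: "('a \<Rightarrow> 'a \<Rightarrow> real) \<Rightarrow> real \<Rightarrow> 'a set \<Rightarrow> 'a set \<Rightarrow> bool" where
  "block_large H \<epsilon> J1 J2 \<longleftrightarrow> (\<exists>x. \<epsilon>\<^sup>2 * (\<Sum>j\<in>J2. (x j)\<^sup>2) < (\<Sum>i\<in>J1. (\<Sum>j\<in>J2. H i j * x j)\<^sup>2))"

lemma block_small_bilinear:
  assumes "\<not> block_large H \<epsilon> J1 J2" "0 \<le> \<epsilon>"
  shows "\<bar>\<Sum>i\<in>J1. \<Sum>j\<in>J2. H i j * x i * x j\<bar> \<le> \<epsilon> * sqrt (\<Sum>i\<in>J1. (x i)\<^sup>2) * sqrt (\<Sum>j\<in>J2. (x j)\<^sup>2)"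
proof -
  have "(\<Sum>i\<in>J1. \<Sum>j\<in>J2. H i j * x i * x j)\<^sup>2 = (\<Sum>i\<in>J1. x i * (\<Sum>j\<in>J2. H i j * x j))\<^sup>2"
    by (simp add: sum_distrib_left mult_ac)
  also have "\<dots> \<le> (\<Sum>i\<in>J1. (x i)\<^sup>2) * (\<Sum>i\<in>J1. (\<Sum>j\<in>J2. H i j * x j)\<^sup>2)" by (rule Cauchy_Schwarz_ineq_sum)
  also have "\<dots> \<le> (\<Sum>i\<in>J1. (x i)\<^sup>2) * (\<epsilon>\<^sup>2 * (\<Sum>j\<in>J2. (x j)\<^sup>2))"
    using assms(1) by (intro mult_left_mono sum_nonneg) (auto simp: block_large_def not_less)
  finally have "sqrt ((\<Sum>i\<in>J1. \<Sum>j\<in>J2. H i j * x i * x j)\<^sup>2) \<le> sqrt ((\<Sum>i\<in>J1. (x i)\<^sup>2) * (\<epsilon>\<^sup>2 * (\<Sum>j\<in>J2. (x j)\<^sup>2)))"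
    by (rule real_sqrt_le_mono)
  then show ?thesis using \<open>0 \<le> \<epsilon>\<close> by (simp add: real_sqrt_mult mult_ac)
qed

text \<open>
  Average the decoupled form over \<open>T\<close>: if the block is small, it contributes at most \<open>\<epsilon> \<parallel>x\<parallel>\<^sup>2\<close>;
  otherwise the trivial bound \<open>card A * \<parallel>x\<parallel>\<^sup>2\<close> is enough, because such \<open>T\<close> are rare.
\<close>

lemma offdiagonal_form_le:
  fixes H :: "'a \<Rightarrow> 'a \<Rightarrow> real"
  assumes A: "finite A" and J: "J \<subseteq> A" and "0 \<le> \<epsilon>"
    and H: "\<And>i j. i \<in> A \<Longrightarrow> j \<in> A \<Longrightarrow> \<bar>H i j\<bar> \<le> 1"
    and rare: "real (card A) * subset_prob (1/2) A (\<lambda>T. block_large H \<epsilon> (J \<inter> T) (J - T)) \<le> \<epsilon>"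
  shows "\<bar>\<Sum>i\<in>J. \<Sum>j\<in>J - {i}. H i j * x i * x j\<bar> \<le> 8 * \<epsilon> * (\<Sum>i\<in>J. (x i)\<^sup>2)"
proof -
  define s where "s = (\<Sum>i\<in>J. (x i)\<^sup>2)"
  have s0: "0 \<le> s" by (simp add: s_def sum_nonneg)
  have fJ: "finite J" using A J by (rule finite_subset[rotated])
  let ?Q = "\<lambda>T. \<Sum>i\<in>J \<inter> T. \<Sum>j\<in>J - T. H i j * x i * x j"
  let ?bad = "\<lambda>T. block_large H \<epsilon> (J \<inter> T) (J - T)"
  have part: "sqrt (\<Sum>i\<in>K. (x i)\<^sup>2) \<le> sqrt s" if "K \<subseteq> J" for K
    unfolding s_def using that fJ by (intro real_sqrt_le_mono sum_mono2) auto
  have Q: "\<bar>?Q T\<bar> \<le> \<epsilon> * s + real (card A) * s * of_bool (?bad T)" for T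
  proof (cases "?bad T")
    case False
    have "\<bar>?Q T\<bar> \<le> \<epsilon> * sqrt (\<Sum>i\<in>J \<inter> T. (x i)\<^sup>2) * sqrt (\<Sum>j\<in>J - T. (x j)\<^sup>2)"
      using False \<open>0 \<le> \<epsilon>\<close> by (rule block_small_bilinear)
    also have "\<dots> \<le> \<epsilon> * sqrt s * sqrt s"
      using \<open>0 \<le> \<epsilon>\<close> s0 by (intro mult_mono part) (auto simp: sum_nonneg)
    finally show ?thesis using False s0 by (simp add: mult.assoc)
  next
    case True
    have "\<bar>?Q T\<bar> \<le> (\<Sum>i\<in>J \<inter> T. \<Sum>j\<in>J - T. \<bar>H i j * x i * x j\<bar>)"
      by (rule order_trans[OF sum_abs sum_mono]) (rule sum_abs)
    also have "\<dots> \<le> (\<Sum>i\<in>J \<inter> T. \<Sum>j\<in>J - T. \<bar>x i\<bar> * \<bar>x j\<bar>)"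
    proof (intro sum_mono)
      fix i j assume "i \<in> J \<inter> T" "j \<in> J - T"
      then have "\<bar>H i j\<bar> * (\<bar>x i\<bar> * \<bar>x j\<bar>) \<le> 1 * (\<bar>x i\<bar> * \<bar>x j\<bar>)"
        using J by (intro mult_right_mono H) auto
      then show "\<bar>H i j * x i * x j\<bar> \<le> \<bar>x i\<bar> * \<bar>x j\<bar>" by (simp add: abs_mult mult_ac)
    qed
    also have "\<dots> = (\<Sum>i\<in>J \<inter> T. \<bar>x i\<bar>) * (\<Sum>j\<in>J - T. \<bar>x j\<bar>)" by (simp add: sum_product)
    also have "\<dots> \<le> (\<Sum>i\<in>J. \<bar>x i\<bar>) * (\<Sum>j\<in>J. \<bar>x j\<bar>)"
      using fJ by (intro mult_mono sum_mono2 sum_nonneg) auto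
    also have "\<dots> = (\<Sum>i\<in>J. 1 * \<bar>x i\<bar>)\<^sup>2" by (simp add: power2_eq_square)
    also have "\<dots> \<le> (\<Sum>i\<in>J. 1\<^sup>2) * (\<Sum>i\<in>J. \<bar>x i\<bar>\<^sup>2)" by (rule Cauchy_Schwarz_ineq_sum)
    also have "\<dots> = real (card J) * s" by (simp add: s_def)
    also have "\<dots> \<le> real (card A) * s" using card_mono[OF A J] s0 by (intro mult_right_mono) auto
    moreover have "0 \<le> \<epsilon> * s" using s0 \<open>0 \<le> \<epsilon>\<close> by simp
    ultimately show ?thesis using True by simp
  qed
  have "subset_mean (1/2) A ?Q \<le> subset_mean (1/2) A (\<lambda>T. \<epsilon> * s + real (card A) * s * of_bool (?bad T))"
    "subset_mean (1/2) A (\<lambda>T. - 1 * ?Q T) \<le> subset_mean (1/2) A (\<lambda>T. \<epsilon> * s + real (card A) * s * of_bool (?bad T))"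
    by (intro subset_mean_mono; use Q in \<open>fastforce simp: abs_le_iff\<close>)+
  then have "\<bar>subset_mean (1/2) A ?Q\<bar> \<le> \<epsilon> * s + real (card A) * s * subset_prob (1/2) A ?bad"
    unfolding subset_mean_add subset_mean_cmult subset_mean_const[OF A] subset_prob_def by linarith
  also have "\<dots> \<le> \<epsilon> * s + \<epsilon> * s"
    using mult_right_mono[OF rare s0] by (simp add: mult_ac)
  finally show ?thesis unfolding decoupling_identity[OF A J] by (simp add: s_def)
qed


section \<open>Random column submatrices of a coherent frame\<close>

text \<open>
  The unit vectors \<open>v i\<close> are the columns of the design matrix, \<open>B\<close> is its squared operator norm and
  \<open>\<delta>\<close> the density of the random support.
  
  The numerical constants are chosen as follows. Moments of order \<open>K \<le> 7 ln p\<close> give failure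
  probabilities \<open>p * exp (- 2 K) \<le> p\<^bsup>-7\<^esup>\<close>, and the loss \<open>exp 2\<close> in the Chernoff bound is at most \<open>9\<close>. For a
  row of the Gram matrix both \<open>K\<close> times the squared coherence and \<open>e \<delta> B\<close> are at most \<open>1 / (10\<^sup>6 ln p)\<close>,
  which gives the threshold \<open>9 / (10\<^sup>6 ln p)\<close>. For the squared norm of the submatrix the unit columns
  give the threshold \<open>9 \<cdot> 7 ln p\<close>. For a decoupled block, whose rows are bounded by the first threshold
  and whose norm by the second one, both quantities are at most \<open>63 / 10\<^sup>6\<close>, and \<open>9 \<cdot> 63 / 10\<^sup>6 \<le> (1/16)\<^sup>2\<close>.
\<close>

locale coherent_frame =
  fixes n p :: nat and v :: "nat \<Rightarrow> nat \<Rightarrow> real" and B \<delta> :: real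
  assumes p: "3 \<le> p"
    and unit: "\<And>i. i < p \<Longrightarrow> ip n (v i) (v i) = 1"
    and coh: "\<And>i j. i < p \<Longrightarrow> j < p \<Longrightarrow> i \<noteq> j \<Longrightarrow> \<bar>ip n (v i) (v j)\<bar> \<le> 1 / (4000 * ln p)"
    and B0: "0 \<le> B" and frame: "\<And>y. (\<Sum>i<p. (ip n (v i) y)\<^sup>2) \<le> B * ip n y y"
    and \<delta>: "0 \<le> \<delta>" "\<delta> \<le> 1" and \<delta>B: "\<delta> * B \<le> 1 / (3 * 10 ^ 6 * ln p)"
begin

lemma ln_p_ge_1: "1 \<le> ln (real p)"
proof -
  have "exp 1 \<le> real p" using exp_le p by linarith
  then show ?thesis using p by (subst ln_ge_iff) auto
qed

text \<open>
  The order of the trace moments. It is odd, and at least \<open>4 ln p\<close> so that \<open>exp (- 2 K) \<le> p\<^bsup>-8\<^esup>\<close>.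
\<close>

definition K :: nat where "K = 2 * nat \<lceil>2 * ln (real p)\<rceil> + 1"

lemma odd_K: "odd K" by (simp add: K_def)

lemma K_le: "real K \<le> 7 * ln (real p)"
  using ln_p_ge_1 unfolding K_def by (simp add: algebra_simps) linarith

lemma K_tail: "real p * exp (- 2 * real K) \<le> 1 / real p ^ 7"
proof -
  have "4 * ln (real p) \<le> real K" using ln_p_ge_1 unfolding K_def by (simp add: algebra_simps) linarith
  then have "exp (- 2 * real K) \<le> exp (- (real 8 * ln (real p)))" by simp
  also have "\<dots> = 1 / real p ^ 8"
    using p by (subst exp_minus, subst exp_of_nat_mult) (simp add: divide_inverse)
  finally have "real p * exp (- 2 * real K) \<le> real p * (1 / real p ^ 8)" by (intro mult_left_mono) auto
  also have "\<dots> = 1 / real p ^ 7" using p by (simp add: field_simps eval_nat_numeral)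
  finally show ?thesis .
qed

lemma exp_2_le: "exp (2::real) \<le> 9"
proof -
  have "exp (2::real) = exp 1 * exp 1" by (simp flip: exp_add)
  also have "\<dots> \<le> 3 * 3" by (intro mult_mono exp_le) auto
  finally show ?thesis by simp
qed

lemma e\<delta>B: "exp 1 * \<delta> * B \<le> 1 / (10 ^ 6 * ln p)"
proof -
  have "exp 1 * \<delta> * B \<le> 3 * (\<delta> * B)"
    using \<delta> B0 by (simp only: mult.assoc) (intro mult_right_mono exp_le, simp)
  also have "\<dots> \<le> 3 * (1 / (3 * 10 ^ 6 * ln p))" using \<delta>B by (intro mult_left_mono) auto
  finally show ?thesis by simp
qed

definition rows_small :: "nat set \<Rightarrow> bool" where
  "rows_small J \<longleftrightarrow> (\<forall>j<p. (\<Sum>i\<in>J - {j}. (ip n (v i) (v j))\<^sup>2) \<le> 9 / (10 ^ 6 * ln p))"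

definition frame_small :: "nat set \<Rightarrow> bool" where
  "frame_small J \<longleftrightarrow> (\<forall>y. (\<Sum>i\<in>J. (ip n (v i) y)\<^sup>2) \<le> 63 * ln p * ip n y y)"

lemma finite_sub: "J \<subseteq> {..<p} \<Longrightarrow> finite J"
  by (rule finite_subset) auto

lemma rows_small_mono: "rows_small J \<Longrightarrow> J \<subseteq> {..<p} \<Longrightarrow> J' \<subseteq> J \<Longrightarrow> rows_small J'"
  unfolding rows_small_def by (meson Diff_mono finite_Diff finite_sub order_refl order_trans sum_mono2 zero_le_power2)

lemma frame_small_mono: "frame_small J \<Longrightarrow> J \<subseteq> {..<p} \<Longrightarrow> J' \<subseteq> J \<Longrightarrow> frame_small J'"
  unfolding frame_small_def by (meson finite_sub order_trans sum_mono2 zero_le_power2)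

text \<open>
  For fixed \<open>j\<close> this is the Chernoff bound in dimension one, with the entries of the \<open>j\<close>-th row of the
  Gram matrix as vectors and the diagonal entry replaced by \<open>0\<close>. The mean is at most
  \<open>\<delta> B\<close> and the coherence bounds the size of the summands.
\<close>

lemma prob_not_rows_small: "subset_prob \<delta> {..<p} (\<lambda>J. \<not> rows_small J) \<le> 1 / real p ^ 6"
proof -
  have one: "subset_prob \<delta> {..<p} (\<lambda>J. 9 / (10 ^ 6 * ln p) < (\<Sum>i\<in>J - {j}. (ip n (v i) (v j))\<^sup>2)) \<le> 1 / real p ^ 7"
    if j: "j < p" for j
  proof -
    define b where "b = (\<lambda>i k::nat. if i = j then 0 else ip n (v i) (v j))"
    define c where "c = 1 / (10 ^ 6 * ln p)"
    have ip1: "ip 1 x y = x 0 * y 0" for x y by (simp add: ip_def)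
    note ip1 = ip1 ip1[unfolded One_nat_def]
    have "subset_prob \<delta> {..<p} (\<lambda>J. \<exists>x. exp 2 * c * ip 1 x x < (\<Sum>i\<in>J. (ip 1 (b i) x)\<^sup>2))
        \<le> real (card {..<p}) * exp (- 2 * real K)"
    proof (rule frame_Chernoff[OF _ \<delta> B0, where L = "(1 / (4000 * ln p))\<^sup>2"])
      show "(\<Sum>i<p. (ip 1 (b i) x)\<^sup>2) \<le> B * ip 1 x x" for x
      proof -
        have "(\<Sum>i<p. (ip 1 (b i) x)\<^sup>2) \<le> (\<Sum>i<p. (ip n (v i) (v j))\<^sup>2 * (x 0)\<^sup>2)"
          unfolding ip1 b_def by (intro sum_mono) (auto simp: power_mult_distrib)
        also have "\<dots> = (\<Sum>i<p. (ip n (v i) (v j))\<^sup>2) * (x 0)\<^sup>2" by (simp add: sum_distrib_right)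
        also have "\<dots> \<le> B * ip n (v j) (v j) * (x 0)\<^sup>2" by (intro mult_right_mono frame) simp
        finally show ?thesis using unit[OF j] by (simp add: ip1 power2_eq_square)
      qed
      show "ip 1 (b i) (b i) \<le> (1 / (4000 * ln p))\<^sup>2" if "i \<in> {..<p}" for i
        using coh[of i j] that j abs_le_square_iff[of "ip n (v i) (v j)" "1 / (4000 * ln p)"] ln_p_ge_1
        by (auto simp: ip1 b_def power2_eq_square)
      show "0 < c" using ln_p_ge_1 by (simp add: c_def)
      show "real K * (1 / (4000 * ln p))\<^sup>2 \<le> c"
      proof -
        have "real K * (1 / (4000 * ln p))\<^sup>2 \<le> 7 * ln p * (1 / (4000 * ln p))\<^sup>2"
          by (intro mult_right_mono K_le) simp
        also have "\<dots> \<le> c" using ln_p_ge_1 unfolding c_def by (simp add: field_simps power2_eq_square)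
        finally show ?thesis .
      qed
      show "exp 1 * \<delta> * B \<le> c" unfolding c_def by (rule e\<delta>B)
    qed (use odd_K in auto)
    also have "\<dots> \<le> 1 / real p ^ 7" using K_tail by simp
    finally have *: "subset_prob \<delta> {..<p} (\<lambda>J. \<exists>x. exp 2 * c * ip 1 x x < (\<Sum>i\<in>J. (ip 1 (b i) x)\<^sup>2)) \<le> 1 / real p ^ 7" .
    show ?thesis
    proof (rule order_trans[OF subset_prob_mono[OF \<delta>] *])
      fix J assume J: "J \<subseteq> {..<p}" and large: "9 / (10 ^ 6 * ln p) < (\<Sum>i\<in>J - {j}. (ip n (v i) (v j))\<^sup>2)"
      have "exp 2 * c \<le> 9 * c" using ln_p_ge_1 by (intro mult_right_mono exp_2_le) (simp add: c_def)
      also have "\<dots> < (\<Sum>i\<in>J - {j}. (ip n (v i) (v j))\<^sup>2)" using large by (simp add: c_def)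
      also have "\<dots> = (\<Sum>i\<in>J. (ip 1 (b i) (\<lambda>_. 1))\<^sup>2)"
        using finite_sub[OF J] by (intro sum.mono_neutral_cong_left) (auto simp: ip1 b_def)
      finally show "\<exists>x. exp 2 * c * ip 1 x x < (\<Sum>i\<in>J. (ip 1 (b i) x)\<^sup>2)"
        by (intro exI[of _ "\<lambda>_. 1"]) (simp add: ip1)
    qed
  qed
  have "subset_prob \<delta> {..<p} (\<lambda>J. \<not> rows_small J)
      \<le> subset_prob \<delta> {..<p} (\<lambda>J. \<exists>j\<in>{..<p}. 9 / (10 ^ 6 * ln p) < (\<Sum>i\<in>J - {j}. (ip n (v i) (v j))\<^sup>2))"
    by (intro subset_prob_mono \<delta>) (auto simp: rows_small_def not_le)
  also have "\<dots> \<le> (\<Sum>j<p. subset_prob \<delta> {..<p} (\<lambda>J. 9 / (10 ^ 6 * ln p) < (\<Sum>i\<in>J - {j}. (ip n (v i) (v j))\<^sup>2)))"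
    by (rule subset_prob_bex_le[OF \<delta>]) simp
  also have "\<dots> \<le> (\<Sum>j<p. 1 / real p ^ 7)" by (intro sum_mono one) simp
  also have "\<dots> = 1 / real p ^ 6" using p by (simp add: field_simps eval_nat_numeral)
  finally show ?thesis .
qed

text \<open>
  Here the summands have norm one, so the Chernoff bound cannot go below the order of \<open>ln p\<close>. This
  crude estimate only serves to bound the mean in the next application.
\<close>

lemma prob_not_frame_small: "subset_prob \<delta> {..<p} (\<lambda>J. \<not> frame_small J) \<le> 1 / real p ^ 7"
proof -
  have "subset_prob \<delta> {..<p} (\<lambda>J. \<not> frame_small J)
      \<le> subset_prob \<delta> {..<p} (\<lambda>J. \<exists>y. exp 2 * (7 * ln p) * ip n y y < (\<Sum>i\<in>J. (ip n (v i) y)\<^sup>2))"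
  proof (rule subset_prob_mono[OF \<delta>])
    fix J assume "\<not> frame_small J"
    then obtain y where "63 * ln p * ip n y y < (\<Sum>i\<in>J. (ip n (v i) y)\<^sup>2)"
      by (auto simp: frame_small_def not_le)
    moreover have "exp 2 * (7 * ln p) * ip n y y \<le> 9 * (7 * ln p) * ip n y y"
      using ln_p_ge_1 by (intro mult_right_mono exp_2_le ip_self_nonneg) auto
    ultimately show "\<exists>y. exp 2 * (7 * ln p) * ip n y y < (\<Sum>i\<in>J. (ip n (v i) y)\<^sup>2)"
      by (intro exI[of _ y]) linarith
  qed
  also have "\<dots> \<le> real (card {..<p}) * exp (- 2 * real K)"
  proof (rule frame_Chernoff[OF _ \<delta> B0 _ zero_le_one])
    show "exp 1 * \<delta> * B \<le> 7 * ln p"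
    proof (rule order_trans[OF e\<delta>B])
      have "1 / (10 ^ 6 * ln (real p)) \<le> 1" using ln_p_ge_1 by (simp add: field_simps)
      then show "1 / (10 ^ 6 * ln (real p)) \<le> 7 * ln p" using ln_p_ge_1 by linarith
    qed
  qed (use frame unit K_le odd_K ln_p_ge_1 in auto)
  also have "\<dots> \<le> 1 / real p ^ 7" using K_tail by simp
  finally show ?thesis .
qed

definition offdiag :: "nat \<Rightarrow> nat \<Rightarrow> real" where "offdiag i j = ip n (v i) (v j)"

text \<open>
  With the columns \<open>J2\<close> fixed, the rows of the block are the vectors of a random frame operator in
  \<open>\<real>\<^sup>p\<close>. Since \<open>J2\<close> and \<open>T\<close> are disjoint, smallness of the rows bounds each summand by
  \<open>9 / (10\<^sup>6 ln p)\<close>. The mean is at most \<open>\<delta> B\<close> times the squared norm of the submatrix on \<open>J2\<close>.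
\<close>

lemma prob_block_large:
  assumes J2: "J2 \<subseteq> {..<p}" "rows_small J2" "frame_small J2" and T: "T \<subseteq> {..<p}" "T \<inter> J2 = {}"
  shows "subset_prob \<delta> T (\<lambda>J1. block_large offdiag (1/16) J1 J2) \<le> 1 / real p ^ 7"
proof -
  define b where "b = (\<lambda>i j. if j \<in> J2 then offdiag i j else 0)"
  define c where "c = 63 / (10 ^ 6 :: real)"
  have ipb: "ip p (b i) x = (\<Sum>j\<in>J2. offdiag i j * x j)" for i x
    unfolding ip_def b_def using J2(1) by (intro sum.mono_neutral_cong_right) auto
  have ipx: "(\<Sum>j\<in>J2. (x j)\<^sup>2) \<le> ip p x x" for x
    unfolding ip_def power2_eq_square using J2(1) by (intro sum_mono2) auto
  have "subset_prob \<delta> T (\<lambda>J1. block_large offdiag (1/16) J1 J2)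
     \<le> subset_prob \<delta> T (\<lambda>J1. \<exists>x. exp 2 * c * ip p x x < (\<Sum>i\<in>J1. (ip p (b i) x)\<^sup>2))"
  proof (rule subset_prob_mono[OF \<delta>])
    fix J1 assume "block_large offdiag (1/16) J1 J2"
    then obtain x where x: "(1/16)\<^sup>2 * (\<Sum>j\<in>J2. (x j)\<^sup>2) < (\<Sum>i\<in>J1. (\<Sum>j\<in>J2. offdiag i j * x j)\<^sup>2)"
      by (auto simp: block_large_def)
    define x' where "x' = (\<lambda>j. if j \<in> J2 then x j else 0)"
    have "ip p x' x' = (\<Sum>j\<in>J2. (x j)\<^sup>2)"
      unfolding ip_def x'_def power2_eq_square using J2(1) by (intro sum.mono_neutral_cong_right) auto
    moreover have "ip p (b i) x' = (\<Sum>j\<in>J2. offdiag i j * x j)" for i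
      unfolding ipb by (intro sum.cong) (auto simp: x'_def)
    moreover have "exp 2 * c * (\<Sum>j\<in>J2. (x j)\<^sup>2) \<le> (1/16)\<^sup>2 * (\<Sum>j\<in>J2. (x j)\<^sup>2)"
    proof (intro mult_right_mono sum_nonneg)
      have "exp 2 * c \<le> 9 * c" by (intro mult_right_mono exp_2_le) (simp add: c_def)
      then show "exp 2 * c \<le> (1/16)\<^sup>2" by (simp add: c_def power2_eq_square)
    qed simp
    ultimately show "\<exists>x. exp 2 * c * ip p x x < (\<Sum>i\<in>J1. (ip p (b i) x)\<^sup>2)"
      using x by (intro exI[of _ x']) simp
  qed
  also have "\<dots> \<le> real (card T) * exp (- 2 * real K)"
  proof (rule frame_Chernoff[OF finite_sub[OF T(1)] \<delta>, where M = "B * (63 * ln p)" and L = "9 / (10 ^ 6 * ln p)"])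
    show "(\<Sum>i\<in>T. (ip p (b i) x)\<^sup>2) \<le> B * (63 * ln p) * ip p x x" for x
    proof -
      define y where "y = (\<lambda>k. \<Sum>j\<in>J2. x j * v j k)"
      have "ip p (b i) x = ip n (v i) y" for i
        unfolding ipb y_def ip_sum_right by (simp add: offdiag_def mult.commute)
      then have "(\<Sum>i\<in>T. (ip p (b i) x)\<^sup>2) = (\<Sum>i\<in>T. (ip n (v i) y)\<^sup>2)" by simp
      also have "\<dots> \<le> (\<Sum>i<p. (ip n (v i) y)\<^sup>2)" using T by (intro sum_mono2) auto
      also have "\<dots> \<le> B * ip n y y" by (rule frame)
      also have "ip n y y \<le> 63 * ln p * (\<Sum>j\<in>J2. (x j)\<^sup>2)"
        unfolding y_def using J2 finite_sub ln_p_ge_1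
        by (intro frame_bound_synthesis) (auto simp: frame_small_def)
      also have "\<dots> \<le> 63 * ln p * ip p x x" using ln_p_ge_1 by (intro mult_left_mono ipx) auto
      finally show ?thesis using B0 by (simp add: mult_left_mono mult.assoc)
    qed
    show "ip p (b i) (b i) \<le> 9 / (10 ^ 6 * ln p)" if i: "i \<in> T" for i
    proof -
      have "ip p (b i) (b i) = (\<Sum>j\<in>J2. (ip n (v j) (v i))\<^sup>2)"
        unfolding ipb by (intro sum.cong) (auto simp: b_def offdiag_def power2_eq_square ip_commute)
      also have "J2 = J2 - {i}" using i T by auto
      finally show ?thesis using J2(2) i T by (auto simp: rows_small_def)
    qed
    show "real K * (9 / (10 ^ 6 * ln p)) \<le> c"
    proof -
      have "real K * (9 / (10 ^ 6 * ln p)) \<le> 7 * ln p * (9 / (10 ^ 6 * ln p))"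
        using ln_p_ge_1 by (intro mult_right_mono K_le) auto
      also have "\<dots> = c" using ln_p_ge_1 by (simp add: c_def)
      finally show ?thesis .
    qed
    show "exp 1 * \<delta> * (B * (63 * ln p)) \<le> c"
    proof -
      have "exp 1 * \<delta> * (B * (63 * ln p)) = (exp 1 * \<delta> * B) * (63 * ln p)" by (simp add: mult_ac)
      also have "\<dots> \<le> 1 / (10 ^ 6 * ln p) * (63 * ln p)"
        using ln_p_ge_1 by (intro mult_right_mono e\<delta>B) auto
      also have "\<dots> = c" using ln_p_ge_1 by (simp add: c_def)
      finally show ?thesis .
    qed
  qed (use B0 ln_p_ge_1 odd_K in \<open>auto simp: c_def\<close>)
  also have "\<dots> \<le> real p * exp (- 2 * real K)"
    using card_mono[OF _ T(1)] by (intro mult_right_mono) auto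
  also have "\<dots> \<le> 1 / real p ^ 7" by (rule K_tail)
  finally show ?thesis .
qed

text \<open>
  For a fixed \<open>T\<close> the parts of \<open>J\<close> inside and outside of \<open>T\<close> are independent, and smallness is inherited
  by subsets, so the bound conditional on the outer part can be averaged.
\<close>

lemma prob_block_large_split:
  assumes T: "T \<subseteq> {..<p}"
  shows "subset_prob \<delta> {..<p} (\<lambda>J. rows_small J \<and> frame_small J \<and> block_large offdiag (1/16) (J \<inter> T) (J - T)) \<le> 1 / real p ^ 7"
    (is "subset_prob _ _ ?P \<le> _")
proof -
  let ?C = "{..<p} - T"
  have split: "{..<p} = ?C \<union> T" using T by auto
  have "subset_prob \<delta> {..<p} ?P = subset_mean \<delta> ?C (\<lambda>J2. subset_mean \<delta> T (\<lambda>J1. of_bool (?P (J2 \<union> J1))))"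
    unfolding subset_prob_def using finite_sub[OF T] by (subst split, subst subset_mean_Un) auto
  also have "\<dots> \<le> subset_mean \<delta> ?C (\<lambda>J2. 1 / real p ^ 7)"
  proof (rule subset_mean_mono[OF \<delta>])
    fix J2 assume J2: "J2 \<subseteq> ?C"
    show "subset_mean \<delta> T (\<lambda>J1. of_bool (?P (J2 \<union> J1))) \<le> 1 / real p ^ 7"
    proof (cases "rows_small J2 \<and> frame_small J2")
      case True
      have "subset_mean \<delta> T (\<lambda>J1. of_bool (?P (J2 \<union> J1))) \<le> subset_prob \<delta> T (\<lambda>J1. block_large offdiag (1/16) J1 J2)"
        unfolding subset_prob_def
      proof (rule subset_mean_mono[OF \<delta>])
        fix J1 assume "J1 \<subseteq> T"
        then have "(J2 \<union> J1) \<inter> T = J1" "J2 \<union> J1 - T = J2" using J2 by auto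
        then show "of_bool (?P (J2 \<union> J1)) \<le> (of_bool (block_large offdiag (1/16) J1 J2) :: real)" by simp
      qed
      also have "\<dots> \<le> 1 / real p ^ 7" using J2 True T by (intro prob_block_large) auto
      finally show ?thesis .
    next
      case False
      have "\<not> ?P (J2 \<union> J1)" if "J1 \<subseteq> T" for J1
      proof -
        have "J2 \<union> J1 \<subseteq> {..<p}" using that T J2 by auto
        then show ?thesis using False rows_small_mono[of "J2 \<union> J1" J2] frame_small_mono[of "J2 \<union> J1" J2] by auto
      qed
      then have "subset_mean \<delta> T (\<lambda>J1. of_bool (?P (J2 \<union> J1))) = subset_mean \<delta> T (\<lambda>J1. 0)"
        by (intro subset_mean_cong) simp
      then show ?thesis using finite_sub[OF T] by (simp add: subset_mean_const)
    qed
  qed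
  also have "\<dots> = 1 / real p ^ 7" by (simp add: subset_mean_const)
  finally show ?thesis .
qed

text \<open>
  The least eigenvalue of the Gram matrix on \<open>J\<close> is at least \<open>1/2\<close>.
\<close>

definition well_conditioned :: "nat set \<Rightarrow> bool" where
  "well_conditioned J \<longleftrightarrow>
    (\<forall>x. (\<Sum>i\<in>J. (x i)\<^sup>2) / 2 \<le> ip n (\<lambda>k. \<Sum>i\<in>J. x i * v i k) (\<lambda>k. \<Sum>i\<in>J. x i * v i k))"

lemma abs_offdiag_le: "i < p \<Longrightarrow> j < p \<Longrightarrow> \<bar>offdiag i j\<bar> \<le> 1"
  using ip_Cauchy_Schwarz[of n "v i" "v j"] by (simp add: offdiag_def unit abs_square_le_1)

lemma well_conditionedI:
  assumes J: "J \<subseteq> {..<p}"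
    and rare: "real p * subset_prob (1/2) {..<p} (\<lambda>T. block_large offdiag (1/16) (J \<inter> T) (J - T)) \<le> 1/16"
  shows "well_conditioned J"
  unfolding well_conditioned_def
proof
  fix x :: "nat \<Rightarrow> real"
  have "\<bar>\<Sum>i\<in>J. \<Sum>j\<in>J - {i}. offdiag i j * x i * x j\<bar> \<le> 8 * (1/16) * (\<Sum>i\<in>J. (x i)\<^sup>2)"
    using J rare abs_offdiag_le by (intro offdiagonal_form_le[of "{..<p}"]) auto
  moreover have "ip n (\<lambda>k. \<Sum>i\<in>J. x i * v i k) (\<lambda>k. \<Sum>i\<in>J. x i * v i k)
      = (\<Sum>i\<in>J. (x i)\<^sup>2) + (\<Sum>i\<in>J. \<Sum>j\<in>J - {i}. offdiag i j * x i * x j)"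
  proof -
    have "ip n (\<lambda>k. \<Sum>i\<in>J. x i * v i k) (\<lambda>k. \<Sum>i\<in>J. x i * v i k) = (\<Sum>i\<in>J. \<Sum>j\<in>J. offdiag i j * x i * x j)"
      unfolding ip_sum_left ip_sum_right by (simp add: sum_distrib_left offdiag_def mult_ac)
    also have "\<dots> = (\<Sum>i\<in>J. (x i)\<^sup>2 + (\<Sum>j\<in>J - {i}. offdiag i j * x i * x j))"
    proof (rule sum.cong[OF refl])
      fix i assume i: "i \<in> J"
      then have "offdiag i i = 1" using J by (auto simp: offdiag_def unit)
      then show "(\<Sum>j\<in>J. offdiag i j * x i * x j) = (x i)\<^sup>2 + (\<Sum>j\<in>J - {i}. offdiag i j * x i * x j)"
        using finite_sub[OF J] i by (simp add: sum.remove[of J i] power2_eq_square)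
    qed
    finally show ?thesis by (simp add: sum.distrib)
  qed
  ultimately show "(\<Sum>i\<in>J. (x i)\<^sup>2) / 2 \<le> ip n (\<lambda>k. \<Sum>i\<in>J. x i * v i k) (\<lambda>k. \<Sum>i\<in>J. x i * v i k)"
    by (simp add: abs_le_iff)
qed

text \<open>
  If \<open>J\<close> is not well conditioned, then more than a fraction \<open>1 / (16 p)\<close> of the sets \<open>T\<close> give a large
  block. By Markov's inequality this costs a factor \<open>16 p\<close> over the probability for a single \<open>T\<close>.
\<close>

lemma prob_not_well_conditioned:
  "subset_prob \<delta> {..<p} (\<lambda>J. rows_small J \<and> frame_small J \<and> \<not> well_conditioned J) \<le> 16 / real p ^ 6"
proof -
  let ?bad = "\<lambda>J T. block_large offdiag (1/16) (J \<inter> T) (J - T)"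
  let ?f = "\<lambda>J. subset_mean (1/2) {..<p} (\<lambda>T. of_bool (rows_small J \<and> frame_small J \<and> ?bad J T))"
  have "subset_prob \<delta> {..<p} (\<lambda>J. rows_small J \<and> frame_small J \<and> \<not> well_conditioned J)
      \<le> subset_mean \<delta> {..<p} ?f / (1 / (16 * real p))"
  proof (rule subset_prob_Markov[OF \<delta>])
    show "0 < 1 / (16 * real p)" using p by simp
    show "0 \<le> ?f J" for J by (rule subset_mean_nonneg) auto
    show "1 / (16 * real p) \<le> ?f J" if J: "J \<subseteq> {..<p}" and *: "rows_small J \<and> frame_small J \<and> \<not> well_conditioned J" for J
    proof -
      have "?f J = subset_prob (1/2) {..<p} (?bad J)" using * by (simp add: subset_prob_def)
      moreover have "1/16 < real p * subset_prob (1/2) {..<p} (?bad J)"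
        using well_conditionedI[OF J] * by (meson not_le)
      ultimately show ?thesis using p by (simp add: field_simps)
    qed
  qed
  also have "\<dots> = 16 * real p * subset_mean (1/2) {..<p} (\<lambda>T. subset_prob \<delta> {..<p} (\<lambda>J. rows_small J \<and> frame_small J \<and> ?bad J T))"
    by (subst subset_mean_swap) (simp add: subset_prob_def)
  also have "\<dots> \<le> 16 * real p * subset_mean (1/2) {..<p} (\<lambda>T. 1 / real p ^ 7)"
    by (intro mult_left_mono subset_mean_mono prob_block_large_split) auto
  also have "\<dots> = 16 / real p ^ 6" using p by (simp add: subset_mean_const field_simps eval_nat_numeral)
  finally show ?thesis .
qed

definition good :: "nat set \<Rightarrow> bool" where
  "good J \<longleftrightarrow> rows_small J \<and> well_conditioned J"

theorem prob_not_good: "subset_prob \<delta> {..<p} (\<lambda>J. \<not> good J) \<le> 18 / real p ^ 6"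
proof -
  have "subset_prob \<delta> {..<p} (\<lambda>J. \<not> good J) \<le> subset_prob \<delta> {..<p} (\<lambda>J. \<not> rows_small J \<or>
      (\<not> frame_small J \<or> (rows_small J \<and> frame_small J \<and> \<not> well_conditioned J)))"
    by (intro subset_prob_mono \<delta>) (auto simp: good_def)
  also have "\<dots> \<le> 1 / real p ^ 6 + (1 / real p ^ 7 + 16 / real p ^ 6)"
    by (intro order_trans[OF subset_prob_disj_le[OF \<delta>]] add_mono
        prob_not_rows_small prob_not_frame_small prob_not_well_conditioned)
  also have "1 / real p ^ 7 \<le> 1 / real p ^ 6"
    using p by (intro divide_left_mono power_increasing) auto
  finally show ?thesis by simp
qed

end

section \<open>From Bernoulli subsets to uniform subsets of a given size\<close>

lemma binomial_weight_le_mode: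
  assumes S: "S < p" and j: "j \<le> p"
  shows "real (p choose j) * real S ^ j * real (p - S) ^ (p - j)
    \<le> real (p choose S) * real S ^ S * real (p - S) ^ (p - S)"
proof -
  define t where "t = (\<lambda>j. real (p choose j) * real S ^ j * real (p - S) ^ (p - j))"
  have ratio: "t (Suc j) * (real (Suc j) * real (p - S)) = t j * (real (p - j) * real S)" if "j < p" for j
  proof -
    have "Suc j * (p choose Suc j) = (p - j) * (p choose j)"
      by (metis binomial_absorb_comp binomial_absorption mult.commute that Suc_pred' less_imp_Suc_add diff_Suc_1 zero_less_Suc gr_implies_not_zero not0_implies_Suc)
    then have c: "real (Suc j) * real (p choose Suc j) = real (p - j) * real (p choose j)"
      by (metis of_nat_mult)
    have e: "p - j = Suc (p - Suc j)" using that by simp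
    have "t (Suc j) * (real (Suc j) * real (p - S)) =
        (real (Suc j) * real (p choose Suc j)) * real S ^ Suc j * (real (p - S) ^ (p - Suc j) * real (p - S))"
      by (simp add: t_def mult_ac)
    also have "real (p - S) ^ (p - Suc j) * real (p - S) = real (p - S) ^ (p - j)" by (subst e) simp
    finally show ?thesis unfolding c by (simp add: t_def mult_ac)
  qed
  have t0: "0 \<le> t j" for j by (simp add: t_def)
  have pos: "0 < real (Suc j) * real (p - S)" for j using S by simp
  have up: "t j \<le> t (Suc j)" if "j < S" for j
  proof -
    have "real (Suc j) * real (p - S) \<le> real (p - j) * real S"
    proof -
      have "real p * 1 \<le> real p * (real S - real j)" using that by (intro mult_left_mono) auto
      then show ?thesis using that S by (simp add: of_nat_diff algebra_simps)
    qed
    then have "t j * (real (Suc j) * real (p - S)) \<le> t j * (real (p - j) * real S)"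
      by (rule mult_left_mono) (rule t0)
    also have "\<dots> = t (Suc j) * (real (Suc j) * real (p - S))" using ratio[of j] that S by simp
    finally show ?thesis using pos[of j] by (rule mult_right_le_imp_le)
  qed
  have down: "t (Suc j) \<le> t j" if "S \<le> j" "j < p" for j
  proof -
    have "real (p - j) * real S \<le> real (Suc j) * real (p - S)"
    proof -
      have "real p * real S \<le> real p * real j" using that by (intro mult_left_mono) auto
      moreover have "real (p - j) * real S = real p * real S - real j * real S"
        "real (Suc j) * real (p - S) = real p * real j + real p - real j * real S - real S"
        using that S by (simp_all add: of_nat_diff algebra_simps)
      moreover have "real S \<le> real p" using S by simp
      ultimately show ?thesis by linarith
    qed
    then have "t j * (real (p - j) * real S) \<le> t j * (real (Suc j) * real (p - S))"
      by (rule mult_left_mono) (rule t0)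
    then have "t (Suc j) * (real (Suc j) * real (p - S)) \<le> t j * (real (Suc j) * real (p - S))"
      using ratio[of j] that by simp
    then show ?thesis using pos[of j] by (rule mult_right_le_imp_le)
  qed
  have "t j \<le> t S"
  proof (cases "j \<le> S")
    case True
    then show ?thesis
    proof (induction j rule: inc_induct)
      case (step m) then show ?case using up[of m] by simp
    qed simp
  next
    case False
    then have "S \<le> j" by simp
    then show ?thesis using j
    proof (induction j rule: dec_induct)
      case (step m) then show ?case using down[of m] by simp
    qed simp
  qed
  then show ?thesis by (simp add: t_def)
qed

lemma binomial_weight_at_mean_ge:
  assumes S: "S \<le> p" and p: "0 < p"
  shows "1 / (real p + 1) \<le> real (p choose S) * (real S / real p) ^ S * (1 - real S / real p) ^ (p - S)"
proof (cases "S = p")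
  case False
  with S have S: "S < p" by simp
  have "real p ^ p = (real S + real (p - S)) ^ p" using S by (simp add: of_nat_diff)
  also have "\<dots> = (\<Sum>j\<le>p. real (p choose j) * real S ^ j * real (p - S) ^ (p - j))" by (rule binomial_ring)
  also have "\<dots> \<le> (\<Sum>j\<le>p. real (p choose S) * real S ^ S * real (p - S) ^ (p - S))"
    by (intro sum_mono binomial_weight_le_mode S) simp
  also have "\<dots> = (real p + 1) * (real (p choose S) * real S ^ S * real (p - S) ^ (p - S))" by simp
  also have "real S ^ S * real (p - S) ^ (p - S) = (real S / real p) ^ S * (1 - real S / real p) ^ (p - S) * real p ^ p"
  proof -
    have "real p ^ p = real p ^ S * real p ^ (p - S)" using S by (simp flip: power_add)
    moreover have "(1 - real S / real p) = real (p - S) / real p" using S p by (simp add: of_nat_diff field_simps)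
    ultimately show ?thesis using p by (simp add: power_divide)
  qed
  then have "(real p + 1) * (real (p choose S) * real S ^ S * real (p - S) ^ (p - S)) =
    (real p + 1) * (real (p choose S) * (real S / real p) ^ S * (1 - real S / real p) ^ (p - S)) * real p ^ p"
    by (simp add: mult.assoc)
  finally have "1 * real p ^ p \<le> (real p + 1) * (real (p choose S) * (real S / real p) ^ S * (1 - real S / real p) ^ (p - S)) * real p ^ p"
    by simp
  then have "1 \<le> (real p + 1) * (real (p choose S) * (real S / real p) ^ S * (1 - real S / real p) ^ (p - S))"
    using p by (subst (asm) mult_le_cancel_right_pos) auto
  then show ?thesis by (simp add: field_simps)
qed (use p in simp)

text \<open>
  A Bernoulli subset of density \<open>S / p\<close>, conditioned on having \<open>S\<close> elements, is uniform. The condition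
  has probability at least \<open>1 / (p + 1)\<close>, because \<open>S\<close> is the mode of the binomial distribution. The
  factor \<open>p + 1\<close> is harmless as the probability of a bad Bernoulli subset is at most a multiple of a high power of \<open>1 / p\<close>.
\<close>

lemma uniform_subset_prob_le:
  assumes S: "S \<le> p" and p: "0 < p"
  shows "measure_pmf.prob (pmf_of_set {I. I \<subseteq> {..<p} \<and> card I = S}) {I. P I}
    \<le> (real p + 1) * subset_prob (real S / real p) {..<p} P"
proof -
  let ?\<S> = "{I. I \<subseteq> {..<p} \<and> card I = S}" and ?\<delta> = "real S / real p"
  have fin: "finite ?\<S>" by simp
  have card: "card ?\<S> = p choose S" using n_subsets[of "{..<p}" S] by simp
  have pos: "0 < p choose S" using S by simp
  then have ne: "?\<S> \<noteq> {}" using card by (metis card.empty less_numeral_extra(3))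
  define N where "N = real (card (?\<S> \<inter> {I. P I}))"
  define w where "w = ?\<delta> ^ S * (1 - ?\<delta>) ^ (p - S)"
  have \<delta>: "0 \<le> ?\<delta>" "?\<delta> \<le> 1" using S p by auto
  have "N * w = (\<Sum>I\<in>?\<S> \<inter> {I. P I}. w)" by (simp add: N_def)
  also have "\<dots> = (\<Sum>I\<in>?\<S> \<inter> {I. P I}. ?\<delta> ^ card I * (1 - ?\<delta>) ^ card ({..<p} - I) * of_bool (P I))"
    by (intro sum.cong refl) (auto simp: w_def card_Diff_subset finite_subset[of _ "{..<p}"])
  also have "\<dots> \<le> subset_prob ?\<delta> {..<p} P"
    unfolding subset_prob_def subset_mean_def using \<delta> by (intro sum_mono2) auto
  finally have le: "N * w \<le> subset_prob ?\<delta> {..<p} P" .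
  have "measure_pmf.prob (pmf_of_set ?\<S>) {I. P I} = N / real (p choose S)"
    using ne fin by (simp add: measure_pmf_of_set N_def card)
  also have "\<dots> \<le> (real p + 1) * (N * w)"
  proof -
    have "1 \<le> (real p + 1) * (real (p choose S) * w)"
      using binomial_weight_at_mean_ge[OF S p] by (simp add: w_def field_simps)
    then have "N * 1 \<le> N * ((real p + 1) * (real (p choose S) * w))" by (intro mult_left_mono) (auto simp: N_def)
    then show ?thesis using pos by (simp add: field_simps)
  qed
  also have "\<dots> \<le> (real p + 1) * subset_prob ?\<delta> {..<p} P" by (intro mult_left_mono le) auto
  finally show ?thesis .
qed

section \<open>The lasso: existence, optimality and the dual certificate\<close>

lemma attains_min_on_rvec:
  fixes f :: "(nat \<Rightarrow> real) \<Rightarrow> real"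
  assumes cont: "continuous_on UNIV f"
    and coercive: "\<And>b j. b \<in> rvec p \<Longrightarrow> j < p \<Longrightarrow> R < \<bar>b j\<bar> \<Longrightarrow> f (\<lambda>j\<in>{..<p}. 0) \<le> f b"
  shows "\<exists>b\<in>rvec p. \<forall>b'\<in>rvec p. f b \<le> f b'"
proof -
  define R' where "R' = max R 0"
  define C where "C = (\<lambda>j::nat. if j < p then {- R'..R'} else {undefined :: real})"
  have box: "b \<in> PiE UNIV C \<longleftrightarrow> b \<in> rvec p \<and> (\<forall>j<p. \<bar>b j\<bar> \<le> R')" for b
    by (auto simp: PiE_iff C_def extensional_def abs_le_iff split: if_splits)
  have "compactin (product_topology (\<lambda>i. euclidean) UNIV) (PiE UNIV C)"
    unfolding compactin_PiE by (auto simp: C_def compact_Icc)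
  then have "compact (PiE UNIV C)"
    by (simp add: euclidean_product_topology)
  moreover have z: "(\<lambda>j\<in>{..<p}. 0) \<in> PiE UNIV C" unfolding box by (auto simp: R'_def)
  ultimately obtain b where b: "b \<in> PiE UNIV C" "\<And>b'. b' \<in> PiE UNIV C \<Longrightarrow> f b \<le> f b'"
    using continuous_attains_inf[of "PiE UNIV C" f] continuous_on_subset[OF cont subset_UNIV] by blast
  show ?thesis
  proof (intro bexI ballI)
    show "b \<in> rvec p" using b(1) box by simp
    fix b' assume b': "b' \<in> rvec p"
    show "f b \<le> f b'"
    proof (cases "b' \<in> PiE UNIV C")
      case False
      then obtain j where "j < p" "R < \<bar>b' j\<bar>" using b' unfolding box by (auto simp: not_le R'_def)
      then show ?thesis using coercive[OF b'] b(2)[OF z] by fastforce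
    qed (rule b(2))
  qed
qed

lemma norm2_power2: "(norm2 n x)\<^sup>2 = ip n x x"
  by (simp add: ip_eq_L2_set)

lemma lasso_objective_ip:
  "lasso_objective n p X y \<tau> b =
    ip n (\<lambda>i. y i - mat_vec p X b i) (\<lambda>i. y i - mat_vec p X b i) / 2 + \<tau> * norm1 p b"
  by (simp add: lasso_objective_def norm2_power2)

lemma lasso_exists:
  assumes "0 < \<tau>"
  shows "\<exists>b. is_lasso n p X y \<tau> b"
proof -
  let ?F = "lasso_objective n p X y \<tau>"
  have "\<exists>b\<in>rvec p. \<forall>b'\<in>rvec p. ?F b \<le> ?F b'"
  proof (rule attains_min_on_rvec)
    show "continuous_on UNIV ?F"
      unfolding lasso_objective_ip ip_def mat_vec_def norm1_def
      by (intro continuous_intros continuous_on_product_coordinates) simp_all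
  next
    fix b j assume b: "b \<in> rvec p" "j < p" and j: "?F (\<lambda>j\<in>{..<p}. 0) / \<tau> < \<bar>b j\<bar>"
    have "?F (\<lambda>j\<in>{..<p}. 0) \<le> \<tau> * \<bar>b j\<bar>" using j \<open>0 < \<tau>\<close> by (simp add: field_simps)
    also have "\<dots> \<le> \<tau> * norm1 p b"
      using b \<open>0 < \<tau>\<close> unfolding norm1_def by (intro mult_left_mono member_le_sum) auto
    also have "\<dots> \<le> ?F b" by (simp add: lasso_objective_ip ip_self_nonneg)
    finally show "?F (\<lambda>j\<in>{..<p}. 0) \<le> ?F b" .
  qed
  then show ?thesis unfolding is_lasso_def is_arg_min_def by (meson not_le)
qed

lemma mat_vec_diff: "mat_vec p X (\<lambda>j. b j - b' j) i = mat_vec p X b i - mat_vec p X b' i"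
  by (simp add: mat_vec_def algebra_simps sum_subtractf)

text \<open>
  Compare the minimizer with the points of the segment towards \<open>b\<close>: the penalty is convex along it, and
  the quadratic term is of second order. Compared with the plain inequality between the two values of
  the objective, this saves a factor \<open>2\<close> in the error bound.
\<close>

lemma lasso_variational_inequality:
  assumes lasso: "is_lasso n p X y \<tau> b'" and b: "b \<in> rvec p" and "0 \<le> \<tau>"
  shows "ip n (\<lambda>i. y i - mat_vec p X b' i) (\<lambda>i. mat_vec p X b i - mat_vec p X b' i)
    \<le> \<tau> * (norm1 p b - norm1 p b')"
proof -
  define r where "r = (\<lambda>i. y i - mat_vec p X b' i)"
  define d where "d = (\<lambda>i. mat_vec p X b i - mat_vec p X b' i)"
  define C where "C = \<tau> * (norm1 p b - norm1 p b')"
  have key: "ip n r d \<le> C + t * ip n d d" if t: "0 < t" "t \<le> 1" for t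
  proof -
    define bt where "bt = (\<lambda>j\<in>{..<p}. b' j + t * (b j - b' j))"
    have "bt \<in> rvec p" by (simp add: bt_def)
    then have "lasso_objective n p X y \<tau> b' \<le> lasso_objective n p X y \<tau> bt"
      using lasso by (auto simp: is_lasso_def is_arg_min_def not_less)
    moreover have "(\<lambda>i. y i - mat_vec p X bt i) = (\<lambda>i. r i - t * d i)"
    proof
      fix i
      have "mat_vec p X bt i = (\<Sum>j<p. X i j * b' j + t * (X i j * b j - X i j * b' j))"
        unfolding mat_vec_def by (intro sum.cong refl) (simp add: bt_def algebra_simps)
      also have "\<dots> = mat_vec p X b' i + t * d i"
        by (simp add: mat_vec_def d_def sum.distrib sum_subtractf flip: sum_distrib_left)
      finally show "y i - mat_vec p X bt i = r i - t * d i" by (simp add: r_def)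
    qed
    moreover have "norm1 p bt \<le> norm1 p b' + t * (norm1 p b - norm1 p b')"
    proof -
      have "norm1 p bt \<le> (\<Sum>j<p. \<bar>b' j\<bar> + t * (\<bar>b j\<bar> - \<bar>b' j\<bar>))"
        unfolding norm1_def
      proof (intro sum_mono)
        fix j assume "j \<in> {..<p}"
        then have "\<bar>bt j\<bar> = \<bar>(1 - t) * b' j + t * b j\<bar>" by (simp add: bt_def algebra_simps)
        also have "\<dots> \<le> \<bar>(1 - t) * b' j\<bar> + \<bar>t * b j\<bar>" by (rule abs_triangle_ineq)
        also have "\<dots> = \<bar>b' j\<bar> + t * (\<bar>b j\<bar> - \<bar>b' j\<bar>)" using t by (simp add: abs_mult) (simp add: algebra_simps)
        finally show "\<bar>bt j\<bar> \<le> \<bar>b' j\<bar> + t * (\<bar>b j\<bar> - \<bar>b' j\<bar>)" .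
      qed
      then show ?thesis by (simp add: norm1_def sum.distrib sum_subtractf flip: sum_distrib_left)
    qed
    then have "\<tau> * norm1 p bt \<le> \<tau> * norm1 p b' + t * C"
      using mult_left_mono[OF _ \<open>0 \<le> \<tau>\<close>] by (fastforce simp: C_def algebra_simps)
    ultimately have "ip n r r / 2 \<le> ip n (\<lambda>i. r i - t * d i) (\<lambda>i. r i - t * d i) / 2 + t * C"
      by (simp add: lasso_objective_ip r_def)
    also have "ip n (\<lambda>i. r i - t * d i) (\<lambda>i. r i - t * d i) = ip n r r - 2 * (t * ip n r d) + t * (t * ip n d d)"
      by (simp add: ip_diff_left ip_diff_right ip_scale_left ip_scale_right ip_commute[of n d r])
    finally have "2 * (t * ip n r d) \<le> 2 * (t * C) + t * (t * ip n d d)" by argo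
    then have "t * (2 * ip n r d) \<le> t * (2 * C + t * ip n d d)" by (simp add: algebra_simps)
    then have "2 * ip n r d \<le> 2 * C + t * ip n d d" using t by simp
    moreover have "0 \<le> t * ip n d d" using t by (simp add: ip_self_nonneg)
    ultimately show ?thesis by linarith
  qed
  have "ip n r d \<le> C"
  proof (rule field_le_epsilon)
    fix e :: real assume e: "0 < e"
    define D where "D = ip n d d"
    have D: "0 \<le> D" by (simp add: D_def ip_self_nonneg)
    define t where "t = min 1 (e / (D + 1))"
    have "t * D \<le> e / (D + 1) * (D + 1)" using D e by (intro mult_mono) (auto simp: t_def)
    also have "\<dots> = e" using D by simp
    finally have "t * D \<le> e" .
    moreover have "0 < t" "t \<le> 1" using e D by (auto simp: t_def)
    ultimately show "ip n r d \<le> C + e" using key[of t] by (simp add: D_def)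
  qed
  then show ?thesis by (simp add: r_def d_def C_def)
qed

lemma is_lasso_rvec: "is_lasso n p X y \<tau> b \<Longrightarrow> b \<in> rvec p"
  by (simp add: is_lasso_def is_arg_min_def)

text \<open>
  The fit is the proximal map of a convex function. Adding the variational inequalities of the two
  problems makes the penalties cancel.
\<close>

lemma lasso_fit_nonexpansive:
  assumes 1: "is_lasso n p X y1 \<tau> b1" and 2: "is_lasso n p X y2 \<tau> b2" and "0 \<le> \<tau>"
  shows "ip n (\<lambda>i. mat_vec p X b1 i - mat_vec p X b2 i) (\<lambda>i. mat_vec p X b1 i - mat_vec p X b2 i)
    \<le> ip n (\<lambda>i. y1 i - y2 i) (\<lambda>i. y1 i - y2 i)"
proof -
  let ?f1 = "mat_vec p X b1" and ?f2 = "mat_vec p X b2"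
  let ?d = "\<lambda>i. ?f1 i - ?f2 i" and ?e = "\<lambda>i. y1 i - y2 i"
  have "ip n (\<lambda>i. y1 i - ?f1 i) (\<lambda>i. ?f2 i - ?f1 i) + ip n (\<lambda>i. y2 i - ?f2 i) ?d \<le> 0"
    using lasso_variational_inequality[OF 1 is_lasso_rvec[OF 2] \<open>0 \<le> \<tau>\<close>]
      lasso_variational_inequality[OF 2 is_lasso_rvec[OF 1] \<open>0 \<le> \<tau>\<close>] by (simp add: algebra_simps)
  moreover have "ip n (\<lambda>i. y1 i - ?f1 i) (\<lambda>i. ?f2 i - ?f1 i) + ip n (\<lambda>i. y2 i - ?f2 i) ?d = ip n ?d ?d - ip n ?e ?d"
    by (simp add: ip_def flip: sum.distrib sum_subtractf) (intro sum.cong refl, simp add: algebra_simps)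
  ultimately have le: "ip n ?d ?d \<le> ip n ?e ?d" by simp
  then have "(ip n ?d ?d)\<^sup>2 \<le> (ip n ?e ?d)\<^sup>2" by (intro power_mono ip_self_nonneg)
  also have "\<dots> \<le> ip n ?e ?e * ip n ?d ?d" by (rule ip_Cauchy_Schwarz)
  finally have *: "ip n ?d ?d * ip n ?d ?d \<le> ip n ?e ?e * ip n ?d ?d" by (simp add: power2_eq_square)
  show ?thesis
  proof (cases "ip n ?d ?d = 0")
    case False
    then show ?thesis using * ip_self_nonneg[of n ?d] by simp
  qed (simp add: ip_self_nonneg)
qed

text \<open>
  Let \<open>e = X h\<close> with \<open>h = \<beta>' - \<beta>\<close>. The variational inequality bounds \<open>\<parallel>e\<parallel>\<^sup>2\<close> by a sum over the coordinates
  of \<open>h\<close>. The vector \<open>g\<close> is chosen such that each coordinate is at most \<open>h j * \<langle>X\<^sub>j, g\<rangle>\<close>: on the support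
  the sign of \<open>\<beta>\<close> is a subgradient of the penalty, and off the support the penalty of \<open>h j\<close> dominates.
  The sum is then \<open>\<langle>g, e\<rangle>\<close>, whence \<open>\<parallel>e\<parallel> \<le> \<parallel>g\<parallel>\<close>.
\<close>

lemma lasso_error_le_dual_certificate:
  fixes n p X \<beta> z
  defines "v \<equiv> \<lambda>j i. X i j" and "I \<equiv> supp p \<beta>"
  assumes lasso: "is_lasso n p X (\<lambda>i. mat_vec p X \<beta> i + z i) \<tau> \<beta>'" and \<beta>: "\<beta> \<in> rvec p" and "0 \<le> \<tau>"
    and on: "\<And>i. i \<in> I \<Longrightarrow> ip n (v i) g = ip n (v i) z - \<tau> * sgn (\<beta> i)"
    and off: "\<And>j. j < p \<Longrightarrow> j \<notin> I \<Longrightarrow> \<bar>ip n (v j) z\<bar> + \<bar>ip n (v j) g\<bar> \<le> \<tau>"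
  shows "ip n (\<lambda>i. mat_vec p X \<beta> i - mat_vec p X \<beta>' i) (\<lambda>i. mat_vec p X \<beta> i - mat_vec p X \<beta>' i) \<le> ip n g g"
proof -
  define h where "h = (\<lambda>j. \<beta>' j - \<beta> j)"
  define e where "e = (\<lambda>i. mat_vec p X \<beta>' i - mat_vec p X \<beta> i)"
  have e: "e = (\<lambda>i. \<Sum>j\<in>{..<p}. h j * v j i)"
    unfolding e_def h_def mat_vec_diff[symmetric] by (simp add: mat_vec_def v_def mult.commute)
  have ip_e: "ip n x e = (\<Sum>j<p. h j * ip n (v j) x)" for x
    unfolding e ip_sum_right by (simp add: ip_commute)
  have "ip n (\<lambda>i. z i - e i) (\<lambda>i. - 1 * e i) \<le> \<tau> * (norm1 p \<beta> - norm1 p \<beta>')"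
    using lasso_variational_inequality[OF lasso \<beta> \<open>0 \<le> \<tau>\<close>] by (simp add: e_def algebra_simps)
  moreover have "ip n (\<lambda>i. z i - e i) (\<lambda>i. - 1 * e i) = ip n e e - ip n z e"
    by (simp only: ip_scale_right ip_diff_left) simp
  ultimately have "ip n e e \<le> ip n z e + \<tau> * (norm1 p \<beta> - norm1 p \<beta>')" by linarith
  also have "\<dots> = (\<Sum>j<p. h j * ip n (v j) z + \<tau> * (\<bar>\<beta> j\<bar> - \<bar>\<beta>' j\<bar>))"
    by (simp add: ip_e norm1_def sum.distrib sum_subtractf flip: sum_distrib_left)
  also have "\<dots> \<le> (\<Sum>j<p. h j * ip n (v j) g)"
  proof (rule sum_mono)
    fix j assume "j \<in> {..<p}"
    then have j: "j < p" by simp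
    show "h j * ip n (v j) z + \<tau> * (\<bar>\<beta> j\<bar> - \<bar>\<beta>' j\<bar>) \<le> h j * ip n (v j) g"
    proof (cases "j \<in> I")
      case True
      have "\<bar>\<beta> j\<bar> + sgn (\<beta> j) * h j \<le> \<bar>\<beta>' j\<bar>" by (auto simp: h_def sgn_if abs_if)
      then have "\<tau> * (\<bar>\<beta> j\<bar> + sgn (\<beta> j) * h j) \<le> \<tau> * \<bar>\<beta>' j\<bar>" using \<open>0 \<le> \<tau>\<close> by (rule mult_left_mono)
      then show ?thesis by (simp add: on[OF True] algebra_simps)
    next
      case False
      then have 0: "\<beta> j = 0" using j by (simp add: I_def supp_def)
      have "h j * (ip n (v j) z - ip n (v j) g) \<le> \<bar>h j\<bar> * (\<bar>ip n (v j) z\<bar> + \<bar>ip n (v j) g\<bar>)"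
        by (rule order_trans[OF abs_ge_self]) (simp add: abs_mult mult_left_mono)
      also have "\<dots> \<le> \<bar>h j\<bar> * \<tau>" using off[OF j False] by (rule mult_left_mono) simp
      finally show ?thesis by (simp add: 0 h_def algebra_simps)
    qed
  qed
  also have "\<dots> = ip n g e" by (simp add: ip_e)
  finally have le: "ip n e e \<le> ip n g e" .
  then have "(ip n e e)\<^sup>2 \<le> (ip n g e)\<^sup>2" by (intro power_mono ip_self_nonneg)
  also have "\<dots> \<le> ip n g g * ip n e e" by (rule ip_Cauchy_Schwarz)
  finally have *: "ip n e e * ip n e e \<le> ip n g g * ip n e e" by (simp add: power2_eq_square)
  have "ip n e e \<le> ip n g g"
  proof (cases "ip n e e = 0")
    case False
    then show ?thesis using * ip_self_nonneg[of n e] by simp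
  qed (simp add: ip_self_nonneg)
  moreover have "ip n (\<lambda>i. mat_vec p X \<beta> i - mat_vec p X \<beta>' i) (\<lambda>i. mat_vec p X \<beta> i - mat_vec p X \<beta>' i) = ip n e e"
    by (simp add: ip_def e_def algebra_simps)
  ultimately show ?thesis by simp
qed

text \<open>
  The solution is the minimizer of the quadratic function with gradient \<open>X\<^sub>I\<^sup>T X\<^sub>I w - a\<close>, which is
  coercive by the eigenvalue bound.
\<close>

lemma normal_equations_solvable:
  fixes v :: "nat \<Rightarrow> nat \<Rightarrow> real"
  assumes I: "I \<subseteq> {..<p}"
    and wc: "\<And>x. (\<Sum>i\<in>I. (x i)\<^sup>2) / 2 \<le> ip n (\<lambda>k. \<Sum>i\<in>I. x i * v i k) (\<lambda>k. \<Sum>i\<in>I. x i * v i k)"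
  shows "\<exists>w. \<forall>i\<in>I. ip n (v i) (\<lambda>k. \<Sum>l\<in>I. w l * v l k) = a i"
proof -
  have fI: "finite I" using I by (rule finite_subset) simp
  define s where "s = (\<lambda>w k. \<Sum>l\<in>I. w l * v l k)"
  (* The last summand makes f coercive in the coordinates outside of I as well; it has
     no influence on the equations for the coordinates in I. *)
  define f where "f = (\<lambda>w. ip n (s w) (s w) / 2 - (\<Sum>l\<in>I. a l * w l) + (\<Sum>l\<in>{..<p} - I. (w l)\<^sup>2) / 4)"
  have quad: "f b \<ge> 0" if "j < p" "4 * (\<Sum>l\<in>I. \<bar>a l\<bar>) < \<bar>b j\<bar>" for b j
  proof -
    define m where "m = Max ((\<lambda>l. \<bar>b l\<bar>) ` {..<p})"
    have fin: "finite ((\<lambda>l. \<bar>b l\<bar>) ` {..<p})" and ne: "(\<lambda>l. \<bar>b l\<bar>) ` {..<p} \<noteq> {}" using that by auto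
    obtain q where q: "q < p" "\<bar>b q\<bar> = m" using Max_in[OF fin ne] unfolding m_def[symmetric] by auto
    have m: "\<bar>b l\<bar> \<le> m" if "l < p" for l using fin that unfolding m_def by (intro Max_ge) auto
    have "(\<Sum>l\<in>I. a l * b l) \<le> (\<Sum>l\<in>I. \<bar>a l\<bar> * m)"
    proof (rule sum_mono)
      fix l assume "l \<in> I"
      then have "\<bar>a l\<bar> * \<bar>b l\<bar> \<le> \<bar>a l\<bar> * m" using I by (intro mult_left_mono m) auto
      then show "a l * b l \<le> \<bar>a l\<bar> * m" by (metis abs_ge_self abs_mult order_trans)
    qed
    also have "\<dots> = (\<Sum>l\<in>I. \<bar>a l\<bar>) * m" by (simp add: sum_distrib_right)
    also have "\<dots> \<le> m / 4 * m" using m[of j] that q by (intro mult_right_mono) auto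
    also have "\<dots> = (b q)\<^sup>2 / 4" unfolding q(2)[symmetric] by (simp add: power2_eq_square)
    also have "\<dots> \<le> ((\<Sum>l\<in>I. (b l)\<^sup>2) + (\<Sum>l\<in>{..<p} - I. (b l)\<^sup>2)) / 4"
    proof -
      have "(b q)\<^sup>2 \<le> (\<Sum>l<p. (b l)\<^sup>2)" using q by (intro member_le_sum) auto
      also have "\<dots> = (\<Sum>l\<in>I. (b l)\<^sup>2) + (\<Sum>l\<in>{..<p} - I. (b l)\<^sup>2)"
        using I by (subst add.commute) (intro sum.subset_diff, auto)
      finally show ?thesis by simp
    qed
    finally show ?thesis using wc[of b] by (simp add: f_def s_def)
  qed
  have "f (\<lambda>j\<in>{..<p}. 0) = 0"
  proof -
    have "s (\<lambda>j\<in>{..<p}. 0) = (\<lambda>k. 0)" unfolding s_def using I by (intro ext sum.neutral) auto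
    then show ?thesis using I by (auto simp: f_def ip_def restrict_def intro!: sum.neutral)
  qed
  then have "f (\<lambda>j\<in>{..<p}. 0) \<le> f b" if "j < p" "4 * (\<Sum>l\<in>I. \<bar>a l\<bar>) < \<bar>b j\<bar>" for b j
    using quad[of j b] that by simp
  then have "\<exists>w\<in>rvec p. \<forall>b'\<in>rvec p. f w \<le> f b'"
  proof (rule attains_min_on_rvec[rotated])
    show "continuous_on UNIV f"
      unfolding f_def ip_def s_def by (intro continuous_intros continuous_on_product_coordinates) simp_all
  qed
  then obtain w where w: "w \<in> rvec p" "\<And>b'. b' \<in> rvec p \<Longrightarrow> f w \<le> f b'" by blast
  show ?thesis
  proof (intro exI[of _ w] ballI)
    fix i assume i: "i \<in> I"
    define g where "g = ip n (v i) (s w) - a i"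
    have "g\<^sup>2 \<le> 0 * (2 * ip n (v i) (v i))"
    proof (rule nonneg_quadratic_discriminant)
      fix t :: real
      define b where "b = w(i := w i + 2 * t)"
      have "b \<in> rvec p" using w(1) i I by (auto simp: b_def PiE_iff extensional_def)
      then have "f w \<le> f b" by (rule w(2))
      moreover have sb: "s b = (\<lambda>k. s w k + 2 * t * v i k)"
      proof
        fix k
        have "s b k = (\<Sum>l\<in>I. w l * v l k + (if l = i then 2 * t * v i k else 0))"
          unfolding s_def by (intro sum.cong) (auto simp: b_def algebra_simps)
        then show "s b k = s w k + 2 * t * v i k" using fI i by (simp add: s_def sum.distrib sum.delta)
      qed
      moreover have "(\<Sum>l\<in>I. a l * b l) = (\<Sum>l\<in>I. a l * w l) + 2 * t * a i"
      proof -
        have "(\<Sum>l\<in>I. a l * b l) = (\<Sum>l\<in>I. a l * w l + (if l = i then 2 * t * a i else 0))"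
          by (intro sum.cong) (auto simp: b_def algebra_simps)
        then show ?thesis using fI i by (simp add: sum.distrib sum.delta)
      qed
      moreover have "(\<Sum>l\<in>{..<p} - I. (b l)\<^sup>2) = (\<Sum>l\<in>{..<p} - I. (w l)\<^sup>2)"
        using i by (intro sum.cong) (auto simp: b_def)
      ultimately show "0 \<le> 0 + 2 * t * g + t\<^sup>2 * (2 * ip n (v i) (v i))"
        unfolding f_def sb ip_add_left ip_add_right ip_scale_left ip_scale_right
        by (simp add: g_def ip_commute[of n "s w" "v i"] power2_eq_square algebra_simps)
    qed (simp add: ip_self_nonneg)
    then show "ip n (v i) (\<lambda>k. \<Sum>l\<in>I. w l * v l k) = a i" by (simp add: g_def s_def)
  qed
qed

section \<open>Least squares on the support\<close>

lemma least_squares_bounds: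
  assumes wc: "(\<Sum>i\<in>I. (w i)\<^sup>2) / 2 \<le> ip n (\<lambda>k. \<Sum>l\<in>I. w l * v l k) (\<lambda>k. \<Sum>l\<in>I. w l * v l k)"
    and sol: "\<And>i. i \<in> I \<Longrightarrow> ip n (v i) (\<lambda>k. \<Sum>l\<in>I. w l * v l k) = a i"
  shows least_squares_fit_le: "ip n (\<lambda>k. \<Sum>l\<in>I. w l * v l k) (\<lambda>k. \<Sum>l\<in>I. w l * v l k) \<le> 2 * (\<Sum>i\<in>I. (a i)\<^sup>2)"
    and least_squares_coeff_le: "(\<Sum>i\<in>I. (w i)\<^sup>2) \<le> 4 * (\<Sum>i\<in>I. (a i)\<^sup>2)"
proof -
  define g where "g = (\<lambda>k. \<Sum>l\<in>I. w l * v l k)"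
  have "ip n g g = (\<Sum>i\<in>I. w i * a i)"
    by (subst (1) g_def, subst ip_sum_left) (simp add: g_def sol)
  then have "(ip n g g)\<^sup>2 \<le> (\<Sum>i\<in>I. (w i)\<^sup>2) * (\<Sum>i\<in>I. (a i)\<^sup>2)"
    by (simp add: Cauchy_Schwarz_ineq_sum)
  also have "\<dots> \<le> (2 * ip n g g) * (\<Sum>i\<in>I. (a i)\<^sup>2)"
    using wc by (intro mult_right_mono sum_nonneg) (simp_all add: g_def)
  finally have *: "ip n g g * ip n g g \<le> (2 * (\<Sum>i\<in>I. (a i)\<^sup>2)) * ip n g g"
    by (simp add: power2_eq_square mult_ac)
  have le: "ip n g g \<le> 2 * (\<Sum>i\<in>I. (a i)\<^sup>2)"
  proof (cases "ip n g g = 0")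
    case False
    then show ?thesis using * ip_self_nonneg[of n g] by simp
  qed (simp add: sum_nonneg)
  then show "ip n (\<lambda>k. \<Sum>l\<in>I. w l * v l k) (\<lambda>k. \<Sum>l\<in>I. w l * v l k) \<le> 2 * (\<Sum>i\<in>I. (a i)\<^sup>2)"
    by (simp add: g_def)
  show "(\<Sum>i\<in>I. (w i)\<^sup>2) \<le> 4 * (\<Sum>i\<in>I. (a i)\<^sup>2)" using le wc by (simp add: g_def)
qed

text \<open>
  Both sides are \<open>\<langle>X\<^sub>I w, X\<^sub>I u\<rangle>\<close>. It exchanges the solution for the random right-hand side \<open>a\<close> with
  coefficients \<open>u\<close> that depend on \<open>I\<close> and \<open>x\<close> only, so that \<open>\<langle>x, X\<^sub>I w\<rangle>\<close> becomes a linear form in \<open>a\<close>.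
\<close>

lemma least_squares_duality:
  assumes w: "\<And>i. i \<in> I \<Longrightarrow> ip n (v i) (\<lambda>k. \<Sum>l\<in>I. w l * v l k) = a i"
    and u: "\<And>i. i \<in> I \<Longrightarrow> ip n (v i) (\<lambda>k. \<Sum>l\<in>I. u l * v l k) = ip n (v i) x"
  shows "ip n x (\<lambda>k. \<Sum>l\<in>I. w l * v l k) = (\<Sum>i\<in>I. u i * a i)"
proof -
  have "ip n x (\<lambda>k. \<Sum>l\<in>I. w l * v l k) = (\<Sum>l\<in>I. w l * ip n (v l) (\<lambda>k. \<Sum>l\<in>I. u l * v l k))"
    unfolding ip_sum_right[of n x] by (simp add: u ip_commute[of n x])
  also have "\<dots> = ip n (\<lambda>k. \<Sum>l\<in>I. w l * v l k) (\<lambda>k. \<Sum>l\<in>I. u l * v l k)"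
    by (simp only: ip_sum_left)
  also have "\<dots> = (\<Sum>i\<in>I. u i * ip n (v i) (\<lambda>k. \<Sum>l\<in>I. w l * v l k))"
    by (subst ip_commute) (simp only: ip_sum_left)
  also have "\<dots> = (\<Sum>i\<in>I. u i * a i)" by (simp add: w)
  finally show ?thesis .
qed

section \<open>Measurability of the lasso error\<close>

text \<open>
  The minimizer need not be unique but its image under \<open>X\<close> is, on the coordinates below \<open>n\<close>. The event
  of the theorem is therefore a statement about \<open>lasso_fit\<close>, and it is measurable since the fit is
  continuous in the data.
\<close>

definition lasso_fit :: "nat \<Rightarrow> nat \<Rightarrow> (nat \<Rightarrow> nat \<Rightarrow> real) \<Rightarrow> real \<Rightarrow> (nat \<Rightarrow> real) \<Rightarrow> nat \<Rightarrow> real" where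
  "lasso_fit n p X \<tau> y = mat_vec p X (SOME b. is_lasso n p X y \<tau> b)"

lemma lasso_fit_lipschitz:
  assumes "0 < \<tau>" "i < n" and b: "is_lasso n p X y' \<tau> b"
  shows "\<bar>mat_vec p X b i - lasso_fit n p X \<tau> y i\<bar> \<le> sqrt (ip n (\<lambda>k. y' k - y k) (\<lambda>k. y' k - y k))"
proof -
  let ?b' = "SOME b. is_lasso n p X y \<tau> b"
  let ?e = "\<lambda>k. mat_vec p X b k - mat_vec p X ?b' k"
  have b': "is_lasso n p X y \<tau> ?b'" using lasso_exists[OF \<open>0 < \<tau>\<close>] by (rule someI_ex)
  have "(?e i)\<^sup>2 \<le> ip n ?e ?e"
    unfolding ip_def power2_eq_square using \<open>i < n\<close> by (intro member_le_sum) auto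
  also have "\<dots> \<le> ip n (\<lambda>k. y' k - y k) (\<lambda>k. y' k - y k)"
    using \<open>0 < \<tau>\<close> by (intro lasso_fit_nonexpansive[OF b b']) simp
  finally have "sqrt ((?e i)\<^sup>2) \<le> sqrt (ip n (\<lambda>k. y' k - y k) (\<lambda>k. y' k - y k))" by (rule real_sqrt_le_mono)
  then show ?thesis by (simp add: lasso_fit_def)
qed

lemma lasso_fit_unique:
  assumes "0 < \<tau>" "i < n" and b: "is_lasso n p X y' \<tau> b" and eq: "\<And>k. k < n \<Longrightarrow> y' k = y k"
  shows "mat_vec p X b i = lasso_fit n p X \<tau> y i"
  using lasso_fit_lipschitz[OF assms(1-3), of y] eq by (simp add: ip_def)

lemma lasso_fit_lasso:
  assumes "0 < \<tau>"
  shows "\<exists>b. is_lasso n p X y \<tau> b \<and> lasso_fit n p X \<tau> y = mat_vec p X b"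
  unfolding lasso_fit_def using someI_ex[OF lasso_exists[OF assms]] by blast

lemma continuous_on_lasso_fit:
  assumes "0 < \<tau>" "i < n"
  shows "continuous_on UNIV (\<lambda>y. lasso_fit n p X \<tau> y i)"
  unfolding continuous_on_def
proof
  fix y :: "nat \<Rightarrow> real"
  define g where "g = (\<lambda>y'. sqrt (ip n (\<lambda>k. y' k - y k) (\<lambda>k. y' k - y k)))"
  have "continuous_on UNIV g"
    unfolding g_def ip_def by (intro continuous_intros continuous_on_product_coordinates)
  then have "(g \<longlongrightarrow> g y) (at y)" by (simp add: continuous_on_def)
  then have g: "(g \<longlongrightarrow> 0) (at y)" by (simp add: g_def ip_def)
  have "((\<lambda>y'. lasso_fit n p X \<tau> y' i - lasso_fit n p X \<tau> y i) \<longlongrightarrow> 0) (at y)"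
  proof (rule Lim_null_comparison[OF _ g], rule always_eventually, rule allI)
    fix y'
    obtain b where "is_lasso n p X y' \<tau> b" "lasso_fit n p X \<tau> y' = mat_vec p X b"
      using lasso_fit_lasso[OF assms(1)] by blast
    then show "norm (lasso_fit n p X \<tau> y' i - lasso_fit n p X \<tau> y i) \<le> g y'"
      using lasso_fit_lipschitz[OF assms] by (simp add: g_def)
  qed
  then show "((\<lambda>y'. lasso_fit n p X \<tau> y' i) \<longlongrightarrow> lasso_fit n p X \<tau> y i) (at y)"
    by (rule LIM_zero_cancel)
qed

lemma measurable_lasso_event:
  assumes "0 < \<tau>"
    and D: "sets D = sets (\<Pi>\<^sub>M j\<in>{..<p}. (borel :: real measure))"
    and N: "sets N = sets (\<Pi>\<^sub>M i\<in>{..<n}. (borel :: real measure))"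
  shows "{\<omega> \<in> space (D \<Otimes>\<^sub>M N). case \<omega> of (\<beta>, z) \<Rightarrow> \<forall>\<beta>'. is_lasso n p X (\<lambda>i. mat_vec p X \<beta> i + z i) \<tau> \<beta>' \<longrightarrow>
      (norm2 n (\<lambda>i. mat_vec p X \<beta> i - mat_vec p X \<beta>' i))\<^sup>2 \<le> C} \<in> sets (D \<Otimes>\<^sub>M N)"
proof -
  have [measurable]: "(\<lambda>b. b j) \<in> borel_measurable D" if "j < p" for j
    using measurable_component_singleton[of j "{..<p}" "\<lambda>_. borel"] that
    by (simp cong: measurable_cong_sets add: D)
  have [measurable]: "(\<lambda>z. z i) \<in> borel_measurable N" if "i < n" for i
    using measurable_component_singleton[of i "{..<n}" "\<lambda>_. borel"] that
    by (simp cong: measurable_cong_sets add: N)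
  have [measurable]: "(\<lambda>\<omega>. mat_vec p X (fst \<omega>) i) \<in> borel_measurable (D \<Otimes>\<^sub>M N)" for i
    unfolding mat_vec_def by (intro borel_measurable_sum borel_measurable_times) measurable
  define Y where "Y = (\<lambda>\<omega> k. if k < n then mat_vec p X (fst \<omega>) k + snd \<omega> k else 0)"
  have [measurable]: "Y \<in> borel_measurable (D \<Otimes>\<^sub>M N)"
  proof (rule measurable_coordinatewise_then_product)
    fix k show "(\<lambda>\<omega>. Y \<omega> k) \<in> borel_measurable (D \<Otimes>\<^sub>M N)"
      by (cases "k < n") (simp_all add: Y_def)
  qed
  have fit [measurable]: "(\<lambda>\<omega>. lasso_fit n p X \<tau> (Y \<omega>) i) \<in> borel_measurable (D \<Otimes>\<^sub>M N)" if "i < n" for i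
    using borel_measurable_continuous_onI[OF continuous_on_lasso_fit[OF \<open>0 < \<tau>\<close> that]] by measurable
  define err where "err = (\<lambda>\<omega>. \<Sum>i<n. (mat_vec p X (fst \<omega>) i - lasso_fit n p X \<tau> (Y \<omega>) i)\<^sup>2)"
  have [measurable]: "err \<in> borel_measurable (D \<Otimes>\<^sub>M N)"
    unfolding err_def by (intro borel_measurable_sum borel_measurable_power borel_measurable_diff fit) auto
  have "(\<forall>\<beta>'. is_lasso n p X (\<lambda>i. mat_vec p X \<beta> i + z i) \<tau> \<beta>' \<longrightarrow>
      (norm2 n (\<lambda>i. mat_vec p X \<beta> i - mat_vec p X \<beta>' i))\<^sup>2 \<le> C) \<longleftrightarrow> err (\<beta>, z) \<le> C" for \<beta> z
  proof -
    have "(norm2 n (\<lambda>i. mat_vec p X \<beta> i - mat_vec p X \<beta>' i))\<^sup>2 = err (\<beta>, z)"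
      if "is_lasso n p X (\<lambda>i. mat_vec p X \<beta> i + z i) \<tau> \<beta>'" for \<beta>'
      unfolding norm2_power2 unfolding ip_def err_def power2_eq_square
      using lasso_fit_unique[OF \<open>0 < \<tau>\<close> _ that, of _ "Y (\<beta>, z)"] by (intro sum.cong) (auto simp: Y_def)
    then show ?thesis using lasso_exists[OF \<open>0 < \<tau>\<close>] by metis
  qed
  then have "{\<omega> \<in> space (D \<Otimes>\<^sub>M N). case \<omega> of (\<beta>, z) \<Rightarrow> \<forall>\<beta>'. is_lasso n p X (\<lambda>i. mat_vec p X \<beta> i + z i) \<tau> \<beta>' \<longrightarrow>
      (norm2 n (\<lambda>i. mat_vec p X \<beta> i - mat_vec p X \<beta>' i))\<^sup>2 \<le> C} = {\<omega> \<in> space (D \<Otimes>\<^sub>M N). err \<omega> \<le> C}"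
    by (auto simp: case_prod_beta)
  also have "\<dots> \<in> sets (D \<Otimes>\<^sub>M N)" by measurable
  finally show ?thesis .
qed

section \<open>Gaussian and Rademacher tails\<close>

text \<open>
  Mills' ratio: on \<open>[t, \<infinity>)\<close> the density is at most \<open>x / t\<close> times itself, which has a primitive.
\<close>

lemma std_normal_tail:
  assumes "0 < t"
  shows "(\<integral>\<^sup>+x. ennreal (std_normal_density x) * indicator {t..} x \<partial>lborel) \<le> ennreal (std_normal_density t / t)"
proof -
  let ?F = "\<lambda>x. - std_normal_density x / t"
  have "(\<integral>\<^sup>+x. ennreal (std_normal_density x) * indicator {t..} x \<partial>lborel)
      \<le> (\<integral>\<^sup>+x. ennreal (x * std_normal_density x / t) * indicator {t..} x \<partial>lborel)"
  proof (intro nn_integral_mono)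
    fix x
    have "std_normal_density x \<le> x * std_normal_density x / t" if "t \<le> x"
      using mult_right_mono[OF that, of "std_normal_density x"] assms by (simp add: field_simps)
    then show "ennreal (std_normal_density x) * indicator {t..} x \<le> ennreal (x * std_normal_density x / t) * indicator {t..} x"
      by (auto simp: indicator_def intro!: ennreal_leI)
  qed
  also have "\<dots> = ennreal (0 - ?F t)"
  proof (rule nn_integral_FTC_atLeast[where F = ?F and T = 0])
    show "(\<lambda>x. x * std_normal_density x / t) \<in> borel_measurable borel" by measurable
    fix x assume "t \<le> x"
    then show "0 \<le> x * std_normal_density x / t" using assms by simp
    show "DERIV ?F x :> x * std_normal_density x / t"
      unfolding std_normal_density_def
      by (rule derivative_eq_intros refl | use assms in simp)+
  next
    show "(?F \<longlongrightarrow> 0) at_top"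
      unfolding std_normal_density_def using assms by real_asymp
  qed
  also have "0 - ?F t = std_normal_density t / t" by simp
  finally show ?thesis .
qed

lemma (in prob_space) std_normal_abs_tail:
  assumes T: "distributed M lborel T std_normal_density" and "0 < t"
  shows "prob {\<omega> \<in> space M. t \<le> \<bar>T \<omega>\<bar>} \<le> 2 * std_normal_density t / t"
proof -
  have one: "prob {\<omega> \<in> space M. t \<le> T \<omega>} \<le> std_normal_density t / t"
    if T: "distributed M lborel T std_normal_density" for T
  proof -
    have "emeasure M (T -` {t..} \<inter> space M) = (\<integral>\<^sup>+x. ennreal (std_normal_density x) * indicator {t..} x \<partial>lborel)"
      by (rule distributed_emeasure[OF T]) simp
    also have "\<dots> \<le> ennreal (std_normal_density t / t)" by (rule std_normal_tail[OF \<open>0 < t\<close>])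
    finally show ?thesis using \<open>0 < t\<close>
      by (simp add: emeasure_eq_measure vimage_def Int_def conj_commute)
  qed
  have [measurable]: "T \<in> borel_measurable M" using distributed_measurable[OF T] by simp
  have "distributed M lborel (\<lambda>x. 0 + (-1) * T x) (normal_density (0 + (-1) * 0) (\<bar>-1\<bar> * 1))"
    by (rule normal_density_affine[OF T]) auto
  then have T': "distributed M lborel (\<lambda>x. - T x) std_normal_density" by simp
  have "prob {\<omega> \<in> space M. t \<le> \<bar>T \<omega>\<bar>} \<le> prob ({\<omega> \<in> space M. t \<le> T \<omega>} \<union> {\<omega> \<in> space M. t \<le> - T \<omega>})"
    by (intro finite_measure_mono) auto
  also have "\<dots> \<le> prob {\<omega> \<in> space M. t \<le> T \<omega>} + prob {\<omega> \<in> space M. t \<le> - T \<omega>}"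
    by (intro measure_Un_le) auto
  also have "\<dots> \<le> std_normal_density t / t + std_normal_density t / t"
    by (intro add_mono one T T')
  finally show ?thesis by simp
qed

lemma prob_space_gaussian_noise: "0 < \<sigma> \<Longrightarrow> prob_space (gaussian_noise n \<sigma>)"
  unfolding gaussian_noise_def by (intro prob_space_PiM prob_space_normal_density)

lemma sets_gaussian_noise: "sets (gaussian_noise n \<sigma>) = sets (\<Pi>\<^sub>M i\<in>{..<n}. (borel :: real measure))"
  unfolding gaussian_noise_def by (intro sets_PiM_cong) auto

lemma measurable_gaussian_noise_component:
  "i < n \<Longrightarrow> (\<lambda>z. z i) \<in> borel_measurable (gaussian_noise n \<sigma>)"
  using measurable_component_singleton[of i "{..<n}" "\<lambda>_. borel"]
  by (simp cong: measurable_cong_sets add: sets_gaussian_noise)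

lemma gaussian_noise_component:
  assumes "0 < \<sigma>" "i < n"
  shows "distributed (gaussian_noise n \<sigma>) lborel (\<lambda>z. z i) (normal_density 0 \<sigma>)"
  unfolding distributed_def
proof (intro conjI)
  have "distr (gaussian_noise n \<sigma>) lborel (\<lambda>z. z i) = distr (gaussian_noise n \<sigma>) (density lborel (normal_density 0 \<sigma>)) (\<lambda>z. z i)"
    by (rule distr_cong) auto
  also have "\<dots> = density lborel (normal_density 0 \<sigma>)"
    unfolding gaussian_noise_def using assms by (intro distr_PiM_component prob_space_normal_density) auto
  finally show "distr (gaussian_noise n \<sigma>) lborel (\<lambda>z. z i) = density lborel (\<lambda>x. ennreal (normal_density 0 \<sigma> x))" .
  show "(\<lambda>z. z i) \<in> gaussian_noise n \<sigma> \<rightarrow>\<^sub>M lborel"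
    using measurable_gaussian_noise_component[OF assms(2)] by simp
qed auto

lemma gaussian_noise_indep:
  assumes "0 < \<sigma>" "K \<subseteq> {..<n}" "K \<noteq> {}"
  shows "prob_space.indep_vars (gaussian_noise n \<sigma>) (\<lambda>_. borel) (\<lambda>i z. z i) K"
proof -
  interpret prob_space "gaussian_noise n \<sigma>" by (rule prob_space_gaussian_noise) fact
  have ne: "{..<n} \<noteq> {}" using assms by auto
  have "indep_vars (\<lambda>_. density lborel (normal_density 0 \<sigma>)) (\<lambda>i z. z i) {..<n}"
  proof (subst indep_vars_iff_distr_eq_PiM'[OF ne])
    let ?P = "\<Pi>\<^sub>M i\<in>{..<n}. density lborel (normal_density 0 \<sigma>)"
    have "distr (gaussian_noise n \<sigma>) ?P (\<lambda>x. \<lambda>i\<in>{..<n}. x i) = distr ?P ?P (\<lambda>x. x)"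
      unfolding gaussian_noise_def by (rule distr_cong) (auto simp: space_PiM)
    also have "\<dots> = ?P" by (rule distr_id)
    also have "\<dots> = (\<Pi>\<^sub>M i\<in>{..<n}. distr (gaussian_noise n \<sigma>) (density lborel (normal_density 0 \<sigma>)) (\<lambda>z. z i))"
      unfolding gaussian_noise_def using assms
      by (intro PiM_cong refl distr_PiM_component[symmetric] prob_space_normal_density) auto
    finally show "distr (gaussian_noise n \<sigma>) ?P (\<lambda>x. \<lambda>i\<in>{..<n}. x i) = \<dots>" .
  qed (simp add: measurable_gaussian_noise_component cong: measurable_cong_sets)
  then have "indep_vars (\<lambda>_. borel) (\<lambda>i z. z i) {..<n}"
    by (rule indep_vars_compose2) simp
  then show ?thesis using assms(2) by (rule indep_vars_subset)
qed

lemma gaussian_noise_ip_tail: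
  assumes "0 < \<sigma>" "0 < t" and a: "ip n a a \<le> s\<^sup>2" "0 < s"
  shows "measure (gaussian_noise n \<sigma>) {z \<in> space (gaussian_noise n \<sigma>). t * s * \<sigma> < \<bar>ip n a z\<bar>} \<le> 2 * std_normal_density t / t"
proof -
  interpret prob_space "gaussian_noise n \<sigma>" by (rule prob_space_gaussian_noise) fact
  (* A normal law of variance zero has no density, hence the restriction to nonzero coefficients. *)
  define K where "K = {k. k < n \<and> a k \<noteq> 0}"
  have K: "finite K" "K \<subseteq> {..<n}" by (auto simp: K_def)
  have ipK: "ip n a z = (\<Sum>k\<in>K. a k * z k)" for z
    unfolding ip_def K_def by (intro sum.mono_neutral_right) auto
  show ?thesis
  proof (cases "K = {}")
    case True
    then have "ip n a z = 0" for z by (simp add: ipK)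
    then have "{z \<in> space (gaussian_noise n \<sigma>). t * s * \<sigma> < \<bar>ip n a z\<bar>} = {}"
      using assms by (auto simp: not_less)
    then show ?thesis using assms by (simp only: measure_empty) simp
  next
    case False
    define r where "r = sqrt (ip n a a)"
    have "0 < ip n a a"
      unfolding ipK using False K by (intro sum_pos) (auto simp: K_def zero_less_mult_iff neq_iff)
    then have r: "0 < r" "r \<le> s" using a by (auto simp: r_def real_le_lsqrt intro: order.strict_implies_order)
    have ind: "indep_vars (\<lambda>_. borel) (\<lambda>k z. a k * z k) K"
      by (rule indep_vars_compose2[OF gaussian_noise_indep[OF assms(1) K(2) False]]) simp
    have "distributed (gaussian_noise n \<sigma>) lborel (\<lambda>z. \<Sum>k\<in>K. a k * z k)
        (normal_density (\<Sum>k\<in>K. 0) (sqrt (\<Sum>k\<in>K. (\<bar>a k\<bar> * \<sigma>)\<^sup>2)))"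
    proof (rule sum_indep_normal[OF K(1) False ind])
      fix k assume k: "k \<in> K"
      then show "0 < \<bar>a k\<bar> * \<sigma>" using \<open>0 < \<sigma>\<close> by (simp add: K_def)
      have "distributed (gaussian_noise n \<sigma>) lborel (\<lambda>z. 0 + a k * z k) (normal_density (0 + a k * 0) (\<bar>a k\<bar> * \<sigma>))"
        using k \<open>0 < \<sigma>\<close> by (intro normal_density_affine gaussian_noise_component) (auto simp: K_def)
      then show "distributed (gaussian_noise n \<sigma>) lborel (\<lambda>z. a k * z k) (normal_density 0 (\<bar>a k\<bar> * \<sigma>))" by simp
    qed
    moreover have "sqrt (\<Sum>k\<in>K. (\<bar>a k\<bar> * \<sigma>)\<^sup>2) = r * \<sigma>"
      using \<open>0 < \<sigma>\<close> unfolding r_def ipK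
      by (simp add: power_mult_distrib real_sqrt_mult flip: sum_distrib_right) (simp add: power2_eq_square)
    ultimately have dist: "distributed (gaussian_noise n \<sigma>) lborel (ip n a) (normal_density 0 (r * \<sigma>))"
      by (simp add: ipK[abs_def])
    then have "distributed (gaussian_noise n \<sigma>) lborel (\<lambda>z. (ip n a z - 0) / (r * \<sigma>)) std_normal_density"
      using normal_standard_normal_convert[of "r * \<sigma>" "ip n a" 0] r \<open>0 < \<sigma>\<close> by simp
    then have std: "distributed (gaussian_noise n \<sigma>) lborel (\<lambda>z. ip n a z / (r * \<sigma>)) std_normal_density" by simp
    have [measurable]: "ip n a \<in> borel_measurable (gaussian_noise n \<sigma>)"
      using distributed_measurable[OF dist] by simp
    have "prob {z \<in> space (gaussian_noise n \<sigma>). t * s * \<sigma> < \<bar>ip n a z\<bar>}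
        \<le> prob {z \<in> space (gaussian_noise n \<sigma>). t \<le> \<bar>ip n a z / (r * \<sigma>)\<bar>}"
    proof (intro finite_measure_mono subsetI CollectI conjI)
      fix z assume z: "z \<in> {z \<in> space (gaussian_noise n \<sigma>). t * s * \<sigma> < \<bar>ip n a z\<bar>}"
      have "t * r * \<sigma> \<le> t * s * \<sigma>" using r assms by (intro mult_right_mono mult_left_mono) auto
      then have "t * (r * \<sigma>) \<le> \<bar>ip n a z\<bar>" using z by (simp add: mult.assoc)
      then show "t \<le> \<bar>ip n a z / (r * \<sigma>)\<bar>" using r \<open>0 < \<sigma>\<close> by (simp add: abs_mult field_simps)
    qed auto
    also have "\<dots> \<le> 2 * std_normal_density t / t" by (rule std_normal_abs_tail[OF std \<open>0 < t\<close>])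
    finally show ?thesis .
  qed
qed

lemma (in prob_space) rademacher_tail:
  assumes I: "finite I" and ind: "indep_vars (\<lambda>_. borel) s I"
    and half: "\<And>i. i \<in> I \<Longrightarrow> prob {\<omega> \<in> space M. s i \<omega> = 1} = 1 / 2"
      "\<And>i. i \<in> I \<Longrightarrow> prob {\<omega> \<in> space M. s i \<omega> = - 1} = 1 / 2"
    and V: "(\<Sum>i\<in>I. (a i)\<^sup>2) \<le> V" and "0 < V" "0 < t"
  shows "prob {\<omega> \<in> space M. t < \<bar>\<Sum>i\<in>I. a i * s i \<omega>\<bar>} \<le> 2 * exp (- t\<^sup>2 / (2 * V))"
proof (cases "(\<Sum>i\<in>I. (a i)\<^sup>2) = 0")
  case True
  then have "a i = 0" if "i \<in> I" for i using that I by (simp add: sum_nonneg_eq_0_iff)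
  then have "{\<omega> \<in> space M. t < \<bar>\<Sum>i\<in>I. a i * s i \<omega>\<bar>} = {}" using \<open>0 < t\<close> by auto
  then show ?thesis by (simp only: measure_empty) simp
next
  case False
  then have pos: "0 < (\<Sum>i\<in>I. (a i)\<^sup>2)" by (simp add: sum_nonneg less_le)
  have meas [measurable]: "s i \<in> borel_measurable M" if "i \<in> I" for i
    using ind that by (auto simp: indep_vars_def)
  have pm: "AE \<omega> in M. s i \<omega> = 1 \<or> s i \<omega> = - 1" if i: "i \<in> I" for i
  proof -
    have "prob ({\<omega> \<in> space M. s i \<omega> = 1} \<union> {\<omega> \<in> space M. s i \<omega> = - 1}) = 1 / 2 + 1 / 2"
      unfolding half(1)[OF i, symmetric] using meas[OF i]
      by (subst finite_measure_Union) (auto simp: half[OF i])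
    then have "AE \<omega> in M. \<omega> \<in> {\<omega> \<in> space M. s i \<omega> = 1} \<union> {\<omega> \<in> space M. s i \<omega> = - 1}"
      using meas[OF i] by (intro AE_prob_1) simp
    then show ?thesis by eventually_elim auto
  qed
  have E: "expectation (s i) = 0" if i: "i \<in> I" for i
  proof -
    have "expectation (s i) = expectation (\<lambda>\<omega>. indicator {\<omega> \<in> space M. s i \<omega> = 1} \<omega> - indicator {\<omega> \<in> space M. s i \<omega> = - 1} \<omega>)"
      using meas[OF i] pm[OF i] by (intro integral_cong_AE) (auto elim!: eventually_mono split: split_indicator)
    also have "\<dots> = prob {\<omega> \<in> space M. s i \<omega> = 1} - prob {\<omega> \<in> space M. s i \<omega> = - 1}"
      using meas[OF i] by (subst Bochner_Integration.integral_diff) (auto simp: less_top[symmetric])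
    finally show ?thesis by (simp add: half[OF i])
  qed
  define \<mu> where "\<mu> = (\<Sum>i\<in>I. expectation (\<lambda>\<omega>. a i * s i \<omega>))"
  have \<mu>0: "\<mu> = 0" by (simp add: \<mu>_def E)
  interpret H: Hoeffding_ineq M I "\<lambda>i \<omega>. a i * s i \<omega>" "\<lambda>i. - \<bar>a i\<bar>" "\<lambda>i. \<bar>a i\<bar>" \<mu>
  proof unfold_locales
    show "indep_vars (\<lambda>_. borel) (\<lambda>i \<omega>. a i * s i \<omega>) I"
      by (rule indep_vars_compose2[OF ind]) simp
    fix i assume "i \<in> I"
    show "AE x in M. a i * s i x \<in> {- \<bar>a i\<bar>..\<bar>a i\<bar>}"
      using pm[OF \<open>i \<in> I\<close>] by eventually_elim auto
  qed (use I in \<open>auto simp: \<mu>_def\<close>)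
  have sq: "(\<Sum>i\<in>I. (\<bar>a i\<bar> - - \<bar>a i\<bar>)\<^sup>2) = 4 * (\<Sum>i\<in>I. (a i)\<^sup>2)"
    by (simp add: sum_distrib_left power2_eq_square)
  have [measurable]: "(\<lambda>\<omega>. \<Sum>i\<in>I. a i * s i \<omega>) \<in> borel_measurable M"
    by (intro borel_measurable_sum borel_measurable_times borel_measurable_const meas)
  have "prob {\<omega> \<in> space M. t < \<bar>\<Sum>i\<in>I. a i * s i \<omega>\<bar>} \<le> prob {\<omega> \<in> space M. \<bar>(\<Sum>i\<in>I. a i * s i \<omega>) - \<mu>\<bar> \<ge> t}"
    by (intro finite_measure_mono) (auto simp: \<mu>0)
  also have "\<dots> \<le> 2 * exp (- 2 * t\<^sup>2 / (\<Sum>i\<in>I. (\<bar>a i\<bar> - - \<bar>a i\<bar>)\<^sup>2))"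
    using H.Hoeffding_ineq_abs_ge[of t] \<open>0 < t\<close> pos unfolding sq by simp
  also have "\<dots> \<le> 2 * exp (- t\<^sup>2 / (2 * V))"
  proof -
    have "t\<^sup>2 / (2 * V) \<le> t\<^sup>2 / (2 * (\<Sum>i\<in>I. (a i)\<^sup>2))"
      using pos V by (intro divide_left_mono) auto
    then show ?thesis unfolding sq using pos by simp
  qed
  finally show ?thesis .
qed

section \<open>Deterministic error bound on a good support\<close>

lemma op_norm_bound:
  "ip n (mat_vec p X b) (mat_vec p X b) \<le> (op_norm n p X)\<^sup>2 * ip p b b"
proof -
  let ?U = "{b \<in> rvec p. norm2 p b \<le> 1}"
  have bdd: "bdd_above ((\<lambda>b. norm2 n (mat_vec p X b)) ` ?U)"
  proof (rule bdd_aboveI2)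
    fix b assume b: "b \<in> ?U"
    have b1: "\<bar>b j\<bar> \<le> 1" if "j < p" for j
    proof -
      have "\<bar>b j\<bar> = norm2 p (\<lambda>k. if k = j then b k else 0)"
        using that by (simp add: L2_set_def if_distrib[of "\<lambda>t. t\<^sup>2"] sum.delta cong: if_cong)
      also have "\<dots> \<le> norm2 p b"
        unfolding L2_set_def by (intro real_sqrt_le_mono sum_mono) auto
      finally show ?thesis using b by simp
    qed
    have "norm2 n (mat_vec p X b) \<le> (\<Sum>i<n. \<bar>mat_vec p X b i\<bar>)" by (rule L2_set_le_sum_abs)
    also have "\<dots> \<le> (\<Sum>i<n. \<Sum>j<p. \<bar>X i j\<bar>)"
    proof (rule sum_mono)
      fix i
      have "\<bar>mat_vec p X b i\<bar> \<le> (\<Sum>j<p. \<bar>X i j\<bar> * \<bar>b j\<bar>)"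
        unfolding mat_vec_def by (rule order_trans[OF sum_abs]) (simp add: abs_mult)
      also have "\<dots> \<le> (\<Sum>j<p. \<bar>X i j\<bar>)" using b1 by (intro sum_mono mult_left_le) auto
      finally show "\<bar>mat_vec p X b i\<bar> \<le> (\<Sum>j<p. \<bar>X i j\<bar>)" .
    qed
    finally show "norm2 n (mat_vec p X b) \<le> (\<Sum>i<n. \<Sum>j<p. \<bar>X i j\<bar>)" .
  qed
  show ?thesis
  proof (cases "ip p b b = 0")
    case True
    then have "b j = 0" if "j < p" for j
      using that by (simp add: ip_def sum_nonneg_eq_0_iff)
    then have "mat_vec p X b i = 0" for i by (simp add: mat_vec_def)
    then show ?thesis using True by (simp add: ip_def)
  next
    case False
    define r where "r = norm2 p b"
    have r2: "ip p b b = r\<^sup>2" by (simp add: r_def norm2_power2)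
    have r: "0 < r" using False r2 by (auto simp: r_def L2_set_nonneg less_le)
    define b' where "b' = (\<lambda>j\<in>{..<p}. b j / r)"
    have "(norm2 p b')\<^sup>2 = ip p (\<lambda>j. (1 / r) * b j) (\<lambda>j. (1 / r) * b j)"
      unfolding norm2_power2 ip_def by (intro sum.cong) (auto simp: b'_def)
    also have "\<dots> = 1" unfolding ip_scale_left ip_scale_right r2 using r by (simp add: power2_eq_square)
    finally have "norm2 p b' = 1" using L2_set_nonneg[of b' "{..<p}"] by (simp add: power2_eq_1_iff)
    then have "b' \<in> ?U" by (simp add: b'_def)
    then have le: "norm2 n (mat_vec p X b') \<le> op_norm n p X"
      unfolding op_norm_def by (rule cSUP_upper[OF _ bdd])
    have "mat_vec p X b = (\<lambda>i. r * mat_vec p X b' i)"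
      unfolding mat_vec_def sum_distrib_left using r by (intro ext sum.cong) (auto simp: b'_def)
    then have "ip n (mat_vec p X b) (mat_vec p X b) = r * (r * (norm2 n (mat_vec p X b'))\<^sup>2)"
      by (simp only: ip_scale_left ip_scale_right norm2_power2)
    also have "\<dots> \<le> r * (r * (op_norm n p X)\<^sup>2)"
      using r le by (intro mult_left_mono power_mono L2_set_nonneg) auto
    finally show ?thesis by (simp add: r2 power2_eq_square mult_ac)
  qed
qed

lemma abs_ip_le_coherence:
  assumes "i < p" "j < p" "i \<noteq> j"
  shows "\<bar>ip n (\<lambda>k. X k i) (\<lambda>k. X k j)\<bar> \<le> coherence n p X"
proof -
  have fin: "finite {(i, j). i < j \<and> j < p}"
    by (rule finite_subset[of _ "{..<p} \<times> {..<p}"]) auto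
  have *: "\<bar>ip n (\<lambda>k. X k i) (\<lambda>k. X k j)\<bar> \<le> coherence n p X" if "i < j" "j < p" for i j
  proof -
    have "(case (i, j) of (i, j) \<Rightarrow> \<bar>\<Sum>k<n. X k i * X k j\<bar>) \<le> coherence n p X"
      unfolding coherence_def using that fin by (intro cSUP_upper bdd_above_finite finite_imageI) auto
    then show ?thesis by (simp add: ip_def)
  qed
  show ?thesis using *[of i j] *[of j i] assms by (auto simp: ip_commute neq_iff)
qed

context coherent_frame
begin

abbreviation synth :: "nat set \<Rightarrow> (nat \<Rightarrow> real) \<Rightarrow> nat \<Rightarrow> real" where
  "synth I w \<equiv> (\<lambda>k. \<Sum>l\<in>I. w l * v l k)"

text \<open>
  The coefficients of the orthogonal projection of \<open>v j\<close> onto the span of the columns in \<open>I\<close>.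
\<close>

definition proj_coeff :: "nat set \<Rightarrow> nat \<Rightarrow> nat \<Rightarrow> real" where
  "proj_coeff I j = (SOME w. \<forall>i\<in>I. ip n (v i) (synth I w) = ip n (v i) (v j))"

context
  fixes I assumes I: "I \<subseteq> {..<p}" and good: "good I"
begin

lemma wc: "(\<Sum>i\<in>I. (x i)\<^sup>2) / 2 \<le> ip n (synth I x) (synth I x)"
  using good by (simp add: good_def well_conditioned_def)

lemma proj_coeff: "i \<in> I \<Longrightarrow> ip n (v i) (synth I (proj_coeff I j)) = ip n (v i) (v j)"
  using someI_ex[OF normal_equations_solvable[OF I wc, of "\<lambda>i. ip n (v i) (v j)"]]
  unfolding proj_coeff_def by blast

lemma correlations_small:
  assumes j: "j < p" "j \<notin> I"
  shows "(\<Sum>i\<in>I. (ip n (v i) (v j))\<^sup>2) \<le> 9 / (10 ^ 6 * ln p)"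
proof -
  have "I = I - {j}" using j by auto
  then show ?thesis using good j by (auto simp: good_def rows_small_def)
qed

lemma proj_coeff_norm:
  assumes "j < p" "j \<notin> I"
  shows "(\<Sum>i\<in>I. (proj_coeff I j i)\<^sup>2) \<le> 36 / (10 ^ 6 * ln p)"
  using least_squares_coeff_le[OF wc proj_coeff, of j] correlations_small[OF assms] by simp

lemma proj_norm:
  assumes "j < p" "j \<notin> I"
  shows "ip n (synth I (proj_coeff I j)) (synth I (proj_coeff I j)) \<le> 18 / (10 ^ 6 * ln p)"
  using least_squares_fit_le[OF wc proj_coeff, of j] correlations_small[OF assms] by simp

text \<open>
  The certificate is \<open>g = X\<^sub>I w\<close> with \<open>X\<^sub>I\<^sup>T g = X\<^sub>I\<^sup>T z - \<tau> sgn \<beta>\<^sub>I\<close>. By duality its correlation with a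
  column \<open>j\<close> off the support is the noise along the projection of \<open>v j\<close> minus \<open>\<tau>\<close> times a signed sum of
  the projection coefficients, and both are small. The eigenvalue bound yields
  \<open>\<parallel>g\<parallel>\<^sup>2 \<le> 2 \<parallel>X\<^sub>I\<^sup>T z - \<tau> sgn \<beta>\<^sub>I\<parallel>\<^sup>2\<close>, and each of the \<open>card I\<close> entries is at most \<open>2 (1 + \<surd>2) \<sigma> \<surd>(ln p)\<close>.
\<close>

lemma lasso_error_bound:
  fixes \<sigma> :: real
  assumes v: "v = (\<lambda>j i. X i j)" and "0 < \<sigma>" and \<beta>: "\<beta> \<in> rvec p" "supp p \<beta> = I"
    and signs: "\<And>j. j < p \<Longrightarrow> j \<notin> I \<Longrightarrow> \<bar>\<Sum>i\<in>I. proj_coeff I j i * sgn (\<beta> i)\<bar> \<le> 1 / 10"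
    and noise: "\<And>j. j < p \<Longrightarrow> \<bar>ip n (v j) z\<bar> \<le> 2 * sqrt (ln p) * \<sigma>"
    and proj_noise: "\<And>j. j < p \<Longrightarrow> j \<notin> I \<Longrightarrow> \<bar>ip n (synth I (proj_coeff I j)) z\<bar> \<le> \<sigma> / 10"
    and lasso: "is_lasso n p X (\<lambda>i. mat_vec p X \<beta> i + z i) (2 * sqrt (2 * ln (real p)) * \<sigma>) \<beta>'"
  shows "ip n (\<lambda>i. mat_vec p X \<beta> i - mat_vec p X \<beta>' i) (\<lambda>i. mat_vec p X \<beta> i - mat_vec p X \<beta>' i)
    \<le> 8 * (1 + sqrt 2)\<^sup>2 * (2 * ln (real p)) * real (card I) * \<sigma>\<^sup>2"
proof -
  define L where "L = sqrt (ln (real p))"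
  have L: "1 \<le> L" "L\<^sup>2 = ln (real p)" using ln_p_ge_1 by (auto simp: L_def)
  define \<tau> where "\<tau> = 2 * sqrt (2 * ln (real p)) * \<sigma>"
  have \<tau>: "\<tau> = 2 * sqrt 2 * L * \<sigma>" by (simp add: \<tau>_def L_def real_sqrt_mult)
  have \<tau>0: "0 \<le> \<tau>" using L \<open>0 < \<sigma>\<close> by (simp add: \<tau>)
  define a where "a = (\<lambda>i. ip n (v i) z - \<tau> * sgn (\<beta> i))"
  obtain w where w: "\<And>i. i \<in> I \<Longrightarrow> ip n (v i) (synth I w) = a i"
    using normal_equations_solvable[OF I wc, of a] by blast
  let ?g = "synth I w"
  have "ip n (\<lambda>i. mat_vec p X \<beta> i - mat_vec p X \<beta>' i) (\<lambda>i. mat_vec p X \<beta> i - mat_vec p X \<beta>' i) \<le> ip n ?g ?g"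
  proof (rule lasso_error_le_dual_certificate[OF lasso[folded \<tau>_def] \<beta>(1) \<tau>0])
    fix i assume "i \<in> supp p \<beta>"
    then show "ip n (\<lambda>k. X k i) ?g = ip n (\<lambda>k. X k i) z - \<tau> * sgn (\<beta> i)"
      using w[of i] \<beta>(2) by (simp add: a_def v)
  next
    fix j assume j: "j < p" "j \<notin> supp p \<beta>"
    then have j: "j < p" "j \<notin> I" using \<beta>(2) by auto
    define P where "P = ip n (synth I (proj_coeff I j)) z"
    define Q where "Q = (\<Sum>i\<in>I. proj_coeff I j i * sgn (\<beta> i))"
    have "ip n (v j) ?g = (\<Sum>i\<in>I. proj_coeff I j i * a i)"
      by (rule least_squares_duality[OF w proj_coeff])
    also have "\<dots> = (\<Sum>i\<in>I. proj_coeff I j i * ip n (v i) z) - \<tau> * Q"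
      unfolding a_def Q_def sum_distrib_left sum_subtractf[symmetric]
      by (intro sum.cong refl) (simp add: algebra_simps)
    also have "(\<Sum>i\<in>I. proj_coeff I j i * ip n (v i) z) = P"
      unfolding P_def by (rule ip_sum_left[symmetric])
    finally have g: "ip n (v j) ?g = P - \<tau> * Q" .
    have "\<bar>P\<bar> \<le> \<sigma> / 10" unfolding P_def by (rule proj_noise[OF j])
    moreover have "\<bar>\<tau> * Q\<bar> \<le> \<tau> * (1 / 10)"
      using mult_left_mono[OF signs[OF j, folded Q_def] \<tau>0] \<tau>0 by (simp add: abs_mult)
    moreover have "\<bar>ip n (v j) z\<bar> \<le> 2 * L * \<sigma>" using noise[OF j(1)] by (simp add: L_def)
    ultimately have "\<bar>ip n (v j) z\<bar> + \<bar>ip n (v j) ?g\<bar> \<le> 2 * L * \<sigma> + (\<sigma> / 10 + \<tau> * (1 / 10))"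
      unfolding g by linarith
    also have "\<dots> \<le> \<tau>"
    proof -
      (* As 7/5 <= sqrt 2, nine tenths of tau are at least 2.52 * L * sigma,
         which leaves room for sigma/10 on top of 2 * L * sigma. *)
      have "7 / 5 \<le> sqrt (2::real)" by (intro real_le_rsqrt) (simp add: power2_eq_square)
      then have "7 / 5 * (L * \<sigma>) \<le> sqrt 2 * (L * \<sigma>)" using L \<open>0 < \<sigma>\<close> by (intro mult_right_mono) auto
      moreover have "\<sigma> \<le> L * \<sigma>" "0 < \<sigma>" using L \<open>0 < \<sigma>\<close> by simp_all
      moreover have "\<tau> = 2 * (sqrt 2 * (L * \<sigma>))" by (simp add: \<tau>)
      ultimately have "2 * (L * \<sigma>) + (\<sigma> / 10 + \<tau> * (1 / 10)) \<le> \<tau>" by linarith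
      then show ?thesis by (simp add: mult.assoc)
    qed
    finally show "\<bar>ip n (\<lambda>k. X k j) z\<bar> + \<bar>ip n (\<lambda>k. X k j) ?g\<bar> \<le> \<tau>" by (simp add: v)
  qed
  also have "\<dots> \<le> 2 * (\<Sum>i\<in>I. (a i)\<^sup>2)" by (rule least_squares_fit_le[OF wc w])
  also have "\<dots> \<le> 2 * (\<Sum>i\<in>I. (2 * (1 + sqrt 2) * (L * \<sigma>))\<^sup>2)"
  proof (intro mult_left_mono sum_mono)
    fix i assume i: "i \<in> I"
    have "\<bar>a i\<bar> \<le> \<bar>ip n (v i) z\<bar> + \<tau> * \<bar>sgn (\<beta> i)\<bar>"
      unfolding a_def using abs_triangle_ineq4[of "ip n (v i) z" "\<tau> * sgn (\<beta> i)"] \<tau>0 by (simp add: abs_mult)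
    also have "\<dots> \<le> 2 * L * \<sigma> + \<tau> * 1"
      using noise[of i] i I \<tau>0 by (intro add_mono mult_left_mono) (auto simp: L_def abs_sgn_eq)
    also have "\<dots> = 2 * (1 + sqrt 2) * (L * \<sigma>)" by (simp add: \<tau> algebra_simps)
    finally have "\<bar>a i\<bar> \<le> \<bar>2 * (1 + sqrt 2) * (L * \<sigma>)\<bar>" by linarith
    then show "(a i)\<^sup>2 \<le> (2 * (1 + sqrt 2) * (L * \<sigma>))\<^sup>2" by (simp only: abs_le_square_iff)
  qed simp
  also have "\<dots> = 8 * (1 + sqrt 2)\<^sup>2 * (1 * ln (real p)) * real (card I) * \<sigma>\<^sup>2"
    unfolding power_mult_distrib L(2) by simp
  also have "\<dots> \<le> 8 * (1 + sqrt 2)\<^sup>2 * (2 * ln (real p)) * real (card I) * \<sigma>\<^sup>2"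
    using ln_p_ge_1 by (intro mult_right_mono mult_left_mono) auto
  finally show ?thesis .
qed

end

end

section \<open>Probability of the good event\<close>

lemma (in prob_space) prob_le_of_conditional_le:
  assumes F: "finite F" and X: "\<And>\<omega>. \<omega> \<in> space M \<Longrightarrow> X \<omega> \<in> F"
    and ev: "\<And>I. I \<in> F \<Longrightarrow> {\<omega> \<in> space M. X \<omega> = I} \<in> events" and E: "E \<in> events"
    and le: "\<And>I. I \<in> F \<Longrightarrow> prob (E \<inter> {\<omega> \<in> space M. X \<omega> = I}) \<le> q * prob {\<omega> \<in> space M. X \<omega> = I}"
  shows "prob E \<le> q"
proof -
  let ?A = "\<lambda>I. {\<omega> \<in> space M. X \<omega> = I}"
  have "E = (\<Union>I\<in>F. E \<inter> ?A I)" using sets.sets_into_space[OF E] X by blast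
  then have "prob E = prob (\<Union>I\<in>F. E \<inter> ?A I)" by simp
  also have "\<dots> \<le> (\<Sum>I\<in>F. prob (E \<inter> ?A I))"
    using F E ev by (intro finite_measure_subadditive_finite) auto
  also have "\<dots> \<le> (\<Sum>I\<in>F. q * prob (?A I))" by (intro sum_mono le)
  also have "\<dots> = q * (\<Sum>I\<in>F. prob (?A I))" by (simp add: sum_distrib_left)
  also have "(\<Sum>I\<in>F. prob (?A I)) = prob (\<Union>I\<in>F. ?A I)"
    using F ev by (intro finite_measure_finite_Union[symmetric]) (auto simp: disjoint_family_on_def)
  also have "(\<Union>I\<in>F. ?A I) = space M" using X by auto
  finally show ?thesis by (simp add: prob_space)
qed

lemma (in pair_prob_space) prob_Times:
  assumes "A \<in> sets M1" "B \<in> sets M2"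
  shows "measure (M1 \<Otimes>\<^sub>M M2) (A \<times> B) = measure M1 A * measure M2 B"
proof -
  have "ennreal (measure (M1 \<Otimes>\<^sub>M M2) (A \<times> B)) = ennreal (measure M1 A) * ennreal (measure M2 B)"
    using M2.emeasure_pair_measure_Times[OF assms]
    by (simp add: emeasure_eq_measure M1.emeasure_eq_measure M2.emeasure_eq_measure)
  then show ?thesis by (simp add: measure_nonneg flip: ennreal_mult)
qed

locale lasso_model = coherent_frame n p v B \<delta> + D: prob_space D
  for n p v B \<delta> and D :: "(nat \<Rightarrow> real) measure" +
  fixes X :: "nat \<Rightarrow> nat \<Rightarrow> real" and \<sigma> :: real and S :: nat
  assumes v: "v = (\<lambda>j i. X i j)" and \<sigma>: "0 < \<sigma>" and \<delta>_eq: "\<delta> = real S / real p"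
    and model: "generic_sparse p S D"
begin

abbreviation "N \<equiv> gaussian_noise n \<sigma>"

sublocale N: prob_space N by (rule prob_space_gaussian_noise) (rule \<sigma>)
sublocale DN: pair_prob_space D N ..

lemma sets_D: "sets D = sets (\<Pi>\<^sub>M i\<in>{..<p}. (borel :: real measure))"
  and S_le: "S \<le> p"
  and distr_supp: "distr D (count_space UNIV) (supp p) = measure_pmf (pmf_of_set {I. I \<subseteq> {..<p} \<and> card I = S})"
  using model by (auto simp: generic_sparse_def)

lemma space_D: "space D = rvec p"
  using sets_eq_imp_space_eq[OF sets_D] by (simp add: space_PiM)

lemma measurable_D_component [measurable]: "j < p \<Longrightarrow> (\<lambda>b. b j) \<in> borel_measurable D"
  using measurable_component_singleton[of j "{..<p}" "\<lambda>_. borel"]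
  by (simp cong: measurable_cong_sets add: sets_D)

lemma measurable_ip_noise [measurable]: "ip n a \<in> borel_measurable N"
  unfolding ip_def by (intro borel_measurable_sum borel_measurable_times measurable_gaussian_noise_component) auto

lemma supp_event [measurable]: "{b \<in> space D. supp p b = I} \<in> sets D"
proof (cases "I \<subseteq> {..<p}")
  case True
  have "{b \<in> space D. supp p b = I} = {b \<in> space D. \<forall>i\<in>{..<p}. b i \<noteq> 0 \<longleftrightarrow> i \<in> I}"
    using True by (auto simp: supp_def)
  also have "\<dots> \<in> sets D"
  proof (rule sets.sets_Collect_finite_All)
    fix i assume "i \<in> {..<p}"
    then have "(\<lambda>b. b i) -` (if i \<in> I then - {0} else {0}) \<inter> space D \<in> sets D"
      by (intro measurable_sets[OF measurable_D_component]) auto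
    also have "(\<lambda>b. b i) -` (if i \<in> I then - {0} else {0}) \<inter> space D = {b \<in> space D. (b i \<noteq> 0) = (i \<in> I)}"
      by auto
    finally show "{b \<in> space D. (b i \<noteq> 0) = (i \<in> I)} \<in> sets D" .
  qed simp
  finally show ?thesis .
next
  case False
  then have "{b \<in> space D. supp p b = I} = {}" by (auto simp: supp_def)
  then show ?thesis by (simp only: sets.empty_sets)
qed

lemma supp_subset: "supp p b \<in> Pow {..<p}"
  by (auto simp: supp_def)

lemma measurable_supp [measurable]: "supp p \<in> D \<rightarrow>\<^sub>M count_space UNIV"
proof (rule measurableI)
  fix A :: "nat set set"
  have "supp p -` A \<inter> space D = (\<Union>I\<in>A \<inter> Pow {..<p}. {b \<in> space D. supp p b = I})"
    using supp_subset by auto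
  also have "\<dots> \<in> sets D" by (intro sets.finite_UN supp_event) auto
  finally show "supp p -` A \<inter> space D \<in> sets D" .
qed simp

lemma prob_supp: "D.prob {b \<in> space D. P (supp p b)} =
    measure_pmf.prob (pmf_of_set {I. I \<subseteq> {..<p} \<and> card I = S}) {I. P I}"
proof -
  have "D.prob {b \<in> space D. P (supp p b)} = measure (distr D (count_space UNIV) (supp p)) {I. P I}"
    by (subst measure_distr) (auto intro!: arg_cong[where f = D.prob])
  then show ?thesis by (simp add: distr_supp)
qed

lemma prob_supp_size: "D.prob {b \<in> space D. supp p b = I} = 0" if "card I \<noteq> S"
proof -
  let ?\<S> = "{I. I \<subseteq> {..<p} \<and> card I = S}"
  have ne: "?\<S> \<noteq> {}" using S_le by (auto intro!: exI[of _ "{..<S}"])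
  have "D.prob {b \<in> space D. supp p b = I} = measure_pmf.prob (pmf_of_set ?\<S>) {J. J = I}"
    by (rule prob_supp)
  also have "\<dots> = 0" using ne that by (simp add: measure_pmf_of_set)
  finally show ?thesis .
qed

lemma prob_supp_not_good: "D.prob {b \<in> space D. \<not> good (supp p b)} \<le> 1 / real p ^ 2"
proof -
  have "D.prob {b \<in> space D. \<not> good (supp p b)} =
      measure_pmf.prob (pmf_of_set {I. I \<subseteq> {..<p} \<and> card I = S}) {I. \<not> good I}"
    by (rule prob_supp)
  also have "\<dots> \<le> (real p + 1) * subset_prob \<delta> {..<p} (\<lambda>I. \<not> good I)"
    unfolding \<delta>_eq using S_le p by (intro uniform_subset_prob_le) auto
  also have "\<dots> \<le> (real p + 1) * (18 / real p ^ 6)" by (intro mult_left_mono prob_not_good) auto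
  also have "\<dots> \<le> 1 / real p ^ 2"
  proof -
    have "27 \<le> real p ^ 3" using power_mono[of 3 "real p" 3] p by simp
    then have "27 * real p \<le> real p ^ 3 * real p" using p by (intro mult_right_mono) auto
    also have "real p ^ 3 * real p = real p ^ 4" by (simp add: eval_nat_numeral)
    finally have "27 * real p \<le> real p ^ 4" .
    moreover have "18 * (real p + 1) \<le> 27 * real p" using p by simp
    ultimately have "18 * (real p + 1) \<le> real p ^ 4" by (rule order_trans[rotated])
    then have "real p ^ 2 * (18 * (real p + 1)) \<le> real p ^ 2 * real p ^ 4" by (rule mult_left_mono) simp
    then show ?thesis using p by (simp add: divide_simps power_add[symmetric] mult_ac)
  qed
  finally show ?thesis .
qed

lemma exp_neg_mult_ln: "exp (- (real k * ln (real p))) = 1 / real p ^ k"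
  using p by (subst exp_minus, subst exp_of_nat_mult) (simp add: divide_inverse)

definition sign_bad :: "nat set \<Rightarrow> (nat \<Rightarrow> real) \<Rightarrow> bool" where
  "sign_bad I b \<longleftrightarrow> (\<exists>j\<in>{..<p} - I. 1 / 10 < \<bar>\<Sum>i\<in>I. proj_coeff I j i * sgn (b i)\<bar>)"

lemma measurable_sign_sum:
  assumes "I \<subseteq> {..<p}"
  shows "{b \<in> space D. 1 / 10 < \<bar>\<Sum>i\<in>I. proj_coeff I j i * sgn (b i)\<bar>} \<in> sets D"
proof -
  have "(\<lambda>b. \<Sum>i\<in>I. proj_coeff I j i * sgn (b i)) \<in> borel_measurable D"
    using assms by (intro borel_measurable_sum borel_measurable_times borel_measurable_const
        measurable_compose[OF measurable_D_component borel_measurable_sgn]) auto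
  then show ?thesis by measurable
qed

lemma measurable_sign_bad: "I \<subseteq> {..<p} \<Longrightarrow> {b \<in> space D. sign_bad I b} \<in> sets D"
  unfolding sign_bad_def by (intro sets.sets_Collect_finite_Ex measurable_sign_sum) auto

text \<open>
  Given the support, the projection coefficients are fixed and the signs are independent. The
  squared norm of the coefficients is of order \<open>1 / ln p\<close>, so Hoeffding's inequality beats any
  fixed power of \<open>p\<close> once the constants are small.
\<close>

lemma prob_sign_bad_given_supp:
  assumes I: "I \<subseteq> {..<p}" "good I"
  shows "D.prob ({b \<in> space D. sign_bad I b} \<inter> {b \<in> space D. supp p b = I}) \<le> 1 / real p ^ 2 * D.prob {b \<in> space D. supp p b = I}"
proof (cases "D.prob {b \<in> space D. supp p b = I} = 0")
  case True
  have "D.prob ({b \<in> space D. sign_bad I b} \<inter> {b \<in> space D. supp p b = I}) \<le> D.prob {b \<in> space D. supp p b = I}"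
    by (intro D.finite_measure_mono) auto
  then show ?thesis by (simp add: True)
next
  case False
  let ?A = "{b \<in> space D. supp p b = I}"
  define DI where "DI = uniform_measure D ?A"
  have pos: "0 < D.prob ?A" using False by (simp add: less_le)
  interpret DI: prob_space DI
    unfolding DI_def using False by (intro prob_space_uniform_measure) (simp_all add: D.emeasure_eq_measure)
  have card: "card I = S" using prob_supp_size[of I] False by auto
  have ind: "DI.indep_vars (\<lambda>_. borel) (\<lambda>i b. sgn (b i)) I"
    and half: "\<And>i. i \<in> I \<Longrightarrow> DI.prob {b \<in> space DI. sgn (b i) = 1} = 1 / 2"
      "\<And>i. i \<in> I \<Longrightarrow> DI.prob {b \<in> space DI. sgn (b i) = - 1} = 1 / 2"
    using model I card by (auto simp: generic_sparse_def DI_def Let_def)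
  have fI: "finite I" using I(1) by (rule finite_sub)
  have space: "space DI = space D" and sets: "sets DI = sets D" by (simp_all add: DI_def)
  have one: "DI.prob {b \<in> space DI. 1 / 10 < \<bar>\<Sum>i\<in>I. proj_coeff I j i * sgn (b i)\<bar>} \<le> 2 * (1 / real p ^ 4)"
    if j: "j \<in> {..<p} - I" for j
  proof -
    have l: "0 < ln (real p)" using ln_p_ge_1 by simp
    have "DI.prob {b \<in> space DI. 1 / 10 < \<bar>\<Sum>i\<in>I. proj_coeff I j i * sgn (b i)\<bar>}
        \<le> 2 * exp (- (1 / 10)\<^sup>2 / (2 * (36 / (10 ^ 6 * ln p))))"
      using j I l by (intro DI.rademacher_tail[OF fI ind half] proj_coeff_norm) auto
    also have "exp (- (1 / 10)\<^sup>2 / (2 * (36 / (10 ^ 6 * ln (real p))))) \<le> exp (- (real 4 * ln (real p)))"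
      using l by (simp add: power2_eq_square)
    finally show ?thesis unfolding exp_neg_mult_ln by simp
  qed
  have "DI.prob {b \<in> space DI. sign_bad I b}
      \<le> DI.prob (\<Union>j\<in>{..<p} - I. {b \<in> space DI. 1 / 10 < \<bar>\<Sum>i\<in>I. proj_coeff I j i * sgn (b i)\<bar>})"
    unfolding sign_bad_def using measurable_sign_sum[OF I(1)]
    by (intro DI.finite_measure_mono sets.finite_UN) (auto simp: sets space)
  also have "\<dots> \<le> (\<Sum>j\<in>{..<p} - I. DI.prob {b \<in> space DI. 1 / 10 < \<bar>\<Sum>i\<in>I. proj_coeff I j i * sgn (b i)\<bar>})"
    using measurable_sign_sum[OF I(1)] by (intro DI.finite_measure_subadditive_finite) (auto simp: sets space)
  also have "\<dots> \<le> (\<Sum>j\<in>{..<p} - I. 2 * (1 / real p ^ 4))" by (intro sum_mono one)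
  also have "\<dots> \<le> (\<Sum>j<p. 2 * (1 / real p ^ 4))" by (intro sum_mono2) auto
  also have "\<dots> = 2 / real p * (1 / real p ^ 2)" using p by (simp add: field_simps eval_nat_numeral)
  also have "\<dots> \<le> 1 * (1 / real p ^ 2)" using p by (intro mult_right_mono) auto
  finally have "DI.prob {b \<in> space DI. sign_bad I b} \<le> 1 / real p ^ 2" by simp
  moreover have "DI.prob {b \<in> space DI. sign_bad I b} = D.prob (?A \<inter> {b \<in> space D. sign_bad I b}) / D.prob ?A"
    unfolding space unfolding DI_def using False measurable_sign_bad[OF I(1)]
    by (intro measure_uniform_measure) (simp_all add: D.emeasure_eq_measure)
  ultimately show ?thesis using pos by (simp add: field_simps Int_commute)
qed

lemma prob_sign_bad: "D.prob {b \<in> space D. good (supp p b) \<and> sign_bad (supp p b) b} \<le> 1 / real p ^ 2"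
proof (rule D.prob_le_of_conditional_le[where F = "Pow {..<p}" and X = "supp p"])
  let ?E = "{b \<in> space D. good (supp p b) \<and> sign_bad (supp p b) b}"
  have "?E = (\<Union>I\<in>{I \<in> Pow {..<p}. good I}. {b \<in> space D. sign_bad I b} \<inter> {b \<in> space D. supp p b = I})"
    using supp_subset by auto
  also have "\<dots> \<in> sets D"
    by (intro sets.finite_UN sets.Int measurable_sign_bad supp_event) auto
  finally show "?E \<in> sets D" .
  fix I assume I: "I \<in> Pow {..<p}"
  show "D.prob (?E \<inter> {b \<in> space D. supp p b = I}) \<le> 1 / real p ^ 2 * D.prob {b \<in> space D. supp p b = I}"
  proof (cases "good I")
    case True
    have "?E \<inter> {b \<in> space D. supp p b = I} = {b \<in> space D. sign_bad I b} \<inter> {b \<in> space D. supp p b = I}"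
      using True by auto
    then show ?thesis using prob_sign_bad_given_supp[OF _ True] I by simp
  next
    case False
    then have "?E \<inter> {b \<in> space D. supp p b = I} = {}" by auto
    then show ?thesis by (simp only: measure_empty) simp
  qed
qed (use supp_subset supp_event in auto)

text \<open>
  Each column has norm one, so the union bound over the columns with Mills' ratio at \<open>2 \<surd>(ln p)\<close> gives
  exactly the second error term of the theorem.
\<close>

lemma prob_noise_large:
  "N.prob {z \<in> space N. \<exists>j\<in>{..<p}. 2 * sqrt (ln p) * \<sigma> < \<bar>ip n (v j) z\<bar>}
    \<le> real p powr (- 1) * (2 * pi * ln (real p)) powr (- 1 / 2)"
proof -
  define l where "l = ln (real p)"
  have l: "1 \<le> l" unfolding l_def by (rule ln_p_ge_1)
  have one: "N.prob {z \<in> space N. 2 * sqrt (ln p) * \<sigma> < \<bar>ip n (v j) z\<bar>} \<le> 1 / real p ^ 2 * (1 / sqrt (2 * pi * l))"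
    if "j < p" for j
  proof -
    have "N.prob {z \<in> space N. 2 * sqrt (ln p) * 1 * \<sigma> < \<bar>ip n (v j) z\<bar>}
        \<le> 2 * std_normal_density (2 * sqrt l) / (2 * sqrt l)"
      using \<sigma> l unit[OF that] unfolding l_def by (intro gaussian_noise_ip_tail) auto
    also have "\<dots> = exp (- (real 2 * ln p)) * (1 / sqrt (2 * pi * l))"
      using l by (simp add: std_normal_density_def power_mult_distrib real_sqrt_mult l_def field_simps)
    finally show ?thesis unfolding exp_neg_mult_ln by simp
  qed
  have "N.prob {z \<in> space N. \<exists>j\<in>{..<p}. 2 * sqrt (ln p) * \<sigma> < \<bar>ip n (v j) z\<bar>}
      \<le> N.prob (\<Union>j<p. {z \<in> space N. 2 * sqrt (ln p) * \<sigma> < \<bar>ip n (v j) z\<bar>})"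
    by (intro N.finite_measure_mono sets.finite_UN) auto
  also have "\<dots> \<le> (\<Sum>j<p. N.prob {z \<in> space N. 2 * sqrt (ln p) * \<sigma> < \<bar>ip n (v j) z\<bar>})"
    by (intro N.finite_measure_subadditive_finite) auto
  also have "\<dots> \<le> (\<Sum>j<p. 1 / real p ^ 2 * (1 / sqrt (2 * pi * l)))" by (intro sum_mono one) simp
  also have "\<dots> = 1 / real p * (1 / sqrt (2 * pi * l))" using p by (simp add: power2_eq_square)
  also have "1 / real p = real p powr (- 1)" using p by (simp add: powr_minus_divide)
  also have "1 / sqrt (2 * pi * l) = (2 * pi * l) powr (- 1 / 2)"
    using l by (simp add: powr_half_sqrt[symmetric] powr_minus_divide)
  finally show ?thesis by (simp add: l_def)
qed

definition proj_noise_bad :: "nat set \<Rightarrow> (nat \<Rightarrow> real) \<Rightarrow> bool" where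
  "proj_noise_bad I z \<longleftrightarrow> (\<exists>j\<in>{..<p} - I. \<sigma> / 10 < \<bar>ip n (synth I (proj_coeff I j)) z\<bar>)"

lemma measurable_proj_noise_bad [measurable]: "{z \<in> space N. proj_noise_bad I z} \<in> sets N"
  unfolding proj_noise_bad_def by (intro sets.sets_Collect_finite_Ex) auto

text \<open>
  The projection of a column off the support has squared norm at most \<open>18 / (10\<^sup>6 ln p)\<close>, which is below
  \<open>s\<^sup>2\<close> for \<open>s = 1 / (40 \<surd>(ln p))\<close>. The threshold \<open>\<sigma> / 10\<close> is then \<open>4 \<surd>(ln p)\<close> times \<open>s \<sigma>\<close>.
\<close>

lemma prob_proj_noise_bad:
  assumes I: "I \<subseteq> {..<p}" "good I"
  shows "N.prob {z \<in> space N. proj_noise_bad I z} \<le> 1 / real p ^ 2"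
proof -
  define l where "l = ln (real p)"
  have l: "1 \<le> l" unfolding l_def by (rule ln_p_ge_1)
  have one: "N.prob {z \<in> space N. \<sigma> / 10 < \<bar>ip n (synth I (proj_coeff I j)) z\<bar>} \<le> 1 / real p ^ 8"
    if j: "j \<in> {..<p} - I" for j
  proof -
    have "N.prob {z \<in> space N. (4 * sqrt l) * (1 / (40 * sqrt l)) * \<sigma> < \<bar>ip n (synth I (proj_coeff I j)) z\<bar>}
        \<le> 2 * std_normal_density (4 * sqrt l) / (4 * sqrt l)"
    proof (intro gaussian_noise_ip_tail \<sigma>)
      have "ip n (synth I (proj_coeff I j)) (synth I (proj_coeff I j)) \<le> 18 / (10 ^ 6 * l)"
        unfolding l_def using j by (intro proj_norm I) auto
      also have "\<dots> \<le> (1 / (40 * sqrt l))\<^sup>2"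
        using l by (simp add: power_mult_distrib power_divide field_simps)
      finally show "ip n (synth I (proj_coeff I j)) (synth I (proj_coeff I j)) \<le> (1 / (40 * sqrt l))\<^sup>2" .
    qed (use l in auto)
    also have "(4 * sqrt l) * (1 / (40 * sqrt l)) * \<sigma> = \<sigma> / 10" using l by simp
    also have "2 * std_normal_density (4 * sqrt l) / (4 * sqrt l) = exp (- (real 8 * ln p)) * (1 / (2 * sqrt l * sqrt (2 * pi)))"
      using l by (simp add: std_normal_density_def power_mult_distrib l_def field_simps)
    also have "\<dots> \<le> exp (- (real 8 * ln p)) * 1"
    proof (intro mult_left_mono)
      have "1 \<le> sqrt l" using l by simp
      then have l1: "1 \<le> 2 * sqrt l" by linarith
      have "1 \<le> sqrt (2 * pi)" using pi_gt3 by simp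
      then have "1 * 1 \<le> (2 * sqrt l) * sqrt (2 * pi)" using l by (intro mult_mono l1) auto
      then show "1 / (2 * sqrt l * sqrt (2 * pi)) \<le> 1" by (simp add: divide_le_eq_1)
    qed simp
    finally show ?thesis unfolding exp_neg_mult_ln by simp
  qed
  have "N.prob {z \<in> space N. proj_noise_bad I z}
      \<le> N.prob (\<Union>j\<in>{..<p} - I. {z \<in> space N. \<sigma> / 10 < \<bar>ip n (synth I (proj_coeff I j)) z\<bar>})"
    unfolding proj_noise_bad_def by (intro N.finite_measure_mono sets.finite_UN) auto
  also have "\<dots> \<le> (\<Sum>j\<in>{..<p} - I. N.prob {z \<in> space N. \<sigma> / 10 < \<bar>ip n (synth I (proj_coeff I j)) z\<bar>})"
    by (intro N.finite_measure_subadditive_finite) auto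
  also have "\<dots> \<le> (\<Sum>j\<in>{..<p} - I. 1 / real p ^ 8)" by (intro sum_mono one)
  also have "\<dots> \<le> (\<Sum>j<p. 1 / real p ^ 8)" by (intro sum_mono2) auto
  also have "\<dots> = 1 / real p ^ 7" using p by (simp add: field_simps eval_nat_numeral)
  also have "\<dots> \<le> 1 / real p ^ 2" using p by (intro divide_left_mono power_increasing) auto
  finally show ?thesis .
qed

text \<open>
  Off the four exceptional events (support not good, signs, noise along the columns, noise along the
  projections) and a null event for the size of the support, the deterministic bound applies. The three
  events other than the noise along the columns have probability at most \<open>p\<^bsup>-2\<^esup>\<close> each, and
  \<open>p\<^bsup>-2\<^esup> \<le> p\<^bsup>-2 ln 2\<^esup>\<close>.
\<close>

lemma lasso_event_ge:
  "DN.prob {\<omega> \<in> space (D \<Otimes>\<^sub>M N). case \<omega> of (\<beta>, z) \<Rightarrow>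
      \<forall>\<beta>'. is_lasso n p X (\<lambda>i. mat_vec p X \<beta> i + z i) (2 * sqrt (2 * ln (real p)) * \<sigma>) \<beta>' \<longrightarrow>
        (norm2 n (\<lambda>i. mat_vec p X \<beta> i - mat_vec p X \<beta>' i))\<^sup>2
          \<le> 8 * (1 + sqrt 2)\<^sup>2 * (2 * ln (real p)) * real S * \<sigma>\<^sup>2}
    \<ge> 1 - 6 * real p powr (- 2 * ln 2) - real p powr (- 1) * (2 * pi * ln (real p)) powr (- 1 / 2)"
    (is "DN.prob ?G \<ge> _")
proof -
  have \<tau>: "0 < 2 * sqrt (2 * ln (real p)) * \<sigma>" using ln_p_ge_1 \<sigma> by simp
  have G [measurable]: "?G \<in> sets (D \<Otimes>\<^sub>M N)"
    by (rule measurable_lasso_event[OF \<tau> sets_D sets_gaussian_noise])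
  define E0 where "E0 = {b \<in> space D. card (supp p b) \<noteq> S} \<times> space N"
  define E1 where "E1 = {b \<in> space D. \<not> good (supp p b)} \<times> space N"
  define E2 where "E2 = {b \<in> space D. good (supp p b) \<and> sign_bad (supp p b) b} \<times> space N"
  define E3 where "E3 = space D \<times> {z \<in> space N. \<exists>j\<in>{..<p}. 2 * sqrt (ln p) * \<sigma> < \<bar>ip n (v j) z\<bar>}"
  define E4 where "E4 = (\<Union>I\<in>{I \<in> Pow {..<p}. good I}. {b \<in> space D. supp p b = I} \<times> {z \<in> space N. proj_noise_bad I z})"
  have sets_supp: "{b \<in> space D. P (supp p b)} \<in> sets D" for P
  proof -
    have "{b \<in> space D. P (supp p b)} = supp p -` {I. P I} \<inter> space D" by auto
    then show ?thesis using measurable_sets[OF measurable_supp, of "{I. P I}"] by (simp only:) simp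
  qed
  have sets2: "{b \<in> space D. good (supp p b) \<and> sign_bad (supp p b) b} \<in> sets D"
  proof -
    have "{b \<in> space D. good (supp p b) \<and> sign_bad (supp p b) b} =
        (\<Union>I\<in>{I \<in> Pow {..<p}. good I}. {b \<in> space D. sign_bad I b} \<inter> {b \<in> space D. supp p b = I})"
      using supp_subset by auto
    also have "\<dots> \<in> sets D"
      by (intro sets.finite_UN sets.Int measurable_sign_bad supp_event) auto
    finally show ?thesis .
  qed
  have sets3: "{z \<in> space N. \<exists>j\<in>{..<p}. 2 * sqrt (ln p) * \<sigma> < \<bar>ip n (v j) z\<bar>} \<in> sets N"
    by (intro sets.sets_Collect_finite_Ex) auto
  have E [measurable]: "E0 \<in> sets (D \<Otimes>\<^sub>M N)" "E1 \<in> sets (D \<Otimes>\<^sub>M N)" "E2 \<in> sets (D \<Otimes>\<^sub>M N)"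
    "E3 \<in> sets (D \<Otimes>\<^sub>M N)" "E4 \<in> sets (D \<Otimes>\<^sub>M N)"
    unfolding E0_def E1_def E2_def E3_def E4_def using sets_supp sets2 sets3
    by (auto intro!: pair_measureI sets.finite_UN)
  have P0: "DN.prob E0 = 0"
  proof -
    have "DN.prob E0 = D.prob {b \<in> space D. card (supp p b) \<noteq> S}"
      unfolding E0_def by (subst DN.prob_Times[OF sets_supp[of "\<lambda>I. card I \<noteq> S"]]) (auto simp: N.prob_space)
    also have "\<dots> = measure_pmf.prob (pmf_of_set {I. I \<subseteq> {..<p} \<and> card I = S}) {I. card I \<noteq> S}"
      by (rule prob_supp)
    also have "\<dots> = 0"
    proof -
      have "{I. I \<subseteq> {..<p} \<and> card I = S} \<noteq> {}" using S_le by (auto intro!: exI[of _ "{..<S}"])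
      moreover have "{I. I \<subseteq> {..<p} \<and> card I = S} \<inter> {I. card I \<noteq> S} = {}" by auto
      ultimately show ?thesis by (simp add: measure_pmf_of_set)
    qed
    finally show ?thesis .
  qed
  have P1: "DN.prob E1 \<le> 1 / real p ^ 2"
    unfolding E1_def using prob_supp_not_good sets_supp[of "\<lambda>I. \<not> good I"]
    by (subst DN.prob_Times) (auto simp: N.prob_space)
  have P2: "DN.prob E2 \<le> 1 / real p ^ 2"
    unfolding E2_def using prob_sign_bad sets2
    by (subst DN.prob_Times) (auto simp: N.prob_space)
  have P3: "DN.prob E3 \<le> real p powr (- 1) * (2 * pi * ln (real p)) powr (- 1 / 2)"
    unfolding E3_def using prob_noise_large sets3
    by (subst DN.prob_Times) (auto simp: D.prob_space)
  have P4: "DN.prob E4 \<le> 1 / real p ^ 2"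
  proof (rule DN.prob_le_of_conditional_le[where F = "Pow {..<p}" and X = "\<lambda>\<omega>. supp p (fst \<omega>)"])
    have slice: "{\<omega> \<in> space (D \<Otimes>\<^sub>M N). supp p (fst \<omega>) = I} = {b \<in> space D. supp p b = I} \<times> space N" for I
      by (auto simp: space_pair_measure)
    fix I assume I: "I \<in> Pow {..<p}"
    show "{\<omega> \<in> space (D \<Otimes>\<^sub>M N). supp p (fst \<omega>) = I} \<in> sets (D \<Otimes>\<^sub>M N)"
      unfolding slice by (intro pair_measureI supp_event) auto
    have p1: "DN.prob {\<omega> \<in> space (D \<Otimes>\<^sub>M N). supp p (fst \<omega>) = I} = D.prob {b \<in> space D. supp p b = I}"
      unfolding slice by (subst DN.prob_Times[OF supp_event]) (auto simp: N.prob_space)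
    show "DN.prob (E4 \<inter> {\<omega> \<in> space (D \<Otimes>\<^sub>M N). supp p (fst \<omega>) = I})
        \<le> 1 / real p ^ 2 * DN.prob {\<omega> \<in> space (D \<Otimes>\<^sub>M N). supp p (fst \<omega>) = I}"
    proof (cases "good I")
      case True
      have "E4 \<inter> {\<omega> \<in> space (D \<Otimes>\<^sub>M N). supp p (fst \<omega>) = I} = {b \<in> space D. supp p b = I} \<times> {z \<in> space N. proj_noise_bad I z}"
        unfolding slice E4_def using True I by auto
      then have "DN.prob (E4 \<inter> {\<omega> \<in> space (D \<Otimes>\<^sub>M N). supp p (fst \<omega>) = I})
          = D.prob {b \<in> space D. supp p b = I} * N.prob {z \<in> space N. proj_noise_bad I z}"
        using DN.prob_Times[OF supp_event measurable_proj_noise_bad] by simp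
      also have "\<dots> \<le> D.prob {b \<in> space D. supp p b = I} * (1 / real p ^ 2)"
        using I True by (intro mult_left_mono prob_proj_noise_bad) auto
      finally show ?thesis unfolding p1 by (simp add: mult.commute)
    next
      case False
      then have "E4 \<inter> {\<omega> \<in> space (D \<Otimes>\<^sub>M N). supp p (fst \<omega>) = I} = {}" unfolding slice E4_def by auto
      then show ?thesis by (simp only: measure_empty) simp
    qed
  qed (use supp_subset E in auto)
  have cover: "space (D \<Otimes>\<^sub>M N) - ?G \<subseteq> E0 \<union> (E1 \<union> (E2 \<union> (E3 \<union> E4)))"
  proof (rule subsetI, rule ccontr)
    fix \<omega> assume bad: "\<omega> \<in> space (D \<Otimes>\<^sub>M N) - ?G" and ok: "\<omega> \<notin> E0 \<union> (E1 \<union> (E2 \<union> (E3 \<union> E4)))"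
    obtain \<beta> z where \<omega>: "\<omega> = (\<beta>, z)" by (cases \<omega>)
    have sp: "\<beta> \<in> space D" "z \<in> space N" using bad by (auto simp: \<omega> space_pair_measure)
    define I where "I = supp p \<beta>"
    have I: "I \<subseteq> {..<p}" using supp_subset by (auto simp: I_def)
    have "card I = S" "good I" using ok sp by (auto simp: \<omega> E0_def E1_def I_def)
    have signs: "\<bar>\<Sum>i\<in>I. proj_coeff I j i * sgn (\<beta> i)\<bar> \<le> 1 / 10" if "j < p" "j \<notin> I" for j
      using ok sp \<open>good I\<close> that by (auto simp: \<omega> E2_def sign_bad_def I_def not_less)
    have noise: "\<bar>ip n (v j) z\<bar> \<le> 2 * sqrt (ln p) * \<sigma>" if "j < p" for j
      using ok sp that by (auto simp: \<omega> E3_def not_less)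
    have "\<not> proj_noise_bad I z" using ok sp \<open>good I\<close> I by (auto simp: \<omega> E4_def I_def)
    then have proj_noise: "\<bar>ip n (synth I (proj_coeff I j)) z\<bar> \<le> \<sigma> / 10" if "j < p" "j \<notin> I" for j
      using that by (auto simp: proj_noise_bad_def not_less)
    have "\<omega> \<in> ?G"
      using bad lasso_error_bound[OF I \<open>good I\<close> v \<sigma> _ I_def[symmetric] signs noise proj_noise] sp(1)
      by (auto simp: \<omega> norm2_power2 \<open>card I = S\<close> space_D)
    then show False using bad by simp
  qed
  have "1 - DN.prob ?G = DN.prob (space (D \<Otimes>\<^sub>M N) - ?G)" by (rule DN.prob_compl[OF G, symmetric])
  also have "\<dots> \<le> DN.prob (E0 \<union> (E1 \<union> (E2 \<union> (E3 \<union> E4))))"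
    using cover by (intro DN.finite_measure_mono) auto
  also have "\<dots> \<le> DN.prob E0 + (DN.prob E1 + (DN.prob E2 + (DN.prob E3 + DN.prob E4)))"
    by (intro order_trans[OF measure_Un_le] add_mono order_refl) auto
  also have "\<dots> \<le> 3 / real p ^ 2 + real p powr (- 1) * (2 * pi * ln (real p)) powr (- 1 / 2)"
    using P0 P1 P2 P3 P4 by simp
  also have "3 / real p ^ 2 \<le> 6 * real p powr (- 2 * ln 2)"
  proof -
    have "real p powr (- 2) \<le> real p powr (- 2 * ln 2)"
      using p ln_2_less_1 by (intro powr_mono) auto
    moreover have "3 / real p ^ 2 = 3 * real p powr (- 2)"
      using p by (simp add: powr_minus_divide powr_numeral)
    ultimately show ?thesis using powr_ge_zero[of "real p" "- 2 * ln 2"] by linarith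
  qed
  finally show ?thesis by simp
qed

end

theorem theorem1p2:
  "\<exists>A\<^sub>0>0. \<exists>c\<^sub>0>0.
     \<forall>(n::nat) (p::nat) (X :: nat \<Rightarrow> nat \<Rightarrow> real) (\<sigma>::real) (S::nat) (D :: (nat \<Rightarrow> real) measure).
       p \<ge> 2 \<longrightarrow>
       unit_columns n p X \<longrightarrow>
       coherence n p X \<le> A\<^sub>0 / ln (real p) \<longrightarrow>
       \<sigma> > 0 \<longrightarrow>
       S \<ge> 1 \<longrightarrow>
       real S \<le> c\<^sub>0 * real p / ((op_norm n p X)\<^sup>2 * ln (real p)) \<longrightarrow>
       generic_sparse p S D \<longrightarrow>
       \<P>((\<beta>, z) in D \<Otimes>\<^sub>M gaussian_noise n \<sigma>.
           \<forall>\<beta>'. is_lasso n p X (\<lambda>i. mat_vec p X \<beta> i + z i) (2 * sqrt (2 * ln (real p)) * \<sigma>) \<beta>' \<longrightarrow>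
             (norm2 n (\<lambda>i. mat_vec p X \<beta> i - mat_vec p X \<beta>' i))\<^sup>2
               \<le> 8 * (1 + sqrt 2)\<^sup>2 * (2 * ln (real p)) * real S * \<sigma>\<^sup>2)
         \<ge> 1 - 6 * real p powr (- 2 * ln 2)
             - real p powr (- 1) * (2 * pi * ln (real p)) powr (- 1 / 2)"
proof (rule exI[of _ "1 / 4000"], rule conjI, simp, rule exI[of _ "1 / (3 * 10 ^ 6)"], rule conjI, simp,
    intro allI impI)
  fix n p S :: nat and X :: "nat \<Rightarrow> nat \<Rightarrow> real" and \<sigma> :: real and D :: "(nat \<Rightarrow> real) measure"
  assume p2: "2 \<le> p" and cols: "unit_columns n p X" and coh: "coherence n p X \<le> 1 / 4000 / ln (real p)"
    and \<sigma>: "0 < \<sigma>" and S1: "1 \<le> S"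
    and S: "real S \<le> 1 / (3 * 10 ^ 6) * real p / ((op_norm n p X)\<^sup>2 * ln (real p))"
    and model: "generic_sparse p S D"
  define v where "v = (\<lambda>j i. X i j)"
  define B where "B = (op_norm n p X)\<^sup>2"
  define l where "l = ln (real p)"
  have l: "1 / 2 \<le> l"
  proof -
    have "ln 2 \<le> l" unfolding l_def using p2 by simp
    then show ?thesis using ln2_ge_two_thirds by simp
  qed
  have unit: "ip n (v j) (v j) = 1" if "j < p" for j
    using cols that by (simp add: unit_columns_def v_def flip: norm2_power2)
  have frame: "(\<Sum>i<p. (ip n (v i) y)\<^sup>2) \<le> B * ip n y y" for y
  proof (rule frame_bound_analysis)
    fix x
    have "ip n (\<lambda>k. \<Sum>i<p. x i * v i k) (\<lambda>k. \<Sum>i<p. x i * v i k) = ip n (mat_vec p X x) (mat_vec p X x)"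
      by (simp add: mat_vec_def[abs_def] v_def mult.commute)
    then show "ip n (\<lambda>k. \<Sum>i<p. x i * v i k) (\<lambda>k. \<Sum>i<p. x i * v i k) \<le> B * (\<Sum>i<p. (x i)\<^sup>2)"
      using op_norm_bound[of n p X x] by (simp add: B_def ip_def[of p] power2_eq_square)
  qed (simp_all add: B_def)
  have B1: "1 \<le> B"
    using frame_bound_ge_self[of "{..<p}" 0 B n v] frame unit[of 0] p2 by (simp add: B_def)
  have SB: "real S * (B * l) \<le> real p / (3 * 10 ^ 6)"
  proof -
    have "0 < B * l" using B1 l by simp
    moreover have "real S \<le> (real p / (3 * 10 ^ 6)) / (B * l)" using S by (simp add: B_def l_def)
    ultimately show ?thesis by (simp only: pos_le_divide_eq)
  qed
  (* For p = 2 the sparsity condition leaves no positive S. *)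
  have p3: "3 \<le> p"
  proof (rule ccontr)
    assume "\<not> 3 \<le> p"
    then have "p = 2" using p2 by simp
    have "1 * (1 * (1 / 2)) \<le> real S * (B * l)" using S1 B1 l by (intro mult_mono) auto
    then show False using SB \<open>p = 2\<close> by simp
  qed
  interpret D: prob_space D using model by (simp add: generic_sparse_def)
  interpret lasso_model n p v B "real S / real p" D X \<sigma> S
  proof unfold_locales
    fix i j assume "i < p" "j < p" "i \<noteq> j"
    then show "\<bar>ip n (v i) (v j)\<bar> \<le> 1 / (4000 * ln (real p))"
      using abs_ip_le_coherence[of i p j n X] coh by (simp add: v_def)
  next
    show "real S / real p * B \<le> 1 / (3 * 10 ^ 6 * ln (real p))"
      using SB p2 l by (simp add: l_def field_simps)
    show "real S / real p \<le> 1" using model p2 by (simp add: generic_sparse_def)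
  qed (use p3 unit frame B1 \<sigma> model in \<open>auto simp: v_def\<close>)
  (* The probability notation with a pair pattern unfolds to the left-hand set. *)
  have set_eq: "{(\<beta>, z). (\<beta>, z) \<in> \<Omega> \<and> Q \<beta> z} = {\<omega> \<in> \<Omega>. case \<omega> of (\<beta>, z) \<Rightarrow> Q \<beta> z}"
    for \<Omega> :: "((nat \<Rightarrow> real) \<times> (nat \<Rightarrow> real)) set" and Q by auto
  show "\<P>((\<beta>, z) in D \<Otimes>\<^sub>M gaussian_noise n \<sigma>.
           \<forall>\<beta>'. is_lasso n p X (\<lambda>i. mat_vec p X \<beta> i + z i) (2 * sqrt (2 * ln (real p)) * \<sigma>) \<beta>' \<longrightarrow>
             (norm2 n (\<lambda>i. mat_vec p X \<beta> i - mat_vec p X \<beta>' i))\<^sup>2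
               \<le> 8 * (1 + sqrt 2)\<^sup>2 * (2 * ln (real p)) * real S * \<sigma>\<^sup>2)
         \<ge> 1 - 6 * real p powr (- 2 * ln 2)
             - real p powr (- 1) * (2 * pi * ln (real p)) powr (- 1 / 2)"
    unfolding set_eq by (rule lasso_event_ge)
qed

end
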